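(* Let $\lambda\in(0,r^\alpha)$, and let $\Phi,\Psi$ be closed subsets of $K$ with $R(\Phi,\Psi)>0$. Then there exists $u=u_{\Phi,\Psi}\in\mathcal D_K$ with $u=1$ on $\Phi$ and $u=0$ on $\Psi$, and $$R(\Phi,\Psi)^{-1}=\mathcal E_K[u_{\Phi,\Psi}]=\inf\{\mathcal E_K[u']: u'\in\mathcal D_K,\ u'=1\text{ on }\Phi,\ u'=0\text{ on }\Psi\};$$ moreover $u_{\Phi,\Psi}$ is the unique minimizer of this infimum in $\mathcal D_K$.
   Context: Let $\{S_i\}_{i=1}^N$ ($N\ge2$) be contractive similitudes of $\mathbb R^d$ with ratios $r_i\in(0,1)$ satisfying the open set condition; $K$ the self-similar set, $\alpha$ its Hausdorff dimension, $\nu$ the normalized $\alpha$-Hausdorff measure on $K$, $r=\min r_i$. $\Sigma^*$ finite words over $\{1,\dots,N\}$ with empty word $\vartheta$, $S_{\mathbf x}=S_{i_1}\circ\cdots\circ S_{i_k}$, $r_{\mathbf x}=r_{i_1}\cdots r_{i_k}$. $\mathcal J_0=\{\vartheta\}$, $\mathcal J_n=\{i_1\cdots i_k: r_{i_1\cdots i_k}\le r^n<r_{i_1\cdots i_{k-1}}\}$, $X=\bigcup_n\mathcal J_n$, $X_n=\bigcup_{k\le n}\mathcal J_k$, $|\mathbf x|=n$ on $\mathcal J_n$, parent $\mathbf x^-$ the prefix in $\mathcal J_{n-1}$. Edges: $\{\mathbf x,\mathbf x^-\}$ and horizontal $\{\mathbf x,\mathbf y\}$, $\mathbf x\ne\mathbf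 y\in\mathcal J_n$, with $\inf_{\xi,\eta\in K}|S_{\mathbf x}(\xi)-S_{\mathbf y}(\eta)|\le\gamma r^n$. Geodesic rays $(\mathbf x_n)$ ($\mathbf x_n\in\mathcal J_n$, each a prefix of the next) converge to $\xi$ if $\xi\in S_{\mathbf x_n}(K)$ for all $n$. The $\lambda$-NRW is the reversible Markov chain with symmetric conductances $c(\mathbf x,\mathbf x^-)=r_{\mathbf x}^\alpha\lambda^{-|\mathbf x|}$, $c(\mathbf x,\mathbf y)=r^{\alpha|\mathbf x|}\lambda^{-|\mathbf x|}$ on horizontal edges, zero otherwise, $P(\mathbf x,\mathbf y)=c(\mathbf x,\mathbf y)/\sum_{\mathbf z}c(\mathbf x,\mathbf z)$; its Martin boundary is identified with $K$, its hitting distribution from $\vartheta$ is $\nu$, and $K(\mathbf x,\xi)$ is the Martin kernel (density w.r.t. $\nu$ of the hitting distribution from $\mathbf x$). $Hu(\mathbf x)=\int_KK(\mathbf x,\xi)u(\xi)d\nu(\xi)$; $\mathcal E_X[f]=\frac12\sum_{\mathbf x\sim\mathbf y}c(\mathbf x,\mathbf y)(f(\mathbf x)-f(\mathbf y))^2$; $\mathcal E_K[u]=\mathcal E_X[Hu]$ on $\mathcal D_K=\{u\in L^2(K,\nu):\mathcal E_K[u]<\infty\}$ (equal to the Besov space $\Lambda^{\alpha,\beta/2}_{2,2}$, $\beta=\log\lambda/\log r$; its elements are continuous when $\lambda<r^\alpha$). Effective resistance in $X_n$: $R_{X_n}(E,F)=(\min\{\mathcal E_{X_n}[f]: f=1$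 on $E$, $0$ on $F\})^{-1}$ for disjoint nonempty $E,F$, $0$ if they intersect. With a $\kappa$-sequence (maps $\kappa_n:K\to\mathcal J_n$ such that $(\kappa_n(\xi))_n$ is a geodesic ray converging to $\xi$), the limiting resistance of closed $\Phi,\Psi\subset K$ is $R(\Phi,\Psi)=\lim_nR_{X_n}(\kappa_n(\Phi),\kappa_n(\Psi))$, which exists and is independent of the $\kappa$-sequence. *)

theory Defs
  imports "HOL-Analysis.Analysis" "HOL-Library.Sublist"
begin

definition similitude :: "('a::real_normed_vector \<Rightarrow> 'a) \<Rightarrow> real \<Rightarrow> bool" where
  "similitude f c \<longleftrightarrow> (\<forall>x y. dist (f x) (f y) = c * dist x y)"

definition osc :: "nat \<Rightarrow> (nat \<Rightarrow> 'a::metric_space \<Rightarrow> 'a) \<Rightarrow> bool" where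
  "osc N S \<longleftrightarrow> (\<exists>V. open V \<and> V \<noteq> {} \<and> (\<forall>i\<in>{1..N}. S i ` V \<subseteq> V) \<and>
     (\<forall>i\<in>{1..N}. \<forall>j\<in>{1..N}. i \<noteq> j \<longrightarrow> S i ` V \<inter> S j ` V = {}))"

definition hpow :: "real \<Rightarrow> 'a::metric_space set \<Rightarrow> ennreal" where
  "hpow s A = (if A = {} then 0 else if s = 0 then 1 else ennreal (diameter A powr s))"

definition hausdorff_approx :: "real \<Rightarrow> real \<Rightarrow> 'a::metric_space set \<Rightarrow> ennreal" where
  "hausdorff_approx s \<delta> A =
     (INF C \<in> {C :: nat \<Rightarrow> 'a set. A \<subseteq> (\<Union>i. C i) \<and> (\<forall>i. bounded (C i) \<and> diameter (C i) \<le> \<delta>)}.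
        (\<Sum>i. hpow s (C i)))"

definition hausdorff_measure :: "real \<Rightarrow> 'a::metric_space set \<Rightarrow> ennreal" where
  "hausdorff_measure s A = (SUP \<delta>\<in>{0<..}. hausdorff_approx s \<delta> A)"

definition hausdorff_dim :: "'a::metric_space set \<Rightarrow> real" where
  "hausdorff_dim A = Inf {s. 0 \<le> s \<and> hausdorff_measure s A = 0}"

definition nu :: "'a::euclidean_space set \<Rightarrow> 'a measure" where
  "nu K = measure_of UNIV (sets borel)
     (\<lambda>B. hausdorff_measure (hausdorff_dim K) (B \<inter> K) / hausdorff_measure (hausdorff_dim K) K)"

fun Sw :: "(nat \<Rightarrow> 'a \<Rightarrow> 'a) \<Rightarrow> nat list \<Rightarrow> 'a \<Rightarrow> 'a" where
  "Sw S [] = id"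
| "Sw S (i # w) = S i \<circ> Sw S w"

definition rw :: "(nat \<Rightarrow> real) \<Rightarrow> nat list \<Rightarrow> real" where
  "rw \<rho> w = prod_list (map \<rho> w)"

definition rmin :: "nat \<Rightarrow> (nat \<Rightarrow> real) \<Rightarrow> real" where
  "rmin N \<rho> = Min (\<rho> ` {1..N})"

fun J :: "nat \<Rightarrow> (nat \<Rightarrow> real) \<Rightarrow> nat \<Rightarrow> nat list set" where
  "J N \<rho> 0 = {[]}"
| "J N \<rho> (Suc n) = {w. w \<noteq> [] \<and> set w \<subseteq> {1..N} \<and>
      rw \<rho> w \<le> rmin N \<rho> ^ Suc n \<and> rmin N \<rho> ^ Suc n < rw \<rho> (butlast w)}"

definition Xn :: "nat \<Rightarrow> (nat \<Rightarrow> real) \<Rightarrow> nat \<Rightarrow> nat list set" where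
  "Xn N \<rho> n = (\<Union>k\<le>n. J N \<rho> k)"

definition lev :: "nat \<Rightarrow> (nat \<Rightarrow> real) \<Rightarrow> nat list \<Rightarrow> nat" where
  "lev N \<rho> x = (THE n. x \<in> J N \<rho> n)"

definition gap :: "(nat \<Rightarrow> 'a::metric_space \<Rightarrow> 'a) \<Rightarrow> 'a set \<Rightarrow> nat list \<Rightarrow> nat list \<Rightarrow> real" where
  "gap S K x y = Inf {dist (Sw S x \<xi>) (Sw S y \<eta>) | \<xi> \<eta>. \<xi> \<in> K \<and> \<eta> \<in> K}"

definition cond :: "nat \<Rightarrow> (nat \<Rightarrow> 'a::euclidean_space \<Rightarrow> 'a) \<Rightarrow> (nat \<Rightarrow> real) \<Rightarrow> 'a set \<Rightarrow> real \<Rightarrow> real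
    \<Rightarrow> nat list \<Rightarrow> nat list \<Rightarrow> real" where
  "cond N S \<rho> K \<gamma> lam x y =
    (let \<alpha> = hausdorff_dim K; r = rmin N \<rho> in
     if (\<exists>n. x \<in> J N \<rho> (Suc n) \<and> y \<in> J N \<rho> n \<and> prefix y x)
       then rw \<rho> x powr \<alpha> * lam powr (- real (lev N \<rho> x))
     else if (\<exists>n. y \<in> J N \<rho> (Suc n) \<and> x \<in> J N \<rho> n \<and> prefix x y)
       then rw \<rho> y powr \<alpha> * lam powr (- real (lev N \<rho> y))
     else if (\<exists>n. x \<in> J N \<rho> n \<and> y \<in> J N \<rho> n \<and> x \<noteq> y \<and> gap S K x y \<le> \<gamma> * r ^ n)
       then r powr (\<alpha> * real (lev N \<rho> x)) * lam powr (- real (lev N \<rho> x))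
     else 0)"

definition nbrs :: "nat \<Rightarrow> (nat \<Rightarrow> 'a::euclidean_space \<Rightarrow> 'a) \<Rightarrow> (nat \<Rightarrow> real) \<Rightarrow> 'a set \<Rightarrow> real \<Rightarrow> real
    \<Rightarrow> nat list \<Rightarrow> nat list set" where
  "nbrs N S \<rho> K \<gamma> lam x = {y. cond N S \<rho> K \<gamma> lam x y \<noteq> 0}"

definition trans_prob :: "nat \<Rightarrow> (nat \<Rightarrow> 'a::euclidean_space \<Rightarrow> 'a) \<Rightarrow> (nat \<Rightarrow> real) \<Rightarrow> 'a set \<Rightarrow> real \<Rightarrow> real
    \<Rightarrow> nat list \<Rightarrow> nat list \<Rightarrow> real" where
  "trans_prob N S \<rho> K \<gamma> lam x y =
     cond N S \<rho> K \<gamma> lam x y / (\<Sum>z\<in>nbrs N S \<rho> K \<gamma> lam x. cond N S \<rho> K \<gamma> lam x z)"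

fun Pn :: "nat \<Rightarrow> (nat \<Rightarrow> 'a::euclidean_space \<Rightarrow> 'a) \<Rightarrow> (nat \<Rightarrow> real) \<Rightarrow> 'a set \<Rightarrow> real \<Rightarrow> real
    \<Rightarrow> nat \<Rightarrow> nat list \<Rightarrow> nat list \<Rightarrow> real" where
  "Pn N S \<rho> K \<gamma> lam 0 x y = (if x = y then 1 else 0)"
| "Pn N S \<rho> K \<gamma> lam (Suc n) x y =
     (\<Sum>z\<in>nbrs N S \<rho> K \<gamma> lam x. trans_prob N S \<rho> K \<gamma> lam x z * Pn N S \<rho> K \<gamma> lam n z y)"

definition green :: "nat \<Rightarrow> (nat \<Rightarrow> 'a::euclidean_space \<Rightarrow> 'a) \<Rightarrow> (nat \<Rightarrow> real) \<Rightarrow> 'a set \<Rightarrow> real \<Rightarrow> real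
    \<Rightarrow> nat list \<Rightarrow> nat list \<Rightarrow> real" where
  "green N S \<rho> K \<gamma> lam x y = (\<Sum>n. Pn N S \<rho> K \<gamma> lam n x y)"

definition geo_ray :: "nat \<Rightarrow> (nat \<Rightarrow> 'a \<Rightarrow> 'a) \<Rightarrow> (nat \<Rightarrow> real) \<Rightarrow> 'a set \<Rightarrow> 'a
    \<Rightarrow> (nat \<Rightarrow> nat list) \<Rightarrow> bool" where
  "geo_ray N S \<rho> K \<xi> xs \<longleftrightarrow>
     (\<forall>n. xs n \<in> J N \<rho> n \<and> prefix (xs n) (xs (Suc n)) \<and> \<xi> \<in> Sw S (xs n) ` K)"

text \<open>Martin kernel K(x,xi): limit of Green function ratios G(x,y)/G(root,y) as y tends
  to the boundary point xi (along a geodesic ray converging to xi).\<close>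
definition martin :: "nat \<Rightarrow> (nat \<Rightarrow> 'a::euclidean_space \<Rightarrow> 'a) \<Rightarrow> (nat \<Rightarrow> real) \<Rightarrow> 'a set \<Rightarrow> real \<Rightarrow> real
    \<Rightarrow> nat list \<Rightarrow> 'a \<Rightarrow> real" where
  "martin N S \<rho> K \<gamma> lam x \<xi> =
     (let ys = (SOME ys. geo_ray N S \<rho> K \<xi> ys) in
      lim (\<lambda>n. green N S \<rho> K \<gamma> lam x (ys n) / green N S \<rho> K \<gamma> lam [] (ys n)))"

definition Hext :: "nat \<Rightarrow> (nat \<Rightarrow> 'a::euclidean_space \<Rightarrow> 'a) \<Rightarrow> (nat \<Rightarrow> real) \<Rightarrow> 'a set \<Rightarrow> real \<Rightarrow> real
    \<Rightarrow> ('a \<Rightarrow> real) \<Rightarrow> nat list \<Rightarrow> real" where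
  "Hext N S \<rho> K \<gamma> lam u x = (\<integral>\<xi>. martin N S \<rho> K \<gamma> lam x \<xi> * u \<xi> \<partial>nu K)"

text \<open>Energy on X: (1/2) sum over ordered pairs (c vanishes off edges).\<close>
definition energyX :: "nat \<Rightarrow> (nat \<Rightarrow> 'a::euclidean_space \<Rightarrow> 'a) \<Rightarrow> (nat \<Rightarrow> real) \<Rightarrow> 'a set \<Rightarrow> real \<Rightarrow> real
    \<Rightarrow> (nat list \<Rightarrow> real) \<Rightarrow> ennreal" where
  "energyX N S \<rho> K \<gamma> lam f =
     (\<integral>\<^sup>+ p. ennreal (cond N S \<rho> K \<gamma> lam (fst p) (snd p) * (f (fst p) - f (snd p))\<^sup>2)
        \<partial>count_space UNIV) / 2"

definition EK :: "nat \<Rightarrow> (nat \<Rightarrow> 'a::euclidean_space \<Rightarrow> 'a) \<Rightarrow> (nat \<Rightarrow> real) \<Rightarrow> 'a set \<Rightarrow> real \<Rightarrow> real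
    \<Rightarrow> ('a \<Rightarrow> real) \<Rightarrow> ennreal" where
  "EK N S \<rho> K \<gamma> lam u = energyX N S \<rho> K \<gamma> lam (Hext N S \<rho> K \<gamma> lam u)"

definition DK :: "nat \<Rightarrow> (nat \<Rightarrow> 'a::euclidean_space \<Rightarrow> 'a) \<Rightarrow> (nat \<Rightarrow> real) \<Rightarrow> 'a set \<Rightarrow> real \<Rightarrow> real
    \<Rightarrow> ('a \<Rightarrow> real) set" where
  "DK N S \<rho> K \<gamma> lam = {u. u \<in> borel_measurable (nu K) \<and> integrable (nu K) (\<lambda>\<xi>. (u \<xi>)\<^sup>2) \<and>
      EK N S \<rho> K \<gamma> lam u < top}"

definition energyXn :: "nat \<Rightarrow> (nat \<Rightarrow> 'a::euclidean_space \<Rightarrow> 'a) \<Rightarrow> (nat \<Rightarrow> real) \<Rightarrow> 'a set \<Rightarrow> real \<Rightarrow> real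
    \<Rightarrow> nat \<Rightarrow> (nat list \<Rightarrow> real) \<Rightarrow> real" where
  "energyXn N S \<rho> K \<gamma> lam n f =
     (\<Sum>x\<in>Xn N \<rho> n. \<Sum>y\<in>Xn N \<rho> n. cond N S \<rho> K \<gamma> lam x y * (f x - f y)\<^sup>2) / 2"

definition effres :: "nat \<Rightarrow> (nat \<Rightarrow> 'a::euclidean_space \<Rightarrow> 'a) \<Rightarrow> (nat \<Rightarrow> real) \<Rightarrow> 'a set \<Rightarrow> real \<Rightarrow> real
    \<Rightarrow> nat \<Rightarrow> nat list set \<Rightarrow> nat list set \<Rightarrow> real" where
  "effres N S \<rho> K \<gamma> lam n E F =
     (if E \<inter> F \<noteq> {} then 0
      else 1 / (INF f \<in> {f. (\<forall>x\<in>E. f x = 1) \<and> (\<forall>x\<in>F. f x = 0)}. energyXn N S \<rho> K \<gamma> lam n f))"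

definition kappa_seq :: "nat \<Rightarrow> (nat \<Rightarrow> 'a \<Rightarrow> 'a) \<Rightarrow> (nat \<Rightarrow> real) \<Rightarrow> 'a set
    \<Rightarrow> (nat \<Rightarrow> 'a \<Rightarrow> nat list) \<Rightarrow> bool" where
  "kappa_seq N S \<rho> K \<kappa> \<longleftrightarrow> (\<forall>\<xi>\<in>K. geo_ray N S \<rho> K \<xi> (\<lambda>n. \<kappa> n \<xi>))"

definition Rlim :: "nat \<Rightarrow> (nat \<Rightarrow> 'a::euclidean_space \<Rightarrow> 'a) \<Rightarrow> (nat \<Rightarrow> real) \<Rightarrow> 'a set \<Rightarrow> real \<Rightarrow> real
    \<Rightarrow> 'a set \<Rightarrow> 'a set \<Rightarrow> real" where
  "Rlim N S \<rho> K \<gamma> lam \<Phi> \<Psi> =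
     (let \<kappa> = (SOME \<kappa>. kappa_seq N S \<rho> K \<kappa>) in
      lim (\<lambda>n. effres N S \<rho> K \<gamma> lam n (\<kappa> n ` \<Phi>) (\<kappa> n ` \<Psi>)))"

text \<open>Admissible functions: (continuous representative) equal to 1 on Phi and 0 on Psi.\<close>
definition admissible :: "'a::topological_space set \<Rightarrow> 'a set \<Rightarrow> 'a set \<Rightarrow> ('a \<Rightarrow> real) \<Rightarrow> bool" where
  "admissible K \<Phi> \<Psi> u \<longleftrightarrow> continuous_on K u \<and> (\<forall>\<xi>\<in>\<Phi>. u \<xi> = 1) \<and> (\<forall>\<xi>\<in>\<Psi>. u \<xi> = 0)"

end

theory Submission
  imports Defs
begin

text \<open>
  By Moran's theorem the weights \<open>rw \<rho> x powr \<alpha>\<close> of the children of a vertex add up to the weight of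
  the vertex, so \<open>lam ^ depth x\<close> is harmonic away from the root and the Green function with pole at the
  root is explicit. The ratio \<open>G(x,y) / G([],y)\<close>, as a function of \<open>y\<close>, is a bounded harmonic function
  of the reversed walk, which drifts towards the root. A Harnack chain and a barrier built from Euclidean
  distance show that its oscillation near a boundary point contracts geometrically along the levels, so
  the Martin kernel exists everywhere and is continuous. Green's identity on \<open>X\<^sub>n\<close> then gives the Poisson
  representation: a (super)harmonic function with continuous boundary values \<open>u\<close> equals (dominates) \<open>Hu\<close>.

  Since \<open>lam < r powr \<alpha>\<close>, the conductances grow geometrically and every function of finite energy has a
  continuous trace on \<open>K\<close>. Near-minimizers of the resistance problems on \<open>X\<^sub>n\<close> converge pointwise along a
  subsequence to a function with the right trace, whose energy is the limit of the minimal energies; it is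
  harmonic because it can be perturbed at single vertices, so it is \<open>Hu\<close> for its trace \<open>u\<close>.
  Uniqueness is the parallelogram identity.
\<close>

section \<open>Metric outer measures and Hausdorff measures\<close>

definition metric_separated :: "'a::metric_space set \<Rightarrow> 'a set \<Rightarrow> bool" where
  "metric_separated A B \<longleftrightarrow> (\<exists>d>0. \<forall>x\<in>A. \<forall>y\<in>B. d \<le> dist x y)"

lemma metric_separated_empty [simp]: "metric_separated {} B"
  unfolding metric_separated_def by (intro exI[of _ 1]) auto

lemma ennreal_suminf_tail_tendsto_0:
  fixes f :: "nat \<Rightarrow> ennreal"
  assumes "(\<Sum>k. f k) \<noteq> top"
  shows "(\<lambda>n. \<Sum>k. f (k + n)) \<longlonglongrightarrow> 0"
proof -
  define g where "g k = enn2real (f k)" for k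
  have f: "f k = ennreal (g k)" for k
    using assms by (metis g_def ennreal_enn2real ennreal_suminf_lessD less_top)
  have g: "g k \<ge> 0" for k by (simp add: g_def)
  have summable: "summable g"
    by (rule summable_suminf_not_top) (use assms f g in auto)
  have "(\<lambda>n. ennreal (\<Sum>k. g (k + n))) \<longlonglongrightarrow> ennreal 0"
    by (intro tendsto_ennrealI suminf_exist_split2 summable)
  moreover have "(\<Sum>k. f (k + n)) = ennreal (\<Sum>k. g (k + n))" for n
    unfolding f using g summable
    by (intro suminf_ennreal_eq summable_sums) (auto simp: summable_iff_shift)
  ultimately show ?thesis by simp
qed

lemma ennreal_suminf_le_even_odd:
  fixes f :: "nat \<Rightarrow> ennreal"
  shows "(\<Sum>k. f k) \<le> (\<Sum>k. f (2 * k)) + (\<Sum>k. f (2 * k + 1))"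
proof (rule suminf_le_const)
  fix n
  have "(\<Sum>k<n. f k) \<le> (\<Sum>k<2 * n. f k)" by (intro sum_mono2) auto
  also have "\<dots> = (\<Sum>k<n. f (2 * k)) + (\<Sum>k<n. f (2 * k + 1))"
    by (induction n) (auto simp: algebra_simps)
  also have "\<dots> \<le> (\<Sum>k. f (2 * k)) + (\<Sum>k. f (2 * k + 1))"
    by (intro add_mono sum_le_suminf) auto
  finally show "(\<Sum>k<n. f k) \<le> \<dots>" .
qed auto

definition far_part :: "'a::metric_space set \<Rightarrow> 'a set \<Rightarrow> nat \<Rightarrow> 'a set" where
  "far_part F A k = {x\<in>A. 1 \<le> real k * infdist x F}"

definition shell :: "'a::metric_space set \<Rightarrow> 'a set \<Rightarrow> nat \<Rightarrow> 'a set" where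
  "shell F A k = far_part F A (Suc k) - far_part F A k"

lemma far_part_subset: "far_part F A k \<subseteq> A"
  by (auto simp: far_part_def)

lemma shell_subset: "shell F A k \<subseteq> A"
  using far_part_subset by (auto simp: shell_def)

lemma far_part_0 [simp]: "far_part F A 0 = {}"
  by (simp add: far_part_def)

lemma far_part_mono: "k \<le> l \<Longrightarrow> far_part F A k \<subseteq> far_part F A l"
  unfolding far_part_def
  by (auto elim!: order_trans intro!: mult_right_mono simp: infdist_nonneg)

lemma metric_separated_far_part_shell: "metric_separated (far_part F A k) (shell F A (Suc k))"
proof (cases "k = 0")
  case False
  show ?thesis
    unfolding metric_separated_def
  proof (intro exI[of _ "1 / real k - 1 / real (Suc k)"] conjI ballI)
    show "0 < 1 / real k - 1 / real (Suc k)" using False by (simp add: frac_less2)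
    fix x y assume "x \<in> far_part F A k" "y \<in> shell F A (Suc k)"
    then have "1 / real k \<le> infdist x F" "infdist y F < 1 / real (Suc k)"
      using False by (auto simp: far_part_def shell_def field_simps)
    then show "1 / real k - 1 / real (Suc k) \<le> dist x y"
      using infdist_triangle[of x F y] by linarith
  qed
qed simp

lemma metric_separated_Int_far_part: "metric_separated (A \<inter> F) (far_part F A n)"
  unfolding metric_separated_def
proof (intro exI[of _ "1 / (real n + 1)"] conjI ballI)
  fix x y assume x: "x \<in> A \<inter> F" and y: "y \<in> far_part F A n"
  have "infdist y F \<le> dist x y" using infdist_le[of x F y] x by (simp add: dist_commute)
  then have "real n * infdist y F \<le> (real n + 1) * dist x y"
    by (intro mult_mono) (auto simp: infdist_nonneg)
  then have "1 \<le> (real n + 1) * dist x y" using y by (simp add: far_part_def)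
  then show "1 / (real n + 1) \<le> dist x y" by (simp add: field_simps)
qed simp

lemma Diff_closed_subset_shells:
  assumes "closed F" "F \<noteq> {}"
  shows "A - F \<subseteq> far_part F A n \<union> (\<Union>k. shell F A (k + n))"
proof
  fix x assume x: "x \<in> A - F"
  then have "infdist x F > 0" using assms by (simp add: infdist_pos_not_in_closed)
  then obtain k where "1 < real k * infdist x F" using reals_Archimedean3 by blast
  then have ex: "\<exists>k. x \<in> far_part F A k" using x by (auto simp: far_part_def intro: less_imp_le)
  define m where "m = (LEAST k. x \<in> far_part F A k)"
  have m: "x \<in> far_part F A m" unfolding m_def using ex by (rule LeastI_ex)
  show "x \<in> far_part F A n \<union> (\<Union>k. shell F A (k + n))"
  proof (cases "m \<le> n")
    case True
    then show ?thesis using far_part_mono m by blast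
  next
    case False
    define k where "k = m - Suc n"
    have k: "m = Suc (k + n)" using False by (simp add: k_def)
    then have "x \<notin> far_part F A (k + n)"
      using not_less_Least[of "k + n" "\<lambda>k. x \<in> far_part F A k"] by (simp add: m_def)
    then show ?thesis using m k by (auto simp: shell_def)
  qed
qed

locale metric_outer_measure =
  fixes \<mu> :: "'a::metric_space set \<Rightarrow> ennreal"
  assumes empty [simp]: "\<mu> {} = 0"
    and mono: "A \<subseteq> B \<Longrightarrow> \<mu> A \<le> \<mu> B"
    and UN_le_suminf: "\<mu> (\<Union>i. C i) \<le> (\<Sum>i::nat. \<mu> (C i))"
    and add_le_separated: "metric_separated A B \<Longrightarrow> \<mu> A + \<mu> B \<le> \<mu> (A \<union> B)"
begin

lemma outer_measure_space: "outer_measure_space (Pow UNIV) \<mu>"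
  unfolding outer_measure_space_def positive_def increasing_def countably_subadditive_def
  by (auto simp: mono UN_le_suminf)

lemma Un_le: "\<mu> (A \<union> B) \<le> \<mu> A + \<mu> B"
proof -
  interpret sigma_algebra UNIV "Pow UNIV :: 'a set set" by (rule sigma_algebra_Pow)
  have "subadditive (Pow UNIV) \<mu>"
    using outer_measure_space countably_subadditive_subadditive
    unfolding outer_measure_space_def by blast
  moreover have "\<mu> (A \<union> B) \<le> \<mu> A + \<mu> (B - A)"
    using subadditiveD[OF calculation, of A "B - A"] by (simp add: Un_Diff_cancel)
  ultimately show ?thesis using mono[of "B - A" B] by (meson Diff_subset add_left_mono order_trans)
qed

lemma suminf_le_separated_chain:
  assumes sep: "\<And>k. metric_separated (T k) (C k)" and sub: "\<And>k. C k \<subseteq> T (Suc k)"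
    and T: "\<And>k. T k \<subseteq> T (Suc k)" and A: "\<And>k. C k \<subseteq> A"
  shows "(\<Sum>k. \<mu> (C k)) \<le> \<mu> A"
proof (rule suminf_le_const)
  fix n
  have "(\<Sum>k<n. \<mu> (C k)) \<le> \<mu> (\<Union>k<n. C k) \<and> (\<Union>k<n. C k) \<subseteq> T n"
  proof (induction n)
    case (Suc n)
    have "metric_separated (\<Union>k<n. C k) (C n)"
      using sep[of n] Suc by (fastforce simp: metric_separated_def)
    then have "\<mu> (\<Union>k<n. C k) + \<mu> (C n) \<le> \<mu> ((\<Union>k<n. C k) \<union> C n)" by (rule add_le_separated)
    moreover have "(\<Union>k<Suc n. C k) = (\<Union>k<n. C k) \<union> C n" by (auto simp: less_Suc_eq)
    ultimately show ?case
      using Suc T[of n] sub[of n] by (auto intro: order_trans add_right_mono)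
  qed simp
  moreover have "\<mu> (\<Union>k<n. C k) \<le> \<mu> A" using A by (intro mono) auto
  ultimately show "(\<Sum>k<n. \<mu> (C k)) \<le> \<mu> A" by auto
qed auto

text \<open>Shells are separated when their indices differ by at least two.\<close>

lemma suminf_shell_le: "(\<Sum>k. \<mu> (shell F A k)) \<le> \<mu> A + \<mu> A"
proof -
  have sub: "shell F A k \<subseteq> far_part F A (Suc k)" for k by (auto simp: shell_def)
  have "(\<Sum>k. \<mu> (shell F A (2 * k))) \<le> \<mu> A"
  proof (rule suminf_le_separated_chain[where T = "\<lambda>k. far_part F A (2 * k - 1)"])
    show "metric_separated (far_part F A (2 * k - 1)) (shell F A (2 * k))" for k
      using metric_separated_far_part_shell[of F A "2 * k - 1"] by (cases k) auto
  qed (use sub[of "2 * _"] in \<open>auto intro!: far_part_mono shell_subset\<close>)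
  moreover have "(\<Sum>k. \<mu> (shell F A (2 * k + 1))) \<le> \<mu> A"
    by (rule suminf_le_separated_chain[where T = "\<lambda>k. far_part F A (2 * k)"])
       (use sub[of "Suc (2 * _)"] metric_separated_far_part_shell in
         \<open>auto intro!: far_part_mono shell_subset\<close>)
  ultimately show ?thesis using ennreal_suminf_le_even_odd by (meson add_mono order_trans)
qed

lemma closed_caratheodory:
  assumes F: "closed F"
  shows "\<mu> (A \<inter> F) + \<mu> (A - F) \<le> \<mu> A"
proof (cases "F = {} \<or> \<mu> A = top")
  case False
  let ?tail = "\<lambda>n. \<Sum>k. \<mu> (shell F A (k + n))"
  have "(\<Sum>k. \<mu> (shell F A k)) \<noteq> top"
    using suminf_shell_le[of F A] False by (auto simp: top_unique)
  then have tail: "?tail \<longlonglongrightarrow> 0" by (rule ennreal_suminf_tail_tendsto_0)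
  have "\<mu> (A \<inter> F) + \<mu> (A - F) \<le> \<mu> A + ?tail n" for n
  proof -
    have "\<mu> (A - F) \<le> \<mu> (far_part F A n \<union> (\<Union>k. shell F A (k + n)))"
      using Diff_closed_subset_shells F False by (intro mono) blast
    also have "\<dots> \<le> \<mu> (far_part F A n) + ?tail n"
      by (rule order_trans[OF Un_le add_left_mono[OF UN_le_suminf]])
    finally have "\<mu> (A \<inter> F) + \<mu> (A - F) \<le> (\<mu> (A \<inter> F) + \<mu> (far_part F A n)) + ?tail n"
      by (simp add: add_left_mono add.assoc)
    also have "\<mu> (A \<inter> F) + \<mu> (far_part F A n) \<le> \<mu> (A \<inter> F \<union> far_part F A n)"
      by (rule add_le_separated[OF metric_separated_Int_far_part])
    also have "\<dots> \<le> \<mu> A" using far_part_subset by (intro mono) auto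
    finally show ?thesis by (simp add: add_right_mono)
  qed
  then show ?thesis
    by (intro LIMSEQ_le_const[OF tendsto_add[OF tendsto_const tail, of "\<mu> A", simplified]]) auto
qed auto

theorem borel_measure_space: "measure_space UNIV (sets borel) \<mu>"
proof -
  interpret sigma_algebra UNIV "Pow UNIV :: 'a set set" by (rule sigma_algebra_Pow)
  let ?L = "lambda_system UNIV (Pow UNIV) \<mu>"
  have L: "measure_space UNIV ?L \<mu>" by (rule caratheodory_lemma[OF outer_measure_space])
  interpret L: sigma_algebra UNIV ?L using L by (simp add: measure_space_def)
  have closed_L: "F \<in> ?L" if "closed F" for F
    unfolding lambda_system_eq
  proof (clarsimp, rule antisym)
    fix A
    show "\<mu> (A \<inter> F) + \<mu> (A - F) \<le> \<mu> A" using that by (rule closed_caratheodory)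
    show "\<mu> A \<le> \<mu> (A \<inter> F) + \<mu> (A - F)" using Un_le[of "A \<inter> F" "A - F"] by (simp add: Int_Diff_Un)
  qed
  have "sets (borel :: 'a measure) \<subseteq> ?L"
    unfolding borel_eq_closed
    by (subst sets_measure_of, simp, rule L.sigma_sets_subset) (use closed_L in auto)
  moreover have "sigma_algebra UNIV (sets (borel :: 'a measure))"
    by (metis sets.sigma_algebra_axioms space_borel)
  ultimately show ?thesis using measure_down[OF L] by blast
qed

end

lemma hpow_empty [simp]: "hpow s {} = 0"
  by (simp add: hpow_def)

lemma hausdorff_approx_mono: "A \<subseteq> B \<Longrightarrow> hausdorff_approx s \<delta> A \<le> hausdorff_approx s \<delta> B"
  unfolding hausdorff_approx_def by (intro INF_superset_mono) auto

lemma hausdorff_approx_antimono: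
  "\<delta> \<le> \<delta>' \<Longrightarrow> hausdorff_approx s \<delta>' A \<le> hausdorff_approx s \<delta> A"
  unfolding hausdorff_approx_def by (rule INF_superset_mono) (auto intro: order_trans)

lemma hausdorff_approx_le_suminf:
  assumes "A \<subseteq> (\<Union>i. C i)" "\<And>i. bounded (C i)" "\<And>i. diameter (C i) \<le> \<delta>"
  shows "hausdorff_approx s \<delta> A \<le> (\<Sum>i::nat. hpow s (C i))"
  unfolding hausdorff_approx_def by (rule INF_lower) (use assms in auto)

lemma hausdorff_approx_le_sum:
  assumes "finite I" "A \<subseteq> (\<Union>i\<in>I. C i)" "\<And>i. i \<in> I \<Longrightarrow> bounded (C i)"
    "\<And>i. i \<in> I \<Longrightarrow> diameter (C i) \<le> \<delta>" "0 \<le> \<delta>"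
  shows "hausdorff_approx s \<delta> A \<le> (\<Sum>i\<in>I. hpow s (C i))"
proof -
  obtain h where h: "bij_betw h {..<card I} I"
    using ex_bij_betw_nat_finite[OF assms(1)] by (auto simp: atLeast0LessThan)
  let ?D = "\<lambda>i. if i < card I then C (h i) else {}"
  have hI: "h i \<in> I" if "i < card I" for i using h that by (auto simp: bij_betw_def)
  have "A \<subseteq> (\<Union>i. ?D i)"
  proof
    fix x assume "x \<in> A"
    then obtain i where i: "i \<in> I" "x \<in> C i" using assms(2) by blast
    have "i \<in> h ` {..<card I}" using h i(1) by (simp add: bij_betw_def)
    then obtain j where "j < card I" "h j = i" by auto
    then show "x \<in> (\<Union>i. ?D i)" using i by (auto intro!: exI[of _ j])
  qed
  then have "hausdorff_approx s \<delta> A \<le> (\<Sum>i. hpow s (?D i))"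
    by (rule hausdorff_approx_le_suminf) (use assms hI in auto)
  also have "\<dots> = (\<Sum>i<card I. hpow s (?D i))" by (intro suminf_finite) auto
  also have "\<dots> = (\<Sum>i<card I. hpow s (C (h i)))" by (intro sum.cong) auto
  also have "\<dots> = (\<Sum>i\<in>I. hpow s (C i))" using sum.reindex_bij_betw[OF h] by simp
  finally show ?thesis .
qed

lemma hausdorff_approx_less_cover:
  assumes "hausdorff_approx s \<delta> A < c"
  obtains C :: "nat \<Rightarrow> 'a::metric_space set"
  where "A \<subseteq> (\<Union>i. C i)" "\<And>i. bounded (C i)" "\<And>i. diameter (C i) \<le> \<delta>" "(\<Sum>i. hpow s (C i)) < c"
  using assms unfolding hausdorff_approx_def INF_less_iff by blast

lemma hausdorff_approx_le_measure: "\<delta> > 0 \<Longrightarrow> hausdorff_approx s \<delta> A \<le> hausdorff_measure s A"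
  unfolding hausdorff_measure_def by (intro SUP_upper) auto

lemma hausdorff_measure_mono: "A \<subseteq> B \<Longrightarrow> hausdorff_measure s A \<le> hausdorff_measure s B"
  unfolding hausdorff_measure_def by (intro SUP_mono) (auto intro: hausdorff_approx_mono)

lemma hausdorff_measure_empty [simp]: "hausdorff_measure s {} = 0"
proof -
  have "hausdorff_approx s \<delta> {} = 0" if "\<delta> > 0" for \<delta>
    using hausdorff_approx_le_suminf[of "{}" "\<lambda>_. {}" \<delta> s] that by simp
  then show ?thesis unfolding hausdorff_measure_def by (intro antisym SUP_least) auto
qed

lemma hausdorff_approx_UN_le:
  fixes A :: "nat \<Rightarrow> 'a::metric_space set"
  shows "hausdorff_approx s \<delta> (\<Union>i. A i) \<le> (\<Sum>i. hausdorff_approx s \<delta> (A i))"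
proof (rule ennreal_le_epsilon)
  fix e :: real assume e: "0 < e" and fin: "(\<Sum>n. hausdorff_approx s \<delta> (A n)) < top"
  have "hausdorff_approx s \<delta> (A n) < hausdorff_approx s \<delta> (A n) + ennreal (e * (1/2) ^ Suc n)" for n
    using e ennreal_suminf_lessD[OF fin, of n] by (auto simp: less_top)
  then have "\<exists>B. A n \<subseteq> (\<Union>i. B i) \<and> (\<forall>i::nat. bounded (B i) \<and> diameter (B i) \<le> \<delta>) \<and>
      (\<Sum>i. hpow s (B i)) < hausdorff_approx s \<delta> (A n) + ennreal (e * (1/2) ^ Suc n)" for n
    by (metis hausdorff_approx_less_cover)
  then obtain B where B: "\<And>n. A n \<subseteq> (\<Union>i. B n i)" "\<And>n i. bounded (B n i)"
      "\<And>n i. diameter (B n i) \<le> \<delta>"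
      "\<And>n. (\<Sum>i::nat. hpow s (B n i)) < hausdorff_approx s \<delta> (A n) + ennreal (e * (1/2) ^ Suc n)"
    by metis
  define C where "C = case_prod B \<circ> prod_decode"
  have "(\<Union>i. A i) \<subseteq> (\<Union>i. C i)"
    using B(1) by (auto simp: C_def subset_eq) (metis prod.case prod_encode_inverse)
  then have "hausdorff_approx s \<delta> (\<Union>i. A i) \<le> (\<Sum>i. hpow s (C i))"
    by (rule hausdorff_approx_le_suminf) (auto simp: C_def B split_def)
  also have "\<dots> = (\<Sum>n. \<Sum>i. hpow s (B n i))"
    using suminf_ennreal_2dimen[of "\<lambda>n. \<Sum>i. hpow s (B n i)" "\<lambda>(n, i). hpow s (B n i)"]
    by (simp add: C_def split_def)
  also have "\<dots> \<le> (\<Sum>n. hausdorff_approx s \<delta> (A n) + ennreal (e * (1/2) ^ Suc n))"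
    by (intro suminf_le less_imp_le B) auto
  also have "\<dots> = (\<Sum>n. hausdorff_approx s \<delta> (A n)) + (\<Sum>n. ennreal (e * (1/2) ^ Suc n))"
    by (intro suminf_add[symmetric]) auto
  also have "(\<Sum>n. ennreal (e * (1/2) ^ Suc n)) = ennreal e"
    using sums_mult[OF power_half_series, of e] e by (intro suminf_ennreal_eq) auto
  finally show "hausdorff_approx s \<delta> (\<Union>i. A i) \<le> (\<Sum>n. hausdorff_approx s \<delta> (A n)) + ennreal e" .
qed

lemma hausdorff_measure_UN_le:
  fixes A :: "nat \<Rightarrow> 'a::metric_space set"
  shows "hausdorff_measure s (\<Union>i. A i) \<le> (\<Sum>i. hausdorff_measure s (A i))"
  unfolding hausdorff_measure_def[of s "\<Union>i. A i"]
proof (rule SUP_least)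
  fix \<delta> :: real assume "\<delta> \<in> {0<..}"
  then have "(\<Sum>i. hausdorff_approx s \<delta> (A i)) \<le> (\<Sum>i. hausdorff_measure s (A i))"
    by (intro suminf_le hausdorff_approx_le_measure) auto
  then show "hausdorff_approx s \<delta> (\<Union>i. A i) \<le> (\<Sum>i. hausdorff_measure s (A i))"
    using hausdorff_approx_UN_le order_trans by blast
qed

lemma hausdorff_approx_add_le:
  assumes dist: "\<And>x y. x \<in> A \<Longrightarrow> y \<in> B \<Longrightarrow> d \<le> dist x y" and "0 \<le> \<delta>" "\<delta> < d"
  shows "hausdorff_approx s \<delta> A + hausdorff_approx s \<delta> B \<le> hausdorff_approx s \<delta> (A \<union> B)"
  unfolding hausdorff_approx_def[of s \<delta> "A \<union> B"]
proof (rule INF_greatest, clarify)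
  fix C :: "nat \<Rightarrow> 'a set"
  assume C: "A \<union> B \<subseteq> \<Union> (range C)" "\<forall>i. bounded (C i) \<and> diameter (C i) \<le> \<delta>"
  define C' where "C' D i = (if C i \<inter> D = {} then {} else C i)" for D i
  have meets_one: "C i \<inter> A = {} \<or> C i \<inter> B = {}" for i
  proof (rule ccontr)
    assume "\<not> ?thesis"
    then obtain x y where "x \<in> C i" "x \<in> A" "y \<in> C i" "y \<in> B" by auto
    then have "d \<le> diameter (C i)" using dist C(2) diameter_bounded_bound by fastforce
    then show False using C(2) \<open>\<delta> < d\<close> by (meson le_less_trans not_le)
  qed
  have approx: "hausdorff_approx s \<delta> D \<le> (\<Sum>i. hpow s (C' D i))" if "D \<subseteq> A \<union> B" for D
  proof (rule hausdorff_approx_le_suminf)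
    show "D \<subseteq> (\<Union>i. C' D i)" using C(1) that by (fastforce simp: C'_def)
  qed (use C(2) \<open>0 \<le> \<delta>\<close> in \<open>auto simp: C'_def\<close>)
  have "hausdorff_approx s \<delta> A + hausdorff_approx s \<delta> B \<le> (\<Sum>i. hpow s (C' A i)) + (\<Sum>i. hpow s (C' B i))"
    by (intro add_mono approx) auto
  also have "\<dots> = (\<Sum>i. hpow s (C' A i) + hpow s (C' B i))" by (intro suminf_add) auto
  also have "\<dots> \<le> (\<Sum>i. hpow s (C i))"
    by (intro suminf_le) (use meets_one in \<open>auto simp: C'_def\<close>)
  finally show "hausdorff_approx s \<delta> A + hausdorff_approx s \<delta> B \<le> (\<Sum>i. hpow s (C i))" .
qed

lemma hausdorff_measure_add_le_separated:
  assumes "metric_separated A B"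
  shows "hausdorff_measure s A + hausdorff_measure s B \<le> hausdorff_measure s (A \<union> B)"
proof -
  obtain d where d: "d > 0" "\<And>x y. x \<in> A \<Longrightarrow> y \<in> B \<Longrightarrow> d \<le> dist x y"
    using assms by (auto simp: metric_separated_def)
  have approx_le: "hausdorff_approx s d1 A + hausdorff_approx s d2 B \<le> hausdorff_measure s (A \<union> B)"
    if "d1 > 0" "d2 > 0" for d1 d2
  proof -
    define \<delta> where "\<delta> = min (d / 2) (min d1 d2)"
    have \<delta>: "\<delta> > 0" "\<delta> < d" "\<delta> \<le> d1" "\<delta> \<le> d2" using that d(1) by (auto simp: \<delta>_def min_def)
    have "hausdorff_approx s d1 A + hausdorff_approx s d2 B
        \<le> hausdorff_approx s \<delta> A + hausdorff_approx s \<delta> B"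
      using \<delta> by (intro add_mono hausdorff_approx_antimono)
    also have "\<dots> \<le> hausdorff_approx s \<delta> (A \<union> B)"
      by (rule hausdorff_approx_add_le) (use d(2) \<delta> in auto)
    also have "\<dots> \<le> hausdorff_measure s (A \<union> B)" using \<delta>(1) by (rule hausdorff_approx_le_measure)
    finally show ?thesis .
  qed
  have ne: "{0::real<..} \<noteq> {}" by (auto intro: exI[of _ 1])
  have "hausdorff_measure s A + hausdorff_measure s B
      = (SUP d1\<in>{0<..}. hausdorff_approx s d1 A + hausdorff_measure s B)"
    unfolding hausdorff_measure_def[of s A] by (rule ennreal_SUP_add_left[OF ne, symmetric])
  also have "\<dots> = (SUP d1\<in>{0<..}. SUP d2\<in>{0<..}. hausdorff_approx s d1 A + hausdorff_approx s d2 B)"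
    unfolding hausdorff_measure_def[of s B] by (simp add: ennreal_SUP_add_right[OF ne])
  also have "\<dots> \<le> hausdorff_measure s (A \<union> B)" by (intro SUP_least approx_le) auto
  finally show ?thesis .
qed

interpretation hausdorff: metric_outer_measure "hausdorff_measure s"
  by unfold_locales
     (auto intro: hausdorff_measure_mono hausdorff_measure_UN_le hausdorff_measure_add_le_separated)

lemma diameter_similitude_image:
  assumes f: "similitude f c" and c: "c > 0" and "bounded C"
  shows "diameter (f ` C) = c * diameter C" "bounded (f ` C)"
proof -
  have le: "dist (f x) (f y) \<le> c * diameter C" if "x \<in> C" "y \<in> C" for x y
    using that f c diameter_bounded_bound[OF \<open>bounded C\<close>] by (auto simp: similitude_def)
  then show bounded: "bounded (f ` C)" unfolding bounded_two_points by blast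
  show "diameter (f ` C) = c * diameter C"
  proof (cases "C = {}")
    case False
    have "diameter C \<le> diameter (f ` C) / c"
    proof (rule diameter_le)
      fix x y assume "x \<in> C" "y \<in> C"
      then have "dist (f x) (f y) \<le> diameter (f ` C)" by (intro diameter_bounded_bound bounded) auto
      then show "norm (x - y) \<le> diameter (f ` C) / c"
        using f c by (simp add: similitude_def dist_norm field_simps)
    qed (use False in simp)
    moreover have "diameter (f ` C) \<le> c * diameter C"
      using le False by (intro diameter_le) (auto simp: dist_norm)
    ultimately show ?thesis using c by (simp add: field_simps)
  qed simp
qed

lemma hpow_similitude_image:
  assumes "similitude f c" "c > 0" "bounded C"
  shows "hpow s (f ` C) = ennreal (c powr s) * hpow s C"
  using assms diameter_ge_0[OF \<open>bounded C\<close>]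
  by (auto simp: hpow_def diameter_similitude_image powr_mult ennreal_mult)

lemma hausdorff_approx_similitude_image_le:
  assumes f: "similitude f c" and c: "c > 0"
  shows "hausdorff_approx s \<delta> (f ` A) \<le> ennreal (c powr s) * hausdorff_approx s (\<delta> / c) A"
proof -
  have "hausdorff_approx s \<delta> (f ` A) \<le> ennreal (c powr s) * (\<Sum>i. hpow s (C i))"
    if C: "A \<subseteq> \<Union> (range C)" "\<forall>i. bounded (C i) \<and> diameter (C i) \<le> \<delta> / c" for C :: "nat \<Rightarrow> 'a set"
  proof -
    have "hausdorff_approx s \<delta> (f ` A) \<le> (\<Sum>i. hpow s (f ` C i))"
    proof (rule hausdorff_approx_le_suminf)
      show "f ` A \<subseteq> (\<Union>i. f ` C i)" using C(1) by blast
    qed (use C(2) f c in \<open>auto simp: diameter_similitude_image field_simps\<close>)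
    also have "\<dots> = (\<Sum>i. ennreal (c powr s) * hpow s (C i))"
      using C(2) f c by (simp add: hpow_similitude_image)
    finally show ?thesis by simp
  qed
  then have "hausdorff_approx s \<delta> (f ` A) / ennreal (c powr s) \<le> hausdorff_approx s (\<delta> / c) A"
    unfolding hausdorff_approx_def[of s "\<delta> / c" A] using c
    by (intro INF_greatest divide_le_posI_ennreal) (auto simp: mult.commute)
  then have "ennreal (c powr s) * (hausdorff_approx s \<delta> (f ` A) / ennreal (c powr s))
      \<le> ennreal (c powr s) * hausdorff_approx s (\<delta> / c) A"
    by (rule mult_left_mono) simp
  then show ?thesis
    unfolding ennreal_times_divide mult.commute[of _ "hausdorff_approx s \<delta> (f ` A)"]
    using c by (subst (asm) mult_divide_eq_ennreal) auto
qed

lemma hausdorff_measure_similitude_image_le: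
  assumes "similitude f c" "c > 0"
  shows "hausdorff_measure s (f ` A) \<le> ennreal (c powr s) * hausdorff_measure s A"
  unfolding hausdorff_measure_def[of s "f ` A"]
proof (rule SUP_least)
  fix \<delta> :: real assume "\<delta> \<in> {0<..}"
  then have "hausdorff_approx s (\<delta> / c) A \<le> hausdorff_measure s A"
    using assms(2) by (intro hausdorff_approx_le_measure) auto
  then show "hausdorff_approx s \<delta> (f ` A) \<le> ennreal (c powr s) * hausdorff_measure s A"
    using hausdorff_approx_similitude_image_le[OF assms] by (meson mult_left_mono order_trans zero_le)
qed

section \<open>Words and cells of a self-similar set\<close>

lemma similitude_surj:
  fixes f :: "'a::euclidean_space \<Rightarrow> 'a"
  assumes "similitude f c" "c > 0"
  shows "surj f"
proof -
  define g where "g x = (1 / c) *\<^sub>R (f x - f 0)" for x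
  have "dist (g x) (g y) = dist x y" for x y
  proof -
    have "dist (g x) (g y) = (1 / c) * dist (f x) (f y)"
      unfolding g_def dist_norm using assms(2) by (simp flip: scaleR_diff_right)
    then show ?thesis using assms by (simp add: similitude_def)
  qed
  then have "orthogonal_transformation g"
    unfolding orthogonal_transformation_isometry by (simp add: g_def)
  then have "surj g" by (rule orthogonal_transformation_surj)
  show ?thesis
    unfolding surj_def
  proof
    fix y
    obtain x where "(1 / c) *\<^sub>R (y - f 0) = g x" using \<open>surj g\<close> unfolding surj_def by blast
    then have "y = f x" using assms(2) by (simp add: g_def)
    then show "\<exists>x. y = f x" ..
  qed
qed

lemma similitude_image_ball:
  fixes f :: "'a::euclidean_space \<Rightarrow> 'a"
  assumes f: "similitude f c" and c: "c > 0"
  shows "f ` ball a e = ball (f a) (c * e)"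
proof (intro equalityI subsetI)
  fix x assume x: "x \<in> ball (f a) (c * e)"
  obtain y where "x = f y" using similitude_surj[OF f c] by (metis surjD)
  then show "x \<in> f ` ball a e" using x f c by (auto simp: similitude_def)
qed (use f c in \<open>auto simp: similitude_def\<close>)

lemma card_disjoint_balls_le:
  fixes c :: "'i \<Rightarrow> 'a::euclidean_space"
  assumes I: "finite I" and disj: "disjoint_family_on (\<lambda>i. ball (c i) \<delta>) I"
    and sub: "\<And>i. i \<in> I \<Longrightarrow> ball (c i) \<delta> \<subseteq> ball p R" and "0 < \<delta>" "0 \<le> R"
  shows "real (card I) \<le> (R / \<delta>) ^ DIM('a)"
proof -
  let ?d = "DIM('a)"
  have vol: "measure lborel (ball x t) = unit_ball_vol (real ?d) * t ^ ?d" if "t \<ge> 0" for x :: 'a and t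
    using content_ball[OF that, of x] by simp
  have meas: "ball x t \<in> fmeasurable lborel" for x :: 'a and t
    using emeasure_lborel_ball_finite by (intro fmeasurableI) auto
  have "real (card I) * (unit_ball_vol (real ?d) * \<delta> ^ ?d) = (\<Sum>i\<in>I. measure lborel (ball (c i) \<delta>))"
    using \<open>0 < \<delta>\<close> by (simp add: vol)
  also have "\<dots> = measure lborel (\<Union>i\<in>I. ball (c i) \<delta>)"
    using disj meas
    by (intro measure_UNION'[symmetric, OF I]) (auto simp: disjoint_family_on_def pairwise_def disjnt_def)
  also have "\<dots> \<le> measure lborel (ball p R)"
    using sub by (intro measure_mono_fmeasurable UN_least meas) (auto intro!: borel_open)
  also have "\<dots> = unit_ball_vol (real ?d) * R ^ ?d" using \<open>0 \<le> R\<close> by (rule vol)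
  finally have "real (card I) * \<delta> ^ ?d \<le> R ^ ?d"
    using unit_ball_vol_pos[of "real ?d"] by (simp add: mult.left_commute)
  then show ?thesis using \<open>0 < \<delta>\<close> by (simp add: power_divide field_simps)
qed

lemma rw_Nil [simp]: "rw \<rho> [] = 1"
  and rw_Cons [simp]: "rw \<rho> (i # w) = \<rho> i * rw \<rho> w"
  and rw_append [simp]: "rw \<rho> (u @ v) = rw \<rho> u * rw \<rho> v"
  by (simp_all add: rw_def)

lemma Sw_append: "Sw S (u @ v) = Sw S u \<circ> Sw S v"
  by (induction u) (auto simp: comp_assoc)

lemma geo_ray_prefix:
  assumes "geo_ray N S \<rho> K \<xi> ys" "m \<le> n"
  shows "prefix (ys m) (ys n)"
  using assms(2)
proof (induction n rule: dec_induct)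
  case (step n)
  then show ?case using assms(1) unfolding geo_ray_def by (meson prefix_order.trans)
qed simp

declare J.simps [simp del]

locale self_similar_set =
  fixes N :: nat and S :: "nat \<Rightarrow> 'a::euclidean_space \<Rightarrow> 'a" and \<rho> :: "nat \<Rightarrow> real" and K :: "'a set"
  assumes N_ge_2: "N \<ge> 2"
    and contractions: "\<forall>i\<in>{1..N}. 0 < \<rho> i \<and> \<rho> i < 1 \<and> similitude (S i) (\<rho> i)"
    and osc: "osc N S"
    and K_compact: "compact K" and K_nonempty: "K \<noteq> {}" and K_eq: "K = (\<Union>i\<in>{1..N}. S i ` K)"
begin

abbreviation "r \<equiv> rmin N \<rho>"
abbreviation "words \<equiv> {w. set w \<subseteq> {1..N}}"
abbreviation "\<J> \<equiv> J N \<rho>"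
abbreviation "cell w \<equiv> Sw S w ` K"

definition "rmax = Max (\<rho> ` {1..N})"

lemma ratio_bounds:
  assumes "i \<in> {1..N}"
  shows "0 < \<rho> i" "\<rho> i < 1" "r \<le> \<rho> i" "\<rho> i \<le> rmax"
  using assms contractions by (auto simp: rmin_def rmax_def)

lemma r_bounds: "0 < r" "r < 1"
proof -
  have "r \<in> \<rho> ` {1..N}" unfolding rmin_def using N_ge_2 by (intro Min_in) auto
  then show "0 < r" "r < 1" using contractions by auto
qed

lemma rmax_bounds: "0 < rmax" "rmax < 1"
proof -
  have "rmax \<in> \<rho> ` {1..N}" unfolding rmax_def using N_ge_2 by (intro Max_in) auto
  then show "0 < rmax" "rmax < 1" using contractions by auto
qed

lemma r_power_le: "m \<le> n \<Longrightarrow> r ^ n \<le> r ^ m"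
  using r_bounds by (intro power_decreasing) auto

lemma rw_pos: "w \<in> words \<Longrightarrow> 0 < rw \<rho> w"
  by (induction w) (use ratio_bounds(1) in auto)

lemma rw_le_1: "w \<in> words \<Longrightarrow> rw \<rho> w \<le> 1"
proof (induction w)
  case (Cons i w)
  then show ?case using ratio_bounds[of i] rw_pos[of w] by (auto intro: mult_le_one)
qed simp

lemma rw_prefix_le: "v \<in> words \<Longrightarrow> prefix u v \<Longrightarrow> rw \<rho> v \<le> rw \<rho> u"
  using rw_le_1 rw_pos by (auto simp: prefix_def mult_left_le less_imp_le)

lemma J_iff:
  "w \<in> \<J> n \<longleftrightarrow> w \<in> words \<and> rw \<rho> w \<le> r ^ n \<and> (w = [] \<or> r ^ n < rw \<rho> (butlast w))"
proof (cases n)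
  case 0
  have "\<not> 1 < rw \<rho> (butlast w)" if "w \<in> words"
    using that rw_le_1[of "butlast w"] in_set_butlastD by fastforce
  then show ?thesis using 0 by (auto simp: J.simps)
next
  case (Suc m)
  have "\<not> 1 \<le> r ^ Suc m" using r_bounds by (simp add: power_Suc_less_one not_le del: power_Suc)
  then show ?thesis using Suc by (auto simp: J.simps simp del: power_Suc)
qed

lemma J_words: "w \<in> \<J> n \<Longrightarrow> w \<in> words"
  by (simp add: J_iff)

lemma rw_J_le: "w \<in> \<J> n \<Longrightarrow> rw \<rho> w \<le> r ^ n"
  by (simp add: J_iff)

lemma rw_J_gt:
  assumes "w \<in> \<J> n"
  shows "r ^ Suc n < rw \<rho> w"
proof (cases w rule: rev_cases)
  case Nil
  then show ?thesis using r_bounds by (simp add: power_Suc_less_one del: power_Suc)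
next
  case (snoc u i)
  then have "r ^ n < rw \<rho> u" "i \<in> {1..N}" using assms by (auto simp: J_iff)
  then have "r * r ^ n < \<rho> i * rw \<rho> u"
    using ratio_bounds(3)[of i] r_bounds by (intro mult_le_less_imp_less) auto
  then show ?thesis using snoc by (simp add: mult.commute)
qed

lemma Nil_J_0: "[] \<in> \<J> 0"
  by (simp add: J.simps)

lemma J_level_unique: "w \<in> \<J> n \<Longrightarrow> w \<in> \<J> m \<Longrightarrow> n = m"
proof (induction n m rule: linorder_wlog)
  case (le n m)
  show ?case
  proof (rule ccontr)
    assume "n \<noteq> m"
    then have "r ^ m \<le> r ^ Suc n" using le by (intro r_power_le) auto
    then show False using rw_J_gt[OF le(2)] rw_J_le[OF le(3)] by linarith
  qed
qed auto

lemma lev_eq: "w \<in> \<J> n \<Longrightarrow> lev N \<rho> w = n"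
  unfolding lev_def using J_level_unique by blast

lemma J_prefix_mono:
  assumes "y \<in> \<J> k" "z \<in> \<J> n" "k \<le> n" "prefix y v" "prefix z v"
  shows "prefix y z"
  using prefix_same_cases[OF assms(4,5)]
proof
  assume zy: "prefix z y"
  show "prefix y z"
  proof (cases "z = y")
    case False
    then have p: "prefix z (butlast y)" and "y \<noteq> []" using zy
      by (metis prefix_snoc snoc_eq_iff_butlast prefix_Nil)+
    then have "r ^ k < rw \<rho> (butlast y)" "butlast y \<in> words" using assms(1)
      by (auto simp: J_iff dest: in_set_butlastD)
    then show ?thesis
      using rw_prefix_le[OF _ p] rw_J_le[OF assms(2)] r_power_le[OF assms(3)] by simp
  qed simp
qed

lemma J_prefix_unique:
  assumes "y \<in> \<J> n" "z \<in> \<J> n" "prefix y v" "prefix z v"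
  shows "y = z"
  using J_prefix_mono assms by (blast intro: prefix_order.antisym)

lemma J_prefix_eq: "y \<in> \<J> n \<Longrightarrow> z \<in> \<J> n \<Longrightarrow> prefix y z \<Longrightarrow> y = z"
  by (rule J_prefix_unique) auto

lemma J_prefix_exists: "v \<in> words \<Longrightarrow> rw \<rho> v \<le> r ^ n \<Longrightarrow> \<exists>y\<in>\<J> n. prefix y v"
proof (induction v rule: rev_induct)
  case Nil
  then show ?case by (auto simp: J_iff intro!: bexI[of _ "[]"])
next
  case (snoc i u)
  show ?case
  proof (cases "rw \<rho> u \<le> r ^ n")
    case True
    then show ?thesis using snoc by (auto intro: prefix_prefix)
  next
    case False
    then have "u @ [i] \<in> \<J> n" using snoc by (auto simp: J_iff)
    then show ?thesis by blast
  qed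
qed

text \<open>The words having a descendant in \<open>\<J> n\<close>.\<close>

definition above :: "nat \<Rightarrow> nat list \<Rightarrow> bool" where
  "above n v \<longleftrightarrow> v \<in> words \<and> (v \<in> \<J> n \<or> r ^ n < rw \<rho> v)"

lemma above_Nil: "above n []"
  using r_bounds by (cases n) (auto simp: above_def J_iff power_Suc_less_one simp del: power_Suc)

lemma above_J: "v \<in> \<J> m \<Longrightarrow> m \<le> n \<Longrightarrow> above n v"
  using J_words[of v m] rw_J_gt[of v m] r_power_le[of "Suc m" n] unfolding above_def
  by (cases "m = n") auto

lemma above_snoc: "v \<in> words \<Longrightarrow> r ^ n < rw \<rho> v \<Longrightarrow> i \<in> {1..N} \<Longrightarrow> above n (v @ [i])"
  by (auto simp: above_def J_iff)

lemma above_induct [consumes 1, case_names level step]: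
  assumes "above n v"
    and level: "\<And>v. v \<in> \<J> n \<Longrightarrow> P v"
    and step: "\<And>v. v \<in> words \<Longrightarrow> r ^ n < rw \<rho> v \<Longrightarrow> (\<And>i. i \<in> {1..N} \<Longrightarrow> P (v @ [i])) \<Longrightarrow> P v"
  shows "P v"
proof -
  have "P v" if "rw \<rho> v * rmax ^ k \<le> r ^ n" "above n v" for k v
    using that
  proof (induction k arbitrary: v)
    case 0
    then show ?case using level by (auto simp: above_def)
  next
    case (Suc k)
    show ?case
    proof (cases "v \<in> \<J> n")
      case False
      then have v: "v \<in> words" "r ^ n < rw \<rho> v" using Suc.prems(2) by (auto simp: above_def)
      show ?thesis
      proof (rule step[OF v])
        fix i assume i: "i \<in> {1..N}"
        have "rw \<rho> (v @ [i]) * rmax ^ k \<le> rw \<rho> v * rmax ^ Suc k"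
          using ratio_bounds(4)[OF i] rw_pos[OF v(1)] rmax_bounds by (simp add: mult_right_mono)
        then show "P (v @ [i])" using Suc.IH[OF _ above_snoc[OF v i]] Suc.prems(1) by simp
      qed
    qed (rule level)
  qed
  moreover have pos: "rw \<rho> v > 0" using assms(1) rw_pos by (simp add: above_def)
  obtain k where "rmax ^ k < r ^ n / rw \<rho> v"
    using real_arch_pow_inv[of "r ^ n / rw \<rho> v" rmax] r_bounds rmax_bounds pos by auto
  then have "rw \<rho> v * rmax ^ k \<le> r ^ n" using pos by (simp add: field_simps)
  ultimately show ?thesis using assms(1) by blast
qed

definition "descendants n v = {z \<in> \<J> n. prefix v z}"

lemma descendants_level: "v \<in> \<J> n \<Longrightarrow> descendants n v = {v}"
  using J_prefix_eq by (auto simp: descendants_def)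

lemma descendants_Nil: "descendants n [] = \<J> n"
  by (simp add: descendants_def)

lemma descendants_step:
  assumes "r ^ n < rw \<rho> v"
  shows "descendants n v = (\<Union>i\<in>{1..N}. descendants n (v @ [i]))"
proof (intro set_eqI iffI)
  fix z assume "z \<in> descendants n v"
  then have z: "z \<in> \<J> n" "prefix v z" by (auto simp: descendants_def)
  then have "z \<noteq> v" using assms rw_J_le[of v n] by auto
  then obtain i u where "z = v @ i # u" using z by (metis append_Nil2 list.exhaust prefixE)
  then show "z \<in> (\<Union>i\<in>{1..N}. descendants n (v @ [i]))"
    using z J_words[OF z(1)] by (auto simp: descendants_def)
qed (auto simp: descendants_def dest: append_prefixD)

lemma descendants_snoc_disjoint:
  "i \<noteq> j \<Longrightarrow> descendants n (v @ [i]) \<inter> descendants n (v @ [j]) = {}"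
  by (auto simp: descendants_def prefix_def)

lemma finite_J: "finite (\<J> n)"
proof -
  have "finite (descendants n v)" if "above n v" for v
    using that by (induction v rule: above_induct) (auto simp: descendants_level descendants_step)
  from this[OF above_Nil] show ?thesis by (simp add: descendants_Nil)
qed

lemma finite_descendants: "finite (descendants n v)"
  using finite_J by (simp add: descendants_def)

lemma sum_descendants:
  fixes g :: "nat list \<Rightarrow> real"
  assumes "above n v" and g: "\<And>u. u \<in> words \<Longrightarrow> (\<Sum>i\<in>{1..N}. g (u @ [i])) = g u"
  shows "(\<Sum>z\<in>descendants n v. g z) = g v"
  using assms(1)
proof (induction v rule: above_induct)
  case (level v)
  then show ?case by (simp add: descendants_level)
next
  case (step v)
  have "(\<Sum>z\<in>descendants n v. g z) = (\<Sum>i\<in>{1..N}. \<Sum>z\<in>descendants n (v @ [i]). g z)"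
    unfolding descendants_step[OF step(2)]
    using descendants_snoc_disjoint finite_descendants by (intro sum.UNION_disjoint) auto
  then show ?case using step g by simp
qed

lemma similitude_Sw: "w \<in> words \<Longrightarrow> similitude (Sw S w) (rw \<rho> w)"
  by (induction w) (use contractions in \<open>auto simp: similitude_def\<close>)

lemma dist_Sw: "w \<in> words \<Longrightarrow> dist (Sw S w x) (Sw S w y) = rw \<rho> w * dist x y"
  using similitude_Sw by (simp add: similitude_def)

lemma inj_Sw: "w \<in> words \<Longrightarrow> inj (Sw S w)"
  by (intro injI) (metis dist_Sw dist_eq_0_iff mult_eq_0_iff rw_pos less_irrefl)

lemma continuous_on_Sw: "w \<in> words \<Longrightarrow> continuous_on A (Sw S w)"
  by (intro continuous_on_subset[OF lipschitz_on_continuous_on[of "rw \<rho> w" UNIV]] lipschitz_onI)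
     (auto simp: dist_Sw rw_pos less_imp_le)

lemma cell_subset_K: "w \<in> words \<Longrightarrow> cell w \<subseteq> K"
proof (induction w)
  case (Cons i w)
  then have "cell (i # w) \<subseteq> S i ` K" "i \<in> {1..N}" by auto
  then show ?case using K_eq by blast
qed simp

lemma cell_prefix_subset: "v \<in> words \<Longrightarrow> prefix u v \<Longrightarrow> cell v \<subseteq> cell u"
  using cell_subset_K by (auto simp: prefix_def Sw_append) blast

lemma compact_cell: "w \<in> words \<Longrightarrow> compact (cell w)"
  using K_compact continuous_on_Sw by (intro compact_continuous_image) auto

lemma cell_eq_UN: "cell w = (\<Union>i\<in>{1..N}. cell (w @ [i]))"
  by (subst K_eq) (auto simp: Sw_append)

lemma diameter_K_nonneg: "0 \<le> diameter K"
  by (simp add: diameter_ge_0 K_compact compact_imp_bounded)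

lemma diameter_cell: "w \<in> words \<Longrightarrow> diameter (cell w) = rw \<rho> w * diameter K"
  by (intro diameter_similitude_image similitude_Sw rw_pos compact_imp_bounded K_compact)

lemma dist_cell_J:
  assumes "w \<in> \<J> n" "x \<in> cell w" "y \<in> cell w"
  shows "dist x y \<le> diameter K * r ^ n"
proof -
  have w: "w \<in> words" using assms(1) by (rule J_words)
  have "dist x y \<le> rw \<rho> w * diameter K"
    using diameter_bounded_bound[OF compact_imp_bounded[OF compact_cell[OF w]] assms(2,3)]
    by (simp only: diameter_cell[OF w])
  also have "\<dots> \<le> r ^ n * diameter K"
    using rw_J_le[OF assms(1)] diameter_K_nonneg by (rule mult_right_mono)
  finally show ?thesis by (simp add: mult.commute)
qed

lemma cell_descendant: "above n v \<Longrightarrow> x \<in> cell v \<Longrightarrow> \<exists>z\<in>descendants n v. x \<in> cell z"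
proof (induction v rule: above_induct)
  case (level v)
  then show ?case by (simp add: descendants_level)
next
  case (step v)
  then obtain i where i: "i \<in> {1..N}" "x \<in> cell (v @ [i])" using cell_eq_UN[of v] by blast
  then obtain z where "z \<in> descendants n (v @ [i])" "x \<in> cell z" using step by blast
  then show ?case using i(1) unfolding descendants_step[OF step(2)] by blast
qed

lemma K_eq_UN_cells: "K = (\<Union>w\<in>\<J> n. cell w)"
  using cell_descendant[OF above_Nil] cell_subset_K[OF J_words] by (fastforce simp: descendants_Nil)

lemma ex_level_cell: "\<xi> \<in> K \<Longrightarrow> \<exists>w\<in>\<J> n. \<xi> \<in> cell w"
  using K_eq_UN_cells[of n] by blast

lemma geo_ray_exists:
  assumes "\<xi> \<in> K"
  shows "\<exists>ys. geo_ray N S \<rho> K \<xi> ys"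
proof -
  have "\<exists>ys. \<forall>n. (ys n \<in> \<J> n \<and> \<xi> \<in> cell (ys n)) \<and> prefix (ys n) (ys (Suc n))"
  proof (rule dependent_nat_choice)
    show "\<exists>x. x \<in> \<J> 0 \<and> \<xi> \<in> cell x" using assms Nil_J_0 by (intro exI[of _ "[]"]) simp
    fix x n assume "x \<in> \<J> n \<and> \<xi> \<in> cell x"
    then have "\<exists>z\<in>descendants (Suc n) x. \<xi> \<in> cell z"
      using cell_descendant[of "Suc n" x \<xi>] above_J[of x n "Suc n"] by simp
    then show "\<exists>y. (y \<in> \<J> (Suc n) \<and> \<xi> \<in> cell y) \<and> prefix x y" by (auto simp: descendants_def)
  qed
  then show ?thesis unfolding geo_ray_def by blast
qed

definition "ray \<xi> = (SOME ys. geo_ray N S \<rho> K \<xi> ys)"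

lemma geo_ray_ray: "\<xi> \<in> K \<Longrightarrow> geo_ray N S \<rho> K \<xi> (ray \<xi>)"
  unfolding ray_def by (rule someI_ex[OF geo_ray_exists])

lemma ray_J: "\<xi> \<in> K \<Longrightarrow> ray \<xi> n \<in> \<J> n"
  and ray_cell: "\<xi> \<in> K \<Longrightarrow> \<xi> \<in> cell (ray \<xi> n)"
  using geo_ray_ray[of \<xi>] by (auto simp: geo_ray_def)

lemma kappa_seq_exists: "\<exists>\<kappa>. kappa_seq N S \<rho> K \<kappa>"
  using geo_ray_ray by (intro exI[of _ "\<lambda>n \<xi>. ray \<xi> n"]) (simp add: kappa_seq_def)

definition feasible :: "'a set \<Rightarrow> bool" where
  "feasible V \<longleftrightarrow> open V \<and> V \<noteq> {} \<and> (\<forall>i\<in>{1..N}. S i ` V \<subseteq> V) \<and>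
     (\<forall>i\<in>{1..N}. \<forall>j\<in>{1..N}. i \<noteq> j \<longrightarrow> S i ` V \<inter> S j ` V = {})"

lemma feasible_exists: "\<exists>V. feasible V"
  using osc unfolding osc_def feasible_def .

lemma Sw_image_feasible_subset: "feasible V \<Longrightarrow> w \<in> words \<Longrightarrow> Sw S w ` V \<subseteq> V"
proof (induction w)
  case (Cons i w)
  then have "Sw S (i # w) ` V \<subseteq> S i ` V" "i \<in> {1..N}" by auto
  then show ?case using Cons.prems(1) unfolding feasible_def by blast
qed simp

lemma Sw_images_feasible_disjoint:
  assumes V: "feasible V" and uv: "u \<in> \<J> n" "v \<in> \<J> n" "u \<noteq> v"
  shows "Sw S u ` V \<inter> Sw S v ` V = {}"
proof -
  have "parallel u v" using uv J_prefix_eq by (auto simp: parallel_def)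
  then obtain q b bs c cs where q: "b \<noteq> c" "u = q @ b # bs" "v = q @ c # cs"
    using parallel_decomp by blast
  then have words: "q \<in> words" "b \<in> {1..N}" "c \<in> {1..N}" "bs \<in> words" "cs \<in> words"
    using J_words[OF uv(1)] J_words[OF uv(2)] by auto
  have "Sw S u ` V \<subseteq> Sw S q ` (S b ` V)" "Sw S v ` V \<subseteq> Sw S q ` (S c ` V)"
    using Sw_image_feasible_subset[OF V words(4)] Sw_image_feasible_subset[OF V words(5)]
    unfolding q(2,3) Sw_append by auto
  moreover have "Sw S q ` (S b ` V) \<inter> Sw S q ` (S c ` V) = {}"
    using V words(2,3) q(1) image_Int[OF inj_Sw[OF words(1)], of "S b ` V" "S c ` V"]
    by (simp add: feasible_def)
  ultimately show ?thesis by blast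
qed

definition "cells_near R n p = {y\<in>\<J> n. \<exists>x\<in>cell y. dist x p \<le> R * r ^ n}"

lemma ball_subset_Sw_image:
  assumes "ball a e \<subseteq> V" "0 \<le> e" "y \<in> \<J> n"
  shows "ball (Sw S y a) (r ^ Suc n * e) \<subseteq> Sw S y ` V"
proof -
  have "ball (Sw S y a) (r ^ Suc n * e) \<subseteq> ball (Sw S y a) (rw \<rho> y * e)"
    using rw_J_gt[OF assms(3)] assms(2) by (intro subset_ball mult_right_mono) auto
  also have "\<dots> = Sw S y ` ball a e"
    using similitude_image_ball similitude_Sw rw_pos J_words[OF assms(3)] by blast
  also have "\<dots> \<subseteq> Sw S y ` V" using assms(1) by (rule image_mono)
  finally show ?thesis .
qed

lemma ball_subset_near:
  assumes y: "y \<in> cells_near R n p" and D: "\<And>x. x \<in> K \<Longrightarrow> dist a x \<le> D" and e: "0 \<le> e"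
  shows "ball (Sw S y a) (r ^ Suc n * e) \<subseteq> ball p ((R + D + e) * r ^ n)"
proof
  fix z assume z: "z \<in> ball (Sw S y a) (r ^ Suc n * e)"
  obtain k where level: "y \<in> \<J> n" and k: "k \<in> K" "dist (Sw S y k) p \<le> R * r ^ n"
    using y by (auto simp: cells_near_def)
  have "dist (Sw S y a) (Sw S y k) = rw \<rho> y * dist a k" using dist_Sw J_words level by blast
  also have "\<dots> \<le> r ^ n * D" using rw_J_le[OF level] D[OF k(1)] r_bounds by (intro mult_mono) auto
  finally have "dist (Sw S y a) (Sw S y k) \<le> r ^ n * D" .
  moreover have "r * r ^ n * e \<le> 1 * r ^ n * e" using r_bounds e by (intro mult_right_mono) auto
  then have "dist (Sw S y a) z < r ^ n * e" using z by (simp add: mult.assoc)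
  moreover have "dist p z \<le> dist (Sw S y k) p + dist (Sw S y a) (Sw S y k) + dist (Sw S y a) z"
    by metric
  ultimately have "dist p z < R * r ^ n + r ^ n * D + r ^ n * e" using k(2) by linarith
  then show "z \<in> ball p ((R + D + e) * r ^ n)" by (simp add: algebra_simps)
qed

text \<open>The images of a small ball of a feasible open set under the maps of the cells are disjoint and of
  comparable size.\<close>

lemma card_cells_near_bounded:
  assumes "R \<ge> 0"
  obtains M where "M > 0" "\<And>n p. real (card (cells_near R n p)) \<le> M"
proof -
  obtain V where V: "feasible V" using feasible_exists by blast
  then have "open V" "V \<noteq> {}" by (simp_all add: feasible_def)
  then obtain a e where e: "e > 0" "ball a e \<subseteq> V" by (meson ex_in_conv openE)
  obtain D where D: "D > 0" "\<And>x. x \<in> K \<Longrightarrow> dist a x \<le> D"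
    using compact_imp_bounded[OF K_compact] bounded_any_center[of K a]
    by (metis less_max_iff_disj max.coboundedI1 zero_less_one)
  have "real (card (cells_near R n p)) \<le> ((R + D + e) * r ^ n / (r ^ Suc n * e)) ^ DIM('a)" for n p
  proof (rule card_disjoint_balls_le[where c = "\<lambda>y. Sw S y a" and p = p])
    show "disjoint_family_on (\<lambda>y. ball (Sw S y a) (r ^ Suc n * e)) (cells_near R n p)"
      unfolding disjoint_family_on_def
    proof (intro ballI impI)
      fix u v assume "u \<in> cells_near R n p" "v \<in> cells_near R n p" and ne: "u \<noteq> v"
      then have uv: "u \<in> \<J> n" "v \<in> \<J> n" by (auto simp: cells_near_def)
      have "ball (Sw S y a) (r ^ Suc n * e) \<subseteq> Sw S y ` V" if "y \<in> \<J> n" for y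
        using ball_subset_Sw_image[OF e(2) _ that] e(1) by simp
      then show "ball (Sw S u a) (r ^ Suc n * e) \<inter> ball (Sw S v a) (r ^ Suc n * e) = {}"
        using Sw_images_feasible_disjoint[OF V uv ne] uv by blast
    qed
  qed (use finite_J r_bounds e D assms ball_subset_near in \<open>auto simp: cells_near_def\<close>)
  also have "((R + D + e) * r ^ n / (r ^ Suc n * e)) ^ DIM('a) = ((R + D + e) / (r * e)) ^ DIM('a)" for n
    using r_bounds by simp
  finally show thesis
    using D(1) e(1) r_bounds assms by (intro that[of "((R + D + e) / (r * e)) ^ DIM('a)"]) auto
qed

end

section \<open>Dimension and normalized Hausdorff measure\<close>

lemma ex_power_between:
  fixes x d :: real
  assumes "0 < x" "x < 1" "0 < d" "d \<le> 1"
  shows "\<exists>n. x ^ Suc n < d \<and> d \<le> x ^ n"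
proof -
  let ?P = "\<lambda>n. x ^ n < d"
  have "\<exists>n. ?P n" using real_arch_pow_inv[of d x] assms by auto
  then have "?P (Least ?P)" by (rule LeastI_ex)
  moreover from this have "Least ?P \<noteq> 0" using assms by (intro notI) auto
  then obtain n where n: "Least ?P = Suc n" using not0_implies_Suc by blast
  moreover have "\<not> ?P n" using not_less_Least[of n ?P] n by simp
  ultimately show ?thesis by (intro exI[of _ n]) auto
qed

lemma eventually_mult_power_less:
  fixes C x e :: real
  assumes "0 \<le> x" "x < 1" "0 < e"
  shows "\<forall>\<^sub>F n in sequentially. C * x ^ n < e"
proof -
  have "(\<lambda>n. C * x ^ n) \<longlonglongrightarrow> C * 0" using assms by (intro tendsto_intros LIMSEQ_power_zero) auto
  then show ?thesis using assms(3) by (intro order_tendstoD) auto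
qed

lemma sum_UN_le:
  fixes f :: "'b \<Rightarrow> 'c::ordered_comm_monoid_add"
  assumes "finite I" "\<And>i. i \<in> I \<Longrightarrow> finite (A i)" and nonneg: "\<And>x. 0 \<le> f x"
  shows "sum f (\<Union>i\<in>I. A i) \<le> (\<Sum>i\<in>I. sum f (A i))"
  using assms(1,2)
proof (induction I rule: finite_induct)
  case (insert j I)
  let ?B = "\<Union>i\<in>I. A i"
  have "sum f (A j \<union> ?B) \<le> sum f (A j \<union> ?B) + sum f (A j \<inter> ?B)"
    using nonneg by (intro add_increasing2 sum_nonneg) auto
  also have "\<dots> = sum f (A j) + sum f ?B" using insert by (intro sum.union_inter) auto
  finally show ?case using insert by (auto intro: order_trans add_left_mono)
qed simp

lemma ex_powr_perturbation:
  fixes D :: real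
  assumes "0 \<le> D" "0 < s" "0 < e" "0 < c"
  shows "\<exists>\<eta>. 0 < \<eta> \<and> \<eta> \<le> c \<and> (D + 2 * \<eta>) powr s \<le> D powr s + e"
proof -
  have "((\<lambda>\<eta>. (D + 2 * \<eta>) powr s) \<longlongrightarrow> (D + 2 * 0) powr s) (at_right 0)"
    using assms by (intro tendsto_powr' tendsto_intros)
      (auto simp: eventually_at_filter intro!: always_eventually)
  then have "\<forall>\<^sub>F \<eta> in at_right 0. (D + 2 * \<eta>) powr s < D powr s + e"
    by (rule order_tendstoD) (use assms in simp)
  moreover have "\<forall>\<^sub>F \<eta> in at_right 0. 0 < \<eta> \<and> \<eta> < c"
    using \<open>0 < c\<close> by (auto simp: eventually_at_right_field)
  ultimately have "\<forall>\<^sub>F \<eta> in at_right 0. 0 < \<eta> \<and> \<eta> \<le> c \<and> (D + 2 * \<eta>) powr s \<le> D powr s + e"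
    by eventually_elim auto
  then show ?thesis using eventually_happens by (fastforce simp: trivial_limit_at_right_real)
qed

lemma dist_thickening_le:
  fixes C :: "'a::metric_space set"
  assumes "bounded C" "x \<in> (\<Union>c\<in>C. ball c \<eta>)" "y \<in> (\<Union>c\<in>C. ball c \<eta>)"
  shows "dist x y \<le> diameter C + 2 * \<eta>"
proof -
  obtain a b where "a \<in> C" "b \<in> C" "dist a x < \<eta>" "dist b y < \<eta>" using assms(2,3) by auto
  moreover from this have "dist a b \<le> diameter C" using diameter_bounded_bound assms(1) by blast
  moreover have "dist x y \<le> dist a x + dist a b + dist b y" by metric
  ultimately show ?thesis by simp
qed

lemma sum_power_half_le_1:
  assumes "finite I"
  shows "(\<Sum>i\<in>I. (1/2::real) ^ Suc i) \<le> 1"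
  using sum_le_suminf[OF sums_summable[OF power_half_series] assms] sums_unique[OF power_half_series]
  by simp

lemma compact_countable_cover_thickening:
  fixes K :: "'a::metric_space set"
  assumes K: "compact K" and C: "K \<subseteq> (\<Union>i::nat. C i)" "\<And>i. bounded (C i)"
    and s: "0 < s" and e: "0 < e" and c: "0 < c"
  obtains I U d where "finite I" "K \<subseteq> (\<Union>i\<in>I. U i)" "\<And>i. i \<in> I \<Longrightarrow> C i \<noteq> {}"
    "\<And>i x y. x \<in> U i \<Longrightarrow> y \<in> U i \<Longrightarrow> dist x y \<le> d i" "\<And>i. 0 < d i"
    "\<And>i. d i \<le> diameter (C i) + c" "(\<Sum>i\<in>I. d i powr s) \<le> (\<Sum>i\<in>I. diameter (C i) powr s) + e"
proof -
  let ?D = "\<lambda>i. diameter (C i)"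
  have "\<exists>\<eta>. 0 < \<eta> \<and> \<eta> \<le> c / 2 \<and> (?D i + 2 * \<eta>) powr s \<le> ?D i powr s + e * (1/2) ^ Suc i" for i
    using ex_powr_perturbation[of "?D i" s "e * (1/2) ^ Suc i" "c / 2"] C(2) s e c
    by (simp add: diameter_ge_0)
  then obtain \<eta> where \<eta>: "\<And>i. 0 < \<eta> i" "\<And>i. \<eta> i \<le> c / 2"
    "\<And>i. (?D i + 2 * \<eta> i) powr s \<le> ?D i powr s + e * (1/2) ^ Suc i" by metis
  define U where "U i = (\<Union>x\<in>C i. ball x (\<eta> i))" for i
  have C_sub: "C i \<subseteq> U i" for i using \<eta>(1)[of i] by (auto simp: U_def)
  have "K \<subseteq> (\<Union>i. U i)" using C(1) UN_mono[OF subset_refl C_sub] by (rule order_trans)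
  moreover have "open (U i)" for i by (auto simp: U_def)
  ultimately obtain I where I: "finite I" "K \<subseteq> (\<Union>i\<in>I. U i)"
    using compactE_image[OF K, of UNIV U] by (metis subset_UNIV)
  define I' where "I' = {i\<in>I. C i \<noteq> {}}"
  have U_empty: "U i = {}" if "C i = {}" for i using that by (simp add: U_def)
  show thesis
  proof (rule that)
    show "finite I'" using I(1) by (simp add: I'_def)
    show "K \<subseteq> (\<Union>i\<in>I'. U i)" using I(2) U_empty by (fastforce simp: I'_def)
    show "C i \<noteq> {}" if "i \<in> I'" for i using that by (simp add: I'_def)
    show "dist x y \<le> ?D i + 2 * \<eta> i" if "x \<in> U i" "y \<in> U i" for i x y
      using dist_thickening_le[OF C(2)] that unfolding U_def .
    show "0 < ?D i + 2 * \<eta> i" for i using \<eta>(1)[of i] C(2) by (simp add: diameter_ge_0 add_nonneg_pos)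
    show "?D i + 2 * \<eta> i \<le> ?D i + c" for i using \<eta>(2)[of i] by simp
    have "e * (\<Sum>i\<in>I'. (1/2) ^ Suc i) \<le> e"
      using sum_power_half_le_1[OF \<open>finite I'\<close>] e by (simp add: mult_left_le)
    moreover have "(\<Sum>i\<in>I'. (?D i + 2 * \<eta> i) powr s) \<le> (\<Sum>i\<in>I'. ?D i powr s + e * (1/2) ^ Suc i)"
      using \<eta>(3) by (rule sum_mono)
    ultimately show "(\<Sum>i\<in>I'. (?D i + 2 * \<eta> i) powr s) \<le> (\<Sum>i\<in>I'. ?D i powr s) + e"
      by (simp add: sum.distrib sum_distrib_left)
  qed
qed

lemma diameter_powr_le_hpow:
  assumes "bounded C" "C \<noteq> {}" "diameter C \<le> 1" "0 < s" "t \<le> s"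
  shows "ennreal (diameter C powr s) \<le> hpow t C"
proof (cases "t = 0 \<or> diameter C = 0")
  case True
  have "diameter C powr s \<le> 1"
    using assms diameter_ge_0[OF \<open>bounded C\<close>] by (simp add: powr_le1)
  then show ?thesis using True assms by (auto simp: hpow_def)
next
  case False
  then have "diameter C powr s \<le> diameter C powr t"
    using assms diameter_ge_0[OF \<open>bounded C\<close>] by (intro powr_mono') auto
  then show ?thesis using False assms by (auto simp: hpow_def intro: ennreal_leI)
qed

context self_similar_set
begin

definition similarity_exponent :: "real \<Rightarrow> bool" where
  "similarity_exponent s \<longleftrightarrow> s > 0 \<and> (\<Sum>i\<in>{1..N}. \<rho> i powr s) = 1"

lemma similarity_exponent_exists: "\<exists>s. similarity_exponent s"
proof -
  let ?f = "\<lambda>s. \<Sum>i\<in>{1..N}. \<rho> i powr s"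
  obtain k where k: "rmax ^ k < 1 / N"
    using real_arch_pow_inv[of "1 / N" rmax] N_ge_2 rmax_bounds by auto
  have "?f (real k) \<le> (\<Sum>i\<in>{1..N}. rmax ^ k)"
    using ratio_bounds by (intro sum_mono) (auto simp: powr_realpow less_imp_le intro!: power_mono)
  also have "\<dots> < 1" using k N_ge_2 by (simp add: field_simps)
  finally have "?f (real k) \<le> 1" by simp
  moreover have f0: "?f 0 = N" using ratio_bounds by (simp add: order_less_imp_not_eq2)
  moreover have "continuous_on {0..real k} ?f"
    using ratio_bounds(1) by (intro continuous_on_sum continuous_on_powr continuous_intros) force
  ultimately obtain s where s: "0 \<le> s" "?f s = 1"
    using IVT2'[of ?f "real k" 1 0] N_ge_2 by auto
  have "s \<noteq> 0" using s(2) f0 N_ge_2 by (intro notI) simp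
  then have "s > 0" using s(1) by simp
  then show ?thesis using s(2) unfolding similarity_exponent_def by blast
qed

lemma sum_powr_descendants:
  assumes s: "similarity_exponent s" and v: "above n v"
  shows "(\<Sum>z\<in>descendants n v. rw \<rho> z powr s) = rw \<rho> v powr s"
proof (rule sum_descendants[OF v])
  fix u assume "u \<in> words"
  have "(\<Sum>i\<in>{1..N}. rw \<rho> (u @ [i]) powr s) = (\<Sum>i\<in>{1..N}. rw \<rho> u powr s * \<rho> i powr s)"
    by (intro sum.cong) (auto simp: powr_mult)
  then show "(\<Sum>i\<in>{1..N}. rw \<rho> (u @ [i]) powr s) = rw \<rho> u powr s"
    using s by (simp add: similarity_exponent_def flip: sum_distrib_left)
qed

lemma sum_powr_J: "similarity_exponent s \<Longrightarrow> (\<Sum>z\<in>\<J> n. rw \<rho> z powr s) = 1"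
  using sum_powr_descendants[OF _ above_Nil] by (simp add: descendants_Nil)

lemma hausdorff_approx_K_le:
  assumes s: "similarity_exponent s" and t: "t \<ge> s" and n: "diameter K * r ^ n \<le> \<delta>"
  shows "hausdorff_approx t \<delta> K \<le> ennreal ((r ^ n) powr (t - s) * diameter K powr t)"
proof -
  have "hausdorff_approx t \<delta> K \<le> (\<Sum>w\<in>\<J> n. hpow t (cell w))"
  proof (rule hausdorff_approx_le_sum[OF finite_J])
    show "K \<subseteq> \<Union> (cell ` \<J> n)" using K_eq_UN_cells by blast
    show "0 \<le> \<delta>" using n diameter_K_nonneg r_bounds by (simp add: order_trans[OF _ n])
    fix w assume w: "w \<in> \<J> n"
    show "bounded (cell w)" using compact_cell[OF J_words[OF w]] compact_imp_bounded by blast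
    show "diameter (cell w) \<le> \<delta>"
      using order_trans[OF mult_right_mono[OF rw_J_le[OF w] diameter_K_nonneg]] n
      by (simp add: diameter_cell[OF J_words[OF w]] mult.commute)
  qed
  also have "\<dots> \<le> (\<Sum>w\<in>\<J> n. ennreal (rw \<rho> w powr s * ((r ^ n) powr (t - s) * diameter K powr t)))"
  proof (rule sum_mono)
    fix w assume w: "w \<in> \<J> n"
    have pos: "rw \<rho> w > 0" using rw_pos[OF J_words[OF w]] .
    have "diameter (cell w) powr t = rw \<rho> w powr s * rw \<rho> w powr (t - s) * diameter K powr t"
      using pos diameter_K_nonneg
      by (simp add: diameter_cell[OF J_words[OF w]] powr_mult powr_add[symmetric])
    also have "\<dots> \<le> rw \<rho> w powr s * (r ^ n) powr (t - s) * diameter K powr t"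
      using pos rw_J_le[OF w] t by (intro mult_right_mono mult_left_mono powr_mono2) auto
    finally show "hpow t (cell w) \<le> ennreal (rw \<rho> w powr s * ((r ^ n) powr (t - s) * diameter K powr t))"
      using s t K_nonempty
      by (auto simp: hpow_def similarity_exponent_def mult.assoc intro!: ennreal_leI)
  qed
  also have "\<dots> = ennreal ((r ^ n) powr (t - s) * diameter K powr t)"
    using sum_powr_J[OF s, of n] by (subst sum_ennreal) (auto simp flip: sum_distrib_right)
  finally show ?thesis .
qed

lemma eventually_diameter_le: "\<delta> > 0 \<Longrightarrow> \<exists>m. \<forall>n\<ge>m. diameter K * r ^ n \<le> \<delta>"
  using eventually_mult_power_less[of r \<delta> "diameter K"] r_bounds
  unfolding eventually_sequentially by (meson less_imp_le)

lemma hausdorff_measure_K_finite: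
  assumes s: "similarity_exponent s"
  shows "hausdorff_measure s K < top"
proof -
  have "hausdorff_measure s K \<le> ennreal (diameter K powr s)"
    unfolding hausdorff_measure_def
  proof (rule SUP_least)
    fix \<delta> :: real assume "\<delta> \<in> {0<..}"
    then obtain n where "diameter K * r ^ n \<le> \<delta>" using eventually_diameter_le by auto
    then show "hausdorff_approx s \<delta> K \<le> ennreal (diameter K powr s)"
      using hausdorff_approx_K_le[OF s order_refl] r_bounds by (fastforce simp: powr_def)
  qed
  then show ?thesis by (simp add: le_less_trans)
qed

lemma hausdorff_measure_K_eq_0:
  assumes s: "similarity_exponent s" and t: "t > s"
  shows "hausdorff_measure t K = 0"
proof -
  have "hausdorff_approx t \<delta> K = 0" if "\<delta> > 0" for \<delta>
  proof -
    obtain m where m: "\<And>n. n \<ge> m \<Longrightarrow> diameter K * r ^ n \<le> \<delta>"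
      using eventually_diameter_le[OF \<open>\<delta> > 0\<close>] by blast
    have "hausdorff_approx t \<delta> K \<le> ennreal ((r ^ n) powr (t - s) * diameter K powr t)" if "n \<ge> m" for n
      using hausdorff_approx_K_le[OF s less_imp_le[OF t] m[OF that]] .
    moreover have "(\<lambda>n. ennreal ((r ^ n) powr (t - s) * diameter K powr t))
        \<longlonglongrightarrow> ennreal (0 powr (t - s) * diameter K powr t)"
      using r_bounds t
      by (intro tendsto_ennrealI tendsto_mult tendsto_powr' LIMSEQ_power_zero tendsto_const) auto
    ultimately have "hausdorff_approx t \<delta> K \<le> 0"
      by (intro LIMSEQ_le_const[of _ "0::ennreal"]) auto
    then show ?thesis by simp
  qed
  then show ?thesis unfolding hausdorff_measure_def by (intro antisym SUP_least) auto
qed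

definition "meeting_cells n U = {w\<in>\<J> n. cell w \<inter> U \<noteq> {}}"

lemma finite_meeting_cells: "finite (meeting_cells n U)"
  using finite_J by (simp add: meeting_cells_def)

lemma sum_powr_meeting_cells_le:
  assumes s: "similarity_exponent s" and M: "\<And>n p. real (card (cells_near 1 n p)) \<le> M"
    and d: "0 < d" "d \<le> 1" and U: "\<And>x y. x \<in> U \<Longrightarrow> y \<in> U \<Longrightarrow> dist x y \<le> d"
  shows "\<exists>n. (\<Sum>w\<in>meeting_cells n U. rw \<rho> w powr s) \<le> M * (d powr s / r powr s)"
proof (cases "U = {}")
  case True
  have "0 \<le> M" using M[of 0 undefined] by linarith
  then show ?thesis using True by (simp add: meeting_cells_def)
next
  case False
  then obtain p where p: "p \<in> U" by auto
  obtain n where n: "r ^ Suc n < d" "d \<le> r ^ n" using ex_power_between r_bounds d by blast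
  have "meeting_cells n U \<subseteq> cells_near 1 n p"
    using U[OF _ p] n by (fastforce simp: meeting_cells_def cells_near_def)
  then have "card (meeting_cells n U) \<le> card (cells_near 1 n p)"
    using finite_J by (intro card_mono) (auto simp: cells_near_def)
  then have card: "real (card (meeting_cells n U)) \<le> M" using M[of n p] by linarith
  have "(\<Sum>w\<in>meeting_cells n U. rw \<rho> w powr s) \<le> (\<Sum>w\<in>meeting_cells n U. d powr s / r powr s)"
  proof (rule sum_mono)
    fix w assume "w \<in> meeting_cells n U"
    then have w: "w \<in> \<J> n" by (simp add: meeting_cells_def)
    have "r * rw \<rho> w \<le> r * r ^ n" using rw_J_le[OF w] r_bounds by simp
    then have "r * rw \<rho> w \<le> d" using n by simp
    then have "rw \<rho> w \<le> d / r" using r_bounds by (simp add: pos_le_divide_eq mult.commute)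
    then have "rw \<rho> w powr s \<le> (d / r) powr s"
      using rw_pos[OF J_words[OF w]] s by (intro powr_mono2) (auto simp: similarity_exponent_def)
    then show "rw \<rho> w powr s \<le> d powr s / r powr s" using r_bounds d by (simp add: powr_divide)
  qed
  also have "\<dots> \<le> M * (d powr s / r powr s)"
    using card by (simp add: mult_right_mono divide_right_mono)
  finally show ?thesis by blast
qed

lemma sum_powr_meeting_cells_cover_ge:
  assumes s: "similarity_exponent s" and I: "finite I" "K \<subseteq> (\<Union>i\<in>I. U i)"
  shows "1 \<le> (\<Sum>i\<in>I. \<Sum>w\<in>meeting_cells (n i) (U i). rw \<rho> w powr s)"
proof -
  define m where "m = Max (insert 0 (n ` I))"
  have n_le: "n i \<le> m" if "i \<in> I" for i using that I(1) by (auto simp: m_def)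
  have sub: "\<J> m \<subseteq> (\<Union>i\<in>I. \<Union>w\<in>meeting_cells (n i) (U i). descendants m w)"
  proof
    fix z assume z: "z \<in> \<J> m"
    obtain k where k: "k \<in> K" using K_nonempty by auto
    have "Sw S z k \<in> K" using cell_subset_K[OF J_words[OF z]] k by auto
    then obtain i where i: "i \<in> I" "Sw S z k \<in> U i" using I(2) by blast
    have "rw \<rho> z \<le> r ^ n i" using rw_J_le[OF z] r_power_le[OF n_le[OF i(1)]] by simp
    then obtain w where w: "w \<in> \<J> (n i)" "prefix w z" using J_prefix_exists[OF J_words[OF z]] by blast
    have "Sw S z k \<in> cell w" using cell_prefix_subset[OF J_words[OF z] w(2)] k by blast
    then have "w \<in> meeting_cells (n i) (U i)" using w i by (auto simp: meeting_cells_def)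
    then show "z \<in> (\<Union>i\<in>I. \<Union>w\<in>meeting_cells (n i) (U i). descendants m w)"
      using i z w by (auto simp: descendants_def)
  qed
  have "1 = (\<Sum>z\<in>\<J> m. rw \<rho> z powr s)" using sum_powr_J[OF s] by simp
  also have "\<dots> \<le> (\<Sum>z\<in>(\<Union>i\<in>I. \<Union>w\<in>meeting_cells (n i) (U i). descendants m w). rw \<rho> z powr s)"
    using sub I(1) finite_meeting_cells finite_descendants by (intro sum_mono2) auto
  also have "\<dots> \<le> (\<Sum>i\<in>I. \<Sum>z\<in>(\<Union>w\<in>meeting_cells (n i) (U i). descendants m w). rw \<rho> z powr s)"
    using I(1) finite_meeting_cells finite_descendants by (intro sum_UN_le) auto
  also have "\<dots> \<le> (\<Sum>i\<in>I. \<Sum>w\<in>meeting_cells (n i) (U i). \<Sum>z\<in>descendants m w. rw \<rho> z powr s)"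
    using finite_meeting_cells finite_descendants by (intro sum_mono sum_UN_le) auto
  also have "\<dots> = (\<Sum>i\<in>I. \<Sum>w\<in>meeting_cells (n i) (U i). rw \<rho> w powr s)"
    using n_le by (intro sum.cong refl sum_powr_descendants[OF s] above_J) (auto simp: meeting_cells_def)
  finally show ?thesis .
qed

lemma finite_cover_sum_ge:
  assumes s: "similarity_exponent s" and M: "\<And>n p. real (card (cells_near 1 n p)) \<le> M"
    and I: "finite I" "K \<subseteq> (\<Union>i\<in>I. U i)"
    and d: "\<And>i. i \<in> I \<Longrightarrow> 0 < d i \<and> d i \<le> (1::real)"
    and U: "\<And>i x y. i \<in> I \<Longrightarrow> x \<in> U i \<Longrightarrow> y \<in> U i \<Longrightarrow> dist x y \<le> d i"
  shows "r powr s \<le> M * (\<Sum>i\<in>I. d i powr s)"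
proof -
  have "\<exists>n. (\<Sum>w\<in>meeting_cells n (U i). rw \<rho> w powr s) \<le> M * (d i powr s / r powr s)" if "i \<in> I" for i
    using sum_powr_meeting_cells_le[OF s M, of "d i" "U i"] d[OF that] U[OF that] by blast
  then obtain n where n:
      "\<And>i. i \<in> I \<Longrightarrow> (\<Sum>w\<in>meeting_cells (n i) (U i). rw \<rho> w powr s) \<le> M * (d i powr s / r powr s)"
    by metis
  have "1 \<le> (\<Sum>i\<in>I. \<Sum>w\<in>meeting_cells (n i) (U i). rw \<rho> w powr s)"
    by (rule sum_powr_meeting_cells_cover_ge[OF s I])
  also have "\<dots> \<le> (\<Sum>i\<in>I. M * (d i powr s / r powr s))" by (intro sum_mono n)
  also have "\<dots> = (M * (\<Sum>i\<in>I. d i powr s)) / r powr s"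
    by (simp add: sum_distrib_left sum_divide_distrib)
  finally show ?thesis using r_bounds by (simp add: field_simps)
qed

lemma hausdorff_measure_K_pos:
  assumes s: "similarity_exponent s" and t: "t \<le> s"
  shows "hausdorff_measure t K > 0"
proof -
  have s_pos: "s > 0" using s by (simp add: similarity_exponent_def)
  obtain M :: real where M: "M > 0" "\<And>n p. real (card (cells_near 1 n p)) \<le> M"
    using card_cells_near_bounded[of 1] by auto
  define e where "e = r powr s / (2 * M)"
  have e: "e > 0" using M(1) r_bounds by (simp add: e_def)
  have "ennreal e \<le> hausdorff_approx t (1/2) K"
    unfolding hausdorff_approx_def
  proof (rule INF_greatest, clarify)
    fix C :: "nat \<Rightarrow> 'a set"
    assume C: "K \<subseteq> \<Union> (range C)" "\<forall>i. bounded (C i) \<and> diameter (C i) \<le> 1 / 2"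
    have bounded: "bounded (C i)" and diam: "diameter (C i) \<le> 1 / 2" for i using C(2) by blast+
    have "(0::real) < 1 / 2" by simp
    then obtain I U d where I: "finite I" "K \<subseteq> (\<Union>i\<in>I. U i)" "\<And>i. i \<in> I \<Longrightarrow> C i \<noteq> {}"
      and U: "\<And>i x y. x \<in> U i \<Longrightarrow> y \<in> U i \<Longrightarrow> dist x y \<le> d i"
      and d: "\<And>i. 0 < d i" "\<And>i. d i \<le> diameter (C i) + 1 / 2"
        "(\<Sum>i\<in>I. d i powr s) \<le> (\<Sum>i\<in>I. diameter (C i) powr s) + e"
      by (rule compact_countable_cover_thickening[OF K_compact C(1) bounded s_pos e]) blast
    have d_le: "d i \<le> 1" for i using d(2)[of i] diam[of i] by linarith
    have "r powr s \<le> M * (\<Sum>i\<in>I. d i powr s)"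
      by (rule finite_cover_sum_ge[OF s M(2) I(1,2)]) (use d(1) d_le U in auto)
    then have "2 * e \<le> (\<Sum>i\<in>I. d i powr s)" using M(1) by (simp add: e_def field_simps)
    then have "ennreal e \<le> (\<Sum>i\<in>I. ennreal (diameter (C i) powr s))"
      using d(3) by (subst sum_ennreal) (auto intro: ennreal_leI)
    also have "\<dots> \<le> (\<Sum>i\<in>I. hpow t (C i))"
    proof (rule sum_mono)
      fix i assume "i \<in> I"
      show "ennreal (diameter (C i) powr s) \<le> hpow t (C i)"
        by (rule diameter_powr_le_hpow[OF bounded I(3)[OF \<open>i \<in> I\<close>] _ s_pos t]) (use diam[of i] in simp)
    qed
    also have "\<dots> \<le> (\<Sum>i. hpow t (C i))" by (rule sum_le_suminf) (use I in auto)
    finally show "ennreal e \<le> (\<Sum>i. hpow t (C i))" .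
  qed
  also have "\<dots> \<le> hausdorff_measure t K" by (rule hausdorff_approx_le_measure) simp
  finally show ?thesis using e by (meson ennreal_less_zero_iff less_le_trans)
qed

abbreviation "\<alpha> \<equiv> hausdorff_dim K"

theorem similarity_exponent_hausdorff_dim: "similarity_exponent \<alpha>"
proof -
  obtain s where s: "similarity_exponent s" using similarity_exponent_exists by blast
  have "{t. 0 \<le> t \<and> hausdorff_measure t K = 0} = {s<..}"
    using hausdorff_measure_K_eq_0[OF s] hausdorff_measure_K_pos[OF s] s
    by (fastforce simp: not_le similarity_exponent_def)
  then show ?thesis using s by (simp add: hausdorff_dim_def)
qed

lemma hausdorff_dim_pos: "\<alpha> > 0"
  using similarity_exponent_hausdorff_dim by (simp add: similarity_exponent_def)

lemma hausdorff_measure_K_nontrivial: "hausdorff_measure \<alpha> K \<noteq> 0" "hausdorff_measure \<alpha> K \<noteq> top"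
  using hausdorff_measure_K_pos[of \<alpha> \<alpha>] hausdorff_measure_K_finite[of \<alpha>]
    similarity_exponent_hausdorff_dim by auto

lemma K_borel [measurable, simp]: "K \<in> sets borel"
  using K_compact by (simp add: borel_closed compact_imp_closed)

lemma cell_borel [simp]: "w \<in> words \<Longrightarrow> cell w \<in> sets borel"
  using compact_cell by (simp add: borel_closed compact_imp_closed)

lemma nu_measure_space:
  "measure_space UNIV (sets borel) (\<lambda>B. hausdorff_measure \<alpha> (B \<inter> K) / hausdorff_measure \<alpha> K)"
proof -
  have space: "measure_space UNIV (sets borel) (hausdorff_measure \<alpha> :: 'a set \<Rightarrow> ennreal)"
    by (rule hausdorff.borel_measure_space)
  have "countably_additive (sets borel) (\<lambda>B. hausdorff_measure \<alpha> (B \<inter> K) / hausdorff_measure \<alpha> K)"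
    unfolding countably_additive_def
  proof (intro allI impI)
    fix A :: "nat \<Rightarrow> 'a set"
    assume A: "range A \<subseteq> sets borel" "disjoint_family A" "\<Union> (range A) \<in> sets borel"
    have "(\<Sum>i. hausdorff_measure \<alpha> (A i \<inter> K)) = hausdorff_measure \<alpha> (\<Union>i. A i \<inter> K)"
    proof (rule space[unfolded measure_space_def countably_additive_def,
          THEN conjunct2, THEN conjunct2, rule_format])
      show "range (\<lambda>i. A i \<inter> K) \<subseteq> sets borel" using A by auto
      then show "(\<Union>i. A i \<inter> K) \<in> sets borel" by (intro sets.countable_UN) auto
      show "disjoint_family (\<lambda>i. A i \<inter> K)" using A(2) by (auto simp: disjoint_family_on_def)
    qed
    then show "(\<Sum>i. hausdorff_measure \<alpha> (A i \<inter> K) / hausdorff_measure \<alpha> K) =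
       hausdorff_measure \<alpha> (\<Union> (range A) \<inter> K) / hausdorff_measure \<alpha> K"
      by (simp add: ennreal_suminf_divide)
  qed
  then show ?thesis using space by (simp add: measure_space_def positive_def)
qed

lemma sets_nu [measurable_cong, simp]: "sets (nu K) = sets borel"
  unfolding nu_def by (subst sets_measure_of) (auto simp: sets.sigma_sets_eq[of borel, simplified])

lemma space_nu [simp]: "space (nu K) = UNIV"
  unfolding nu_def by (subst space_measure_of) auto

lemma emeasure_nu:
  "B \<in> sets borel \<Longrightarrow> emeasure (nu K) B = hausdorff_measure \<alpha> (B \<inter> K) / hausdorff_measure \<alpha> K"
  using nu_measure_space unfolding nu_def measure_space_def
  by (intro emeasure_measure_of_sigma) auto

lemma emeasure_nu_UNIV: "emeasure (nu K) UNIV = 1"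
  and emeasure_nu_K: "emeasure (nu K) K = 1"
  using hausdorff_measure_K_nontrivial mult_divide_eq_ennreal[of "hausdorff_measure \<alpha> K" 1]
  by (simp_all add: emeasure_nu)

sublocale nu: finite_measure "nu K"
  by (rule finite_measureI) (simp add: emeasure_nu_UNIV)

lemma measure_nu_UNIV [simp]: "measure (nu K) UNIV = 1"
  by (simp add: measure_def emeasure_nu_UNIV)

lemma AE_nu_K: "AE x in nu K. x \<in> K"
proof -
  have "emeasure (nu K) (UNIV - K) = 0"
    using Diff_disjoint[of K UNIV] by (simp add: emeasure_nu Int_commute)
  then show ?thesis by (intro AE_I[of _ _ "UNIV - K"]) auto
qed

lemma borel_measurable_extend_continuous_on_K:
  fixes f :: "'a \<Rightarrow> real"
  assumes "continuous_on K f" "\<And>x. x \<notin> K \<Longrightarrow> f x = k"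
  shows "f \<in> borel_measurable borel"
proof -
  have [measurable]: "(\<lambda>x. indicator K x *\<^sub>R f x) \<in> borel_measurable borel"
    by (rule borel_measurable_continuous_on_indicator) (use assms in auto)
  have "f = (\<lambda>x. if x \<in> K then indicator K x *\<^sub>R f x else k)" using assms by (auto simp: indicator_def)
  also have "\<dots> \<in> borel_measurable borel" by measurable
  finally show ?thesis .
qed

lemma bounded_image_K: "continuous_on K f \<Longrightarrow> bounded (f ` K)"
  using K_compact by (intro compact_imp_bounded compact_continuous_image)

lemma continuous_on_K_bounded:
  fixes f :: "'a \<Rightarrow> real"
  assumes "continuous_on K f"
  obtains B where "B > 0" "\<And>\<xi>. \<xi> \<in> K \<Longrightarrow> \<bar>f \<xi>\<bar> \<le> B"
  using bounded_image_K[OF assms] that unfolding bounded_pos by auto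

lemma integrable_nu_continuous:
  fixes f :: "'a \<Rightarrow> real"
  assumes "f \<in> borel_measurable borel" "continuous_on K f"
  shows "integrable (nu K) f"
proof -
  obtain B where "\<And>\<xi>. \<xi> \<in> K \<Longrightarrow> \<bar>f \<xi>\<bar> \<le> B" using continuous_on_K_bounded[OF assms(2)] by blast
  then have "AE x in nu K. norm (f x) \<le> B" using AE_nu_K by (auto elim!: eventually_mono)
  then show ?thesis using assms(1) by (intro nu.integrable_const_bound[of _ B]) auto
qed

definition "weight x = rw \<rho> x powr \<alpha>"

lemma weight_nonneg [simp]: "0 \<le> weight x"
  by (simp add: weight_def)

lemma weight_pos: "x \<in> \<J> n \<Longrightarrow> weight x > 0"
  using rw_pos[OF J_words] by (simp add: weight_def order_less_imp_not_eq2)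

lemma weight_Nil [simp]: "weight [] = 1"
  by (simp add: weight_def)

lemma sum_weight_descendants: "above n v \<Longrightarrow> (\<Sum>z\<in>descendants n v. weight z) = weight v"
  unfolding weight_def by (rule sum_powr_descendants[OF similarity_exponent_hausdorff_dim])

lemma sum_weight_J: "(\<Sum>z\<in>\<J> n. weight z) = 1"
  unfolding weight_def by (rule sum_powr_J[OF similarity_exponent_hausdorff_dim])

lemma measure_nu_cell_le:
  assumes "w \<in> words"
  shows "measure (nu K) (cell w) \<le> weight w"
proof -
  have "emeasure (nu K) (cell w) = hausdorff_measure \<alpha> (cell w) / hausdorff_measure \<alpha> K"
    using emeasure_nu[OF cell_borel[OF assms]] cell_subset_K[OF assms] by (simp add: Int_absorb2)
  also have "\<dots> \<le> ennreal (weight w) * hausdorff_measure \<alpha> K / hausdorff_measure \<alpha> K"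
    unfolding weight_def using rw_pos similitude_Sw assms
    by (intro divide_right_mono_ennreal hausdorff_measure_similitude_image_le) auto
  also have "\<dots> = ennreal (weight w)"
    using hausdorff_measure_K_nontrivial by (rule mult_divide_eq_ennreal)
  finally show ?thesis by (simp add: nu.emeasure_eq_measure)
qed

text \<open>The upper bounds add up to the total mass, so none of them is strict.\<close>

theorem measure_nu_cell:
  assumes "w \<in> \<J> n"
  shows "measure (nu K) (cell w) = weight w"
proof -
  let ?defect = "\<lambda>v. weight v - measure (nu K) (cell v)"
  have "1 = measure (nu K) (\<Union>v\<in>\<J> n. cell v)"
    using emeasure_nu_K K_eq_UN_cells[of n] by (simp add: measure_def)
  also have "\<dots> \<le> (\<Sum>v\<in>\<J> n. measure (nu K) (cell v))"
    using finite_J cell_borel[OF J_words] by (intro nu.finite_measure_subadditive_finite) auto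
  finally have "(\<Sum>v\<in>\<J> n. ?defect v) \<le> 0" using sum_weight_J by (simp add: sum_subtractf)
  moreover have nonneg: "0 \<le> ?defect v" if "v \<in> \<J> n" for v
    using measure_nu_cell_le[OF J_words[OF that]] by simp
  then have "0 \<le> (\<Sum>v\<in>\<J> n. ?defect v)" by (rule sum_nonneg)
  ultimately have "(\<Sum>v\<in>\<J> n. ?defect v) = 0" by linarith
  then have "\<forall>v\<in>\<J> n. ?defect v = 0"
    using sum_nonneg_eq_0_iff[OF finite_J, of n ?defect] nonneg by blast
  then show ?thesis using assms by auto
qed

lemma integrable_nu_indicator_cell:
  "w \<in> \<J> n \<Longrightarrow> integrable (nu K) (indicator (cell w) :: 'a \<Rightarrow> real)"
  using cell_borel[OF J_words]
  by (intro nu.integrable_const_bound[of _ 1]) (auto simp: indicator_def)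

lemma AE_sum_indicator_cells: "AE x in nu K. (\<Sum>w\<in>\<J> n. indicator (cell w) x) = (1::real)"
proof -
  let ?f = "\<lambda>x. (\<Sum>w\<in>\<J> n. indicator (cell w) x) - (1::real)"
  have integrable: "integrable (nu K) (\<lambda>x. \<Sum>w\<in>\<J> n. indicator (cell w) x :: real)"
    by (intro Bochner_Integration.integrable_sum integrable_nu_indicator_cell)
  have "(\<integral>x. (\<Sum>w\<in>\<J> n. indicator (cell w) x) \<partial>nu K) = (\<Sum>w\<in>\<J> n. measure (nu K) (cell w))"
    by (simp add: integrable_nu_indicator_cell cong: sum.cong)
  also have "\<dots> = (\<Sum>w\<in>\<J> n. weight w)" by (intro sum.cong refl measure_nu_cell)
  finally have "(\<integral>x. (\<Sum>w\<in>\<J> n. indicator (cell w) x) \<partial>nu K) = (\<Sum>w\<in>\<J> n. weight w)" .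
  then have "integral\<^sup>L (nu K) ?f = 0"
    using integrable by (simp add: sum_weight_J)
  moreover have "AE x in nu K. 0 \<le> ?f x"
    using AE_nu_K
  proof eventually_elim
    case (elim x)
    then obtain w where w: "w \<in> \<J> n" "x \<in> cell w" using ex_level_cell by blast
    have "(indicator (cell w) x :: real) \<le> (\<Sum>w\<in>\<J> n. indicator (cell w) x)"
      using w finite_J by (intro member_le_sum) auto
    then show ?case using w by simp
  qed
  ultimately have "AE x in nu K. ?f x = 0"
    using integrable by (subst (asm) integral_nonneg_eq_0_iff_AE) auto
  then show ?thesis by eventually_elim auto
qed

lemma riemann_sum_bound:
  assumes psi: "integrable (nu K) \<psi>"
    and e: "\<And>y x. y \<in> \<J> n \<Longrightarrow> x \<in> cell y \<Longrightarrow> \<bar>\<phi> y - \<psi> x\<bar> \<le> e"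
  shows "\<bar>(\<Sum>y\<in>\<J> n. weight y * \<phi> y) - (\<integral>x. \<psi> x \<partial>nu K)\<bar> \<le> e"
proof -
  let ?f = "\<lambda>x. \<Sum>y\<in>\<J> n. indicator (cell y) x * \<phi> y"
  have integrable: "integrable (nu K) ?f"
    by (intro Bochner_Integration.integrable_sum integrable_mult_left integrable_nu_indicator_cell)
  have "integral\<^sup>L (nu K) ?f = (\<Sum>y\<in>\<J> n. measure (nu K) (cell y) * \<phi> y)"
    by (simp add: integrable_nu_indicator_cell cong: sum.cong)
  also have "\<dots> = (\<Sum>y\<in>\<J> n. weight y * \<phi> y)" by (intro sum.cong refl) (simp add: measure_nu_cell)
  finally have "(\<Sum>y\<in>\<J> n. weight y * \<phi> y) - (\<integral>x. \<psi> x \<partial>nu K) = (\<integral>x. ?f x - \<psi> x \<partial>nu K)"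
    using integrable psi by simp
  also have "\<bar>\<dots>\<bar> \<le> (\<integral>x. \<bar>?f x - \<psi> x\<bar> \<partial>nu K)"
    using integral_norm_bound[of "nu K" "\<lambda>x. ?f x - \<psi> x"] by simp
  also have "\<dots> \<le> (\<integral>x. e \<partial>nu K)"
  proof (rule integral_mono_AE)
    show "AE x in nu K. \<bar>?f x - \<psi> x\<bar> \<le> e"
      using AE_sum_indicator_cells[of n]
    proof eventually_elim
      case (elim x)
      have "?f x - \<psi> x = ?f x - (\<Sum>w\<in>\<J> n. indicator (cell w) x) * \<psi> x" using elim by simp
      also have "\<dots> = (\<Sum>y\<in>\<J> n. indicator (cell y) x * (\<phi> y - \<psi> x))"
        by (simp add: sum_distrib_right sum_subtractf[symmetric] right_diff_distrib)
      also have "\<bar>\<dots>\<bar> \<le> (\<Sum>y\<in>\<J> n. indicator (cell y) x * e)"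
        using e by (intro order_trans[OF sum_abs] sum_mono) (auto simp: indicator_def)
      also have "\<dots> = e" using elim by (simp flip: sum_distrib_right)
      finally show ?case .
    qed
  qed (use integrable psi in auto)
  also have "\<dots> = e" by simp
  finally show ?thesis .
qed

end

section \<open>Reversible random walks on locally finite weighted graphs\<close>

locale weighted_graph =
  fixes c :: "'v \<Rightarrow> 'v \<Rightarrow> real"
  assumes c_nonneg: "0 \<le> c x y" and c_sym: "c x y = c y x"
    and finite_nonzero: "finite {y. c x y \<noteq> 0}"
begin

definition "neighbours x = {y. c x y \<noteq> 0}"

definition "conductance x = (\<Sum>y\<in>neighbours x. c x y)"

definition "transition x y = c x y / conductance x"

primrec step_prob :: "nat \<Rightarrow> 'v \<Rightarrow> 'v \<Rightarrow> real" where
  "step_prob 0 x y = (if x = y then 1 else 0)"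
| "step_prob (Suc n) x y = (\<Sum>z\<in>neighbours x. transition x z * step_prob n z y)"

definition "green_fn x y = (\<Sum>n. step_prob n x y)"

definition diff_operator :: "('v \<Rightarrow> 'v \<Rightarrow> real) \<Rightarrow> ('v \<Rightarrow> real) \<Rightarrow> 'v \<Rightarrow> real" where
  "diff_operator w f x = (\<Sum>y\<in>neighbours x. w x y * (f y - f x))"

abbreviation "laplacian \<equiv> diff_operator c"

lemma finite_neighbours: "finite (neighbours x)"
  using finite_nonzero by (simp add: neighbours_def)

lemma neighbours_sym: "y \<in> neighbours x \<longleftrightarrow> x \<in> neighbours y"
  using c_sym by (simp add: neighbours_def)

lemma diff_operator_linear:
  "diff_operator w (\<lambda>y. f y + t * g y) x = diff_operator w f x + t * diff_operator w g x"
  unfolding diff_operator_def sum_distrib_left sum.distrib[symmetric]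
  by (intro sum.cong refl) (simp add: algebra_simps)

lemma diff_operator_const [simp]: "diff_operator w (\<lambda>_. k) x = 0"
  by (simp add: diff_operator_def)

lemma diff_operator_scale: "diff_operator w (\<lambda>y. k * f y) x = k * diff_operator w f x"
  using diff_operator_linear[of w "\<lambda>_. 0" k f x] by simp

lemma diff_operator_cong:
  assumes "f x = g x" "\<And>y. y \<in> neighbours x \<Longrightarrow> f y = g y"
  shows "diff_operator w f x = diff_operator w g x"
  unfolding diff_operator_def using assms by (intro sum.cong) auto

lemma diff_operator_add_const: "diff_operator w (\<lambda>y. k + f y) x = diff_operator w f x"
  by (simp add: diff_operator_def)

lemma diff_operator_uminus: "diff_operator w (\<lambda>y. - f y) x = - diff_operator w f x"
  using diff_operator_scale[of w "-1" f x] by simp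

lemma diff_operator_nonneg:
  assumes "\<And>y. y \<in> neighbours x \<Longrightarrow> 0 \<le> w x y" "\<And>y. y \<in> neighbours x \<Longrightarrow> f x \<le> f y"
  shows "0 \<le> diff_operator w f x"
  unfolding diff_operator_def using assms by (intro sum_nonneg mult_nonneg_nonneg) auto

lemma harnack_edge:
  assumes "diff_operator w v x = 0" "\<And>y. y \<in> neighbours x \<Longrightarrow> 0 \<le> w x y" "\<And>y. y \<in> neighbours x \<Longrightarrow> 0 \<le> v y"
    and z: "z \<in> neighbours x"
  shows "w x z * v z \<le> (\<Sum>y\<in>neighbours x. w x y) * v x"
proof -
  have "w x z * v z \<le> (\<Sum>y\<in>neighbours x. w x y * v y)"
    using assms finite_neighbours by (intro member_le_sum[OF z]) auto
  also have "\<dots> = (\<Sum>y\<in>neighbours x. w x y) * v x"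
    using assms(1) by (simp add: diff_operator_def right_diff_distrib sum_subtractf sum_distrib_right)
  finally show ?thesis .
qed

lemma doob_transform:
  "laplacian (\<lambda>y. h y * f y) x = diff_operator (\<lambda>x y. c x y * h y) f x + f x * laplacian h x"
  unfolding diff_operator_def sum_distrib_left sum.distrib[symmetric]
  by (intro sum.cong refl) (simp add: algebra_simps)

text \<open>A small multiple of the strict supersolution \<open>s\<close> makes the minimum of \<open>v\<close> attained.\<close>

lemma minimum_principle:
  assumes w: "\<And>y z. y \<in> U \<Longrightarrow> z \<in> neighbours y \<Longrightarrow> 0 \<le> w y z"
    and super: "\<And>y. y \<in> U \<Longrightarrow> diff_operator w v y \<le> 0"
    and strict: "\<And>y. y \<in> U \<Longrightarrow> diff_operator w s y < 0"
    and boundary: "\<And>y z. y \<in> U \<Longrightarrow> z \<in> neighbours y \<Longrightarrow> z \<notin> U \<Longrightarrow> 0 \<le> v z \<and> 0 \<le> s z"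
    and fin: "\<And>e. e > 0 \<Longrightarrow> finite {y\<in>U. v y + e * s y < 0}"
    and x: "x \<in> U"
  shows "0 \<le> v x"
proof (rule ccontr)
  assume "\<not> 0 \<le> v x"
  define e where "e = - v x / (2 * (\<bar>s x\<bar> + 1))"
  have e: "e > 0" using \<open>\<not> 0 \<le> v x\<close> by (simp add: e_def field_simps)
  have "e * s x \<le> e * (\<bar>s x\<bar> + 1)" using e by (intro mult_left_mono) auto
  also have "\<dots> = - v x / 2" by (simp add: e_def field_simps)
  finally have ux: "v x + e * s x < 0" using \<open>\<not> 0 \<le> v x\<close> by simp
  define u where "u y = v y + e * s y" for y
  let ?A = "{y\<in>U. u y < 0}"
  have "finite ?A" "?A \<noteq> {}" using fin[OF e] x ux by (auto simp: u_def)
  then obtain y where y: "y \<in> ?A" "\<And>z. z \<in> ?A \<Longrightarrow> u y \<le> u z"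
    using ex_is_arg_min_if_finite[of ?A u] by (auto simp: is_arg_min_linorder)
  then have yU: "y \<in> U" by simp
  have "u y \<le> u z" if z: "z \<in> neighbours y" for z
  proof (cases "z \<in> U")
    case True
    then show ?thesis using y by (cases "u z < 0") auto
  next
    case False
    then have "0 \<le> u z" using boundary[OF yU z] e by (simp add: u_def)
    then show ?thesis using y(1) by simp
  qed
  then have "0 \<le> diff_operator w u y" using w[OF yU] by (intro diff_operator_nonneg)
  also have "diff_operator w u y = diff_operator w v y + e * diff_operator w s y"
    unfolding u_def by (rule diff_operator_linear)
  finally show False using super[OF yU] mult_pos_neg[OF e strict[OF yU]] by linarith
qed

text \<open>Green's second identity: the terms of the edges inside \<open>A\<close> cancel by antisymmetry.\<close>

lemma green_identity:
  assumes "finite A"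
  shows "(\<Sum>x\<in>A. f x * laplacian g x - g x * laplacian f x)
    = (\<Sum>x\<in>A. \<Sum>y\<in>neighbours x - A. c x y * (f x * g y - g x * f y))"
proof -
  let ?F = "\<lambda>x y. c x y * (f x * g y - g x * f y)"
  have antisym: "?F y x = - ?F x y" for x y by (simp add: c_sym[of y x] algebra_simps)
  have "(\<Sum>x\<in>A. \<Sum>y\<in>A. ?F x y) = (\<Sum>x\<in>A. \<Sum>y\<in>A. ?F y x)" by (rule sum.swap)
  also have "\<dots> = (\<Sum>x\<in>A. \<Sum>y\<in>A. - ?F x y)" by (intro sum.cong refl antisym)
  also have "\<dots> = - (\<Sum>x\<in>A. \<Sum>y\<in>A. ?F x y)" by (simp only: sum_negf)
  finally have cancel: "(\<Sum>x\<in>A. \<Sum>y\<in>A. ?F x y) = 0" by simp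
  have "f x * laplacian g x - g x * laplacian f x = (\<Sum>y\<in>neighbours x. ?F x y)" for x
    unfolding diff_operator_def sum_distrib_left sum_subtractf[symmetric]
    by (intro sum.cong refl) (simp add: algebra_simps)
  also have "\<dots> x = (\<Sum>y\<in>A. ?F x y) + (\<Sum>y\<in>neighbours x - A. ?F x y)" for x
  proof -
    have "(\<Sum>y\<in>neighbours x. ?F x y) = (\<Sum>y\<in>neighbours x \<inter> A. ?F x y) + (\<Sum>y\<in>neighbours x - A. ?F x y)"
      by (rule sum.Int_Diff[OF finite_neighbours])
    moreover have "(\<Sum>y\<in>neighbours x \<inter> A. ?F x y) = (\<Sum>y\<in>A. ?F x y)"
      using assms by (intro sum.mono_neutral_left) (auto simp: neighbours_def)
    ultimately show ?thesis by simp
  qed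
  finally show ?thesis by (simp add: sum.distrib cancel)
qed

lemma conductance_nonneg: "0 \<le> conductance x"
  unfolding conductance_def by (intro sum_nonneg c_nonneg)

lemma c_le_conductance: "c x y \<le> conductance x"
proof (cases "y \<in> neighbours x")
  case True
  then show ?thesis
    unfolding conductance_def by (intro member_le_sum finite_neighbours c_nonneg)
next
  case False
  then show ?thesis using conductance_nonneg by (simp add: neighbours_def)
qed

lemma conductance_mult_transition: "conductance x * transition x y = c x y"
  using c_le_conductance[of x y] c_nonneg[of x y] by (simp add: transition_def)

lemma transition_nonneg: "0 \<le> transition x y"
  unfolding transition_def using c_nonneg conductance_nonneg by simp

lemma transition_eq_0: "y \<notin> neighbours x \<Longrightarrow> transition x y = 0"
  by (simp add: transition_def neighbours_def)

lemma transition_pos: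
  assumes "y \<in> neighbours x"
  shows "0 < transition x y"
proof -
  have "transition x y \<noteq> 0" using assms conductance_mult_transition[of x y] by (auto simp: neighbours_def)
  then show ?thesis using transition_nonneg[of x y] by simp
qed

lemma laplacian_eq_transition:
  "laplacian f x = conductance x * ((\<Sum>y\<in>neighbours x. transition x y * f y) - f x)"
proof -
  have "conductance x * (\<Sum>y\<in>neighbours x. transition x y * f y) = (\<Sum>y\<in>neighbours x. c x y * f y)"
    unfolding sum_distrib_left mult.assoc[symmetric] conductance_mult_transition ..
  moreover have "conductance x * f x = (\<Sum>y\<in>neighbours x. c x y * f x)"
    unfolding conductance_def by (rule sum_distrib_right)
  ultimately show ?thesis by (simp add: diff_operator_def right_diff_distrib sum_subtractf)
qed

lemma step_prob_nonneg: "0 \<le> step_prob n x y"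
  by (induction n arbitrary: x) (auto intro!: sum_nonneg mult_nonneg_nonneg transition_nonneg)

lemma step_prob_mult_le: "step_prob m x z * step_prob n z y \<le> step_prob (m + n) x y"
proof (induction m arbitrary: x)
  case 0
  then show ?case using step_prob_nonneg by simp
next
  case (Suc m)
  have "step_prob (Suc m) x z * step_prob n z y
      = (\<Sum>u\<in>neighbours x. transition x u * (step_prob m u z * step_prob n z y))"
    by (simp add: sum_distrib_right mult.assoc)
  also have "\<dots> \<le> (\<Sum>u\<in>neighbours x. transition x u * step_prob (m + n) u y)"
    using Suc transition_nonneg by (intro sum_mono mult_left_mono)
  finally show ?case by simp
qed

lemma step_prob_1: "step_prob (Suc 0) x y = transition x y"
  using finite_neighbours transition_eq_0
  by (auto simp: if_distrib[of "\<lambda>t. _ * t"] sum.delta cong: if_cong)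

lemma step_prob_Suc_right: "step_prob (Suc n) x y = (\<Sum>z\<in>neighbours y. step_prob n x z * transition z y)"
proof (induction n arbitrary: x)
  case 0
  have "(\<Sum>z\<in>neighbours y. step_prob 0 x z * transition z y) = transition x y"
    using finite_neighbours transition_eq_0[of y x] neighbours_sym[of x y]
    by (auto simp: if_distrib[of "\<lambda>t. t * _"] sum.delta cong: if_cong)
  then show ?case by (simp only: step_prob_1)
next
  case (Suc n)
  have "step_prob (Suc (Suc n)) x y
      = (\<Sum>u\<in>neighbours x. transition x u * (\<Sum>z\<in>neighbours y. step_prob n u z * transition z y))"
    using Suc by (simp only: step_prob.simps(2)[of "Suc n"])
  also have "\<dots> = (\<Sum>z\<in>neighbours y. \<Sum>u\<in>neighbours x. transition x u * step_prob n u z * transition z y)"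
    by (simp add: sum_distrib_left mult.assoc sum.swap[of _ "neighbours y"])
  also have "\<dots> = (\<Sum>z\<in>neighbours y. step_prob (Suc n) x z * transition z y)"
    by (simp add: sum_distrib_right)
  finally show ?case .
qed

lemma step_prob_reversible: "conductance x * step_prob n x y = conductance y * step_prob n y x"
proof (induction n arbitrary: x)
  case (Suc n)
  have "conductance x * step_prob (Suc n) x y
      = (\<Sum>z\<in>neighbours x. (conductance x * transition x z) * step_prob n z y)"
    by (simp add: sum_distrib_left mult.assoc)
  also have "\<dots> = (\<Sum>z\<in>neighbours x. transition z x * (conductance z * step_prob n z y))"
    unfolding conductance_mult_transition c_sym[of x]
    by (simp add: conductance_mult_transition[symmetric] mult_ac)
  also have "\<dots> = conductance y * step_prob (Suc n) y x"
    unfolding Suc step_prob_Suc_right by (simp add: sum_distrib_left mult_ac)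
  finally show ?case .
qed auto

lemma step_prob_Suc_pos:
  assumes "z \<in> neighbours x" "0 < step_prob n z y"
  shows "0 < step_prob (Suc n) x y"
proof -
  have "0 < transition x z * step_prob n z y" using assms transition_pos by simp
  also have "\<dots> \<le> (\<Sum>z\<in>neighbours x. transition x z * step_prob n z y)"
    using assms(1) finite_neighbours transition_nonneg step_prob_nonneg by (intro member_le_sum) auto
  finally show ?thesis by simp
qed

lemma supersolution_bounds_green:
  assumes g: "\<And>x. 0 \<le> g x"
    and super: "\<And>x. (\<Sum>z\<in>neighbours x. transition x z * g z) \<le> g x - step_prob 0 x y"
  shows "summable (\<lambda>n. step_prob n x y)" "green_fn x y \<le> g x"
proof -
  have bound: "(\<Sum>k<n. step_prob k x y) \<le> g x" for n x
  proof (induction n arbitrary: x)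
    case (Suc n)
    have "(\<Sum>k<n. step_prob (Suc k) x y) = (\<Sum>z\<in>neighbours x. transition x z * (\<Sum>k<n. step_prob k z y))"
      by (simp add: sum_distrib_left sum.swap[of _ "{..<n}"])
    also have "\<dots> \<le> (\<Sum>z\<in>neighbours x. transition x z * g z)"
      using Suc transition_nonneg by (intro sum_mono mult_left_mono)
    finally show ?case using super[of x] by (simp only: sum.lessThan_Suc_shift)
  qed (use g in simp)
  show "summable (\<lambda>n. step_prob n x y)"
    by (rule bounded_imp_summable[of _ "g x"])
       (use bound[of x "Suc _"] step_prob_nonneg in \<open>auto simp: lessThan_Suc_atMost simp del: sum.lessThan_Suc\<close>)
  then show "green_fn x y \<le> g x"
    unfolding green_fn_def using bound by (intro suminf_le_const) auto
qed

lemma summable_step_prob_of_reachable: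
  assumes "summable (\<lambda>n. step_prob n x z)" "0 < step_prob j y z"
  shows "summable (\<lambda>n. step_prob n x y)" "green_fn x y * step_prob j y z \<le> green_fn x z"
proof -
  have le: "step_prob n x y * step_prob j y z \<le> step_prob (n + j) x z" for n
    by (rule step_prob_mult_le)
  have shift: "summable (\<lambda>n. step_prob (n + j) x z)" using assms(1) by (subst summable_iff_shift)
  have prod: "summable (\<lambda>n. step_prob n x y * step_prob j y z)"
    by (rule summable_comparison_test'[OF shift, of 0]) (use le step_prob_nonneg assms(2) in auto)
  then show summable: "summable (\<lambda>n. step_prob n x y)"
    using summable_mult2[OF prod, of "1 / step_prob j y z"] assms(2) by simp
  have "green_fn x y * step_prob j y z = (\<Sum>n. step_prob n x y * step_prob j y z)"
    unfolding green_fn_def using suminf_mult2[OF summable] by simp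
  also have "\<dots> \<le> (\<Sum>n. step_prob (n + j) x z)" by (rule suminf_le[OF le prod shift])
  also have "\<dots> \<le> (\<Sum>n. step_prob n x z)"
    using suminf_split_initial_segment[OF assms(1), of j] step_prob_nonneg by (simp add: sum_nonneg)
  finally show "green_fn x y * step_prob j y z \<le> green_fn x z" by (simp add: green_fn_def)
qed

lemma green_fn_first_step:
  assumes "\<And>x. summable (\<lambda>n. step_prob n x y)"
  shows "green_fn x y = (if x = y then 1 else 0) + (\<Sum>z\<in>neighbours x. transition x z * green_fn z y)"
proof -
  have "green_fn x y = step_prob 0 x y + (\<Sum>n. step_prob (Suc n) x y)"
    unfolding green_fn_def using suminf_split_head[OF assms[of x]] by simp
  also have "(\<Sum>n. step_prob (Suc n) x y) = (\<Sum>z\<in>neighbours x. \<Sum>n. transition x z * step_prob n z y)"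
    unfolding step_prob.simps(2) using assms by (intro suminf_sum summable_mult)
  also have "\<dots> = (\<Sum>z\<in>neighbours x. transition x z * green_fn z y)"
    unfolding green_fn_def using assms by (intro sum.cong refl suminf_mult)
  finally show ?thesis by simp
qed

end

locale transient_graph = weighted_graph +
  assumes summable_step_prob: "summable (\<lambda>n. step_prob n x y)"
begin

lemma green_fn_nonneg: "0 \<le> green_fn x y"
  unfolding green_fn_def using summable_step_prob step_prob_nonneg by (intro suminf_nonneg)

lemma laplacian_green_fn: "laplacian (\<lambda>x. green_fn x y) x = (if x = y then - conductance x else 0)"
  using green_fn_first_step[OF summable_step_prob, of x y]
    laplacian_eq_transition[of "\<lambda>x. green_fn x y" x] by (auto simp: algebra_simps)

lemma green_fn_reversible: "conductance x * green_fn x y = conductance y * green_fn y x"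
proof -
  have "conductance x * green_fn x y = (\<Sum>n. conductance x * step_prob n x y)"
    unfolding green_fn_def using suminf_mult[OF summable_step_prob] by simp
  also have "\<dots> = (\<Sum>n. conductance y * step_prob n y x)" by (simp only: step_prob_reversible[of x])
  also have "\<dots> = conductance y * green_fn y x"
    unfolding green_fn_def using suminf_mult[OF summable_step_prob] by simp
  finally show ?thesis .
qed

end

section \<open>Energy on weighted graphs\<close>

context weighted_graph
begin

definition "energy_on A f = (\<Sum>x\<in>A. \<Sum>y\<in>A. c x y * (f x - f y)\<^sup>2) / 2"

definition "energy_form A f g = (\<Sum>x\<in>A. \<Sum>y\<in>A. c x y * (f x - f y) * (g x - g y)) / 2"

definition "energy f = (\<integral>\<^sup>+p. ennreal (c (fst p) (snd p) * (f (fst p) - f (snd p))\<^sup>2) \<partial>count_space UNIV) / 2"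

lemma energy_on_eq_form: "energy_on A f = energy_form A f f"
  by (simp add: energy_on_def energy_form_def power2_eq_square mult.assoc)

lemma energy_on_nonneg: "0 \<le> energy_on A f"
  unfolding energy_on_def by (auto intro!: sum_nonneg divide_nonneg_nonneg mult_nonneg_nonneg c_nonneg)

lemma energy_on_const [simp]: "energy_on A (\<lambda>_. k) = 0"
  by (simp add: energy_on_def)

lemma energy_on_cong: "(\<And>x. x \<in> A \<Longrightarrow> f x = g x) \<Longrightarrow> energy_on A f = energy_on A g"
  by (simp add: energy_on_def)

lemma energy_on_eq_sum_pairs:
  "energy_on A f = (\<Sum>p\<in>A \<times> A. c (fst p) (snd p) * (f (fst p) - f (snd p))\<^sup>2) / 2"
  unfolding energy_on_def by (simp add: sum.cartesian_product split_def)

lemma energy_on_mono: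
  assumes "finite B" "A \<subseteq> B"
  shows "energy_on A f \<le> energy_on B f"
  unfolding energy_on_eq_sum_pairs using assms c_nonneg
  by (intro divide_right_mono sum_mono2) (auto intro: finite_subset)

lemma edge_le_energy_on:
  assumes "finite A" "x \<in> A" "y \<in> A"
  shows "c x y * (f x - f y)\<^sup>2 \<le> energy_on A f"
proof (cases "x = y")
  case False
  have "2 * (c x y * (f x - f y)\<^sup>2) = (\<Sum>p\<in>{(x, y), (y, x)}. c (fst p) (snd p) * (f (fst p) - f (snd p))\<^sup>2)"
    using False c_sym[of x y] by (simp add: power2_commute)
  also have "\<dots> \<le> (\<Sum>p\<in>A \<times> A. c (fst p) (snd p) * (f (fst p) - f (snd p))\<^sup>2)"
    using assms c_nonneg by (intro sum_mono2) auto
  finally show ?thesis by (simp add: energy_on_eq_sum_pairs)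
qed (simp add: energy_on_nonneg)

lemma energy_on_lipschitz:
  assumes "\<And>x y. \<bar>g x - g y\<bar> \<le> t * \<bar>f x - f y\<bar>"
  shows "energy_on A g \<le> t\<^sup>2 * energy_on A f"
proof -
  have "c x y * (g x - g y)\<^sup>2 \<le> t\<^sup>2 * (c x y * (f x - f y)\<^sup>2)" for x y
  proof -
    have "(g x - g y)\<^sup>2 \<le> (t * \<bar>f x - f y\<bar>)\<^sup>2"
      using power_mono[OF assms abs_ge_zero, of x y 2] by simp
    then show ?thesis
      using mult_left_mono[OF _ c_nonneg] by (fastforce simp: power_mult_distrib mult.left_commute)
  qed
  then show ?thesis
    unfolding energy_on_def by (simp add: sum_distrib_left divide_right_mono sum_mono)
qed

lemma energy_on_add: "energy_on A (\<lambda>x. f x + g x) = energy_on A f + energy_on A g + 2 * energy_form A f g"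
proof -
  have "(\<Sum>x\<in>A. \<Sum>y\<in>A. c x y * (f x + g x - (f y + g y))\<^sup>2)
      = (\<Sum>x\<in>A. \<Sum>y\<in>A. c x y * (f x - f y)\<^sup>2) + (\<Sum>x\<in>A. \<Sum>y\<in>A. c x y * (g x - g y)\<^sup>2)
        + 2 * (\<Sum>x\<in>A. \<Sum>y\<in>A. c x y * (f x - f y) * (g x - g y))"
    unfolding sum_distrib_left sum.distrib[symmetric]
    by (intro sum.cong refl) (simp add: power2_eq_square algebra_simps)
  then show ?thesis unfolding energy_on_def energy_form_def by simp
qed

lemma energy_on_scale: "energy_on A (\<lambda>x. t * f x) = t\<^sup>2 * energy_on A f"
  unfolding energy_on_def
  by (simp add: right_diff_distrib[symmetric] power_mult_distrib sum_distrib_left mult.left_commute)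

lemma energy_form_uminus: "energy_form A f (\<lambda>x. - g x) = - energy_form A f g"
  unfolding energy_form_def by (simp add: sum_negf[symmetric] algebra_simps)

lemma energy_on_uminus: "energy_on A (\<lambda>x. - f x) = energy_on A f"
  using energy_on_scale[of A "-1" f] by simp

lemma energy_on_parallelogram:
  "energy_on A (\<lambda>x. (f x + g x) / 2) + energy_on A (\<lambda>x. (f x - g x) / 2) = (energy_on A f + energy_on A g) / 2"
proof -
  have half: "energy_on A (\<lambda>x. h x / 2) = energy_on A h / 4" for h
    using energy_on_scale[of A "1 / 2" h] by (simp add: power2_eq_square)
  show ?thesis
    unfolding half using energy_on_add[of A f g] energy_on_add[of A f "\<lambda>x. - g x"]
    by (simp add: energy_on_uminus energy_form_uminus field_simps)
qed

lemma energy_form_eq_sum: "energy_form A f g = (\<Sum>x\<in>A. g x * (\<Sum>y\<in>A. c x y * (f x - f y)))"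
proof -
  let ?T = "\<lambda>x y. c x y * (f x - f y) * g x"
  have antisym: "c y x * (f y - f x) * g x = - ?T x y" for x y
    using c_sym[of y x] by (simp add: algebra_simps)
  have "(\<Sum>x\<in>A. \<Sum>y\<in>A. c x y * (f x - f y) * g y) = (\<Sum>x\<in>A. \<Sum>y\<in>A. c y x * (f y - f x) * g x)"
    by (rule sum.swap)
  also have "\<dots> = - (\<Sum>x\<in>A. \<Sum>y\<in>A. ?T x y)"
    unfolding antisym by (simp add: sum_negf)
  finally have "(\<Sum>x\<in>A. \<Sum>y\<in>A. c x y * (f x - f y) * (g x - g y)) = 2 * (\<Sum>x\<in>A. \<Sum>y\<in>A. ?T x y)"
    by (simp add: right_diff_distrib sum_subtractf)
  then show ?thesis by (simp add: energy_form_def sum_distrib_left mult_ac)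
qed

lemma energy_form_point:
  assumes "finite A" "x \<in> A" "neighbours x \<subseteq> A"
  shows "energy_form A f (\<lambda>y. if y = x then t else 0) = - t * laplacian f x"
proof -
  have "energy_form A f (\<lambda>y. if y = x then t else 0)
      = (\<Sum>y\<in>A. if y = x then t * (\<Sum>z\<in>A. c y z * (f y - f z)) else 0)"
    unfolding energy_form_eq_sum by (intro sum.cong) auto
  also have "\<dots> = t * (\<Sum>z\<in>A. c x z * (f x - f z))" using assms by (simp add: sum.delta)
  also have "(\<Sum>z\<in>A. c x z * (f x - f z)) = (\<Sum>z\<in>neighbours x. c x z * (f x - f z))"
    using assms by (intro sum.mono_neutral_right) (auto simp: neighbours_def)
  also have "\<dots> = - laplacian f x"
    unfolding diff_operator_def sum_negf[symmetric] by (intro sum.cong refl) (simp add: algebra_simps)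
  finally show ?thesis by simp
qed

lemma energy_on_perturb_le:
  assumes A: "finite A" "x \<in> A" "neighbours x \<subseteq> A"
  shows "energy_on A (\<lambda>y. f y + (if y = x then t else 0))
    \<le> energy_on A f - 2 * t * laplacian f x + t\<^sup>2 * conductance x"
proof -
  let ?d = "\<lambda>y. if y = x then t else 0"
  have "energy_on A ?d = (\<Sum>y\<in>neighbours x. c x y * (t * (?d x - ?d y)))"
    unfolding energy_on_eq_form energy_form_point[OF A] diff_operator_def sum_distrib_left
    by (intro sum.cong refl) (simp add: algebra_simps)
  also have "\<dots> \<le> (\<Sum>y\<in>neighbours x. c x y * t\<^sup>2)"
    using c_nonneg by (intro sum_mono mult_left_mono) (auto simp: power2_eq_square)
  also have "\<dots> = t\<^sup>2 * conductance x" by (simp add: conductance_def sum_distrib_left mult.commute)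
  finally have "energy_on A ?d \<le> t\<^sup>2 * conductance x" .
  then show ?thesis unfolding energy_on_add energy_form_point[OF A] by simp
qed

lemma energy_on_tendsto:
  assumes "\<And>x. ((\<lambda>k. F k x) \<longlongrightarrow> f x) G"
  shows "((\<lambda>k. energy_on A (F k)) \<longlongrightarrow> energy_on A f) G"
  unfolding energy_on_def by (intro tendsto_intros assms) simp

lemma energy_eq_SUP:
  assumes A: "incseq A" "\<And>n. finite (A n)" and exhausts: "\<And>x y. c x y \<noteq> 0 \<Longrightarrow> \<exists>n. x \<in> A n"
  shows "energy f = (SUP n. ennreal (energy_on (A n) f))"
proof -
  let ?q = "\<lambda>p. c (fst p) (snd p) * (f (fst p) - f (snd p))\<^sup>2"
  let ?g = "\<lambda>n p. ennreal (?q p) * indicator (A n \<times> A n) p"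
  have A_le: "A m \<subseteq> A n" if "m \<le> n" for m n using A(1) that by (rule monoD)
  have inc: "incseq ?g"
    using A_le by (intro incseq_SucI le_funI) (auto simp: indicator_def, (meson le_SucI order_refl subsetD)+)
  have SUP_g: "(SUP n. ?g n p) = ennreal (?q p)" for p
  proof (cases "c (fst p) (snd p) = 0")
    case False
    then obtain m n where "fst p \<in> A m" "snd p \<in> A n"
      using exhausts c_sym by metis
    then have "p \<in> A (max m n) \<times> A (max m n)"
      using A_le[of m "max m n"] A_le[of n "max m n"] by (auto simp: mem_Times_iff)
    then show ?thesis
      by (intro antisym SUP_least SUP_upper2[of "max m n"]) (auto simp: indicator_def)
  qed simp
  have integral_g: "(\<integral>\<^sup>+p. ?g n p \<partial>count_space UNIV) = ennreal (2 * energy_on (A n) f)" for n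
  proof -
    have "(\<integral>\<^sup>+p. ?g n p \<partial>count_space UNIV) = (\<integral>\<^sup>+p. ennreal (?q p) \<partial>count_space (A n \<times> A n))"
      by (rule nn_integral_count_space_indicator[symmetric]) simp
    also have "\<dots> = (\<Sum>p\<in>A n \<times> A n. ennreal (?q p))"
      using A(2) by (intro nn_integral_count_space_finite) simp
    also have "\<dots> = ennreal (2 * energy_on (A n) f)"
      using c_nonneg by (subst sum_ennreal) (auto simp: energy_on_eq_sum_pairs)
    finally show ?thesis .
  qed
  have "energy f = (\<integral>\<^sup>+p. (SUP n. ?g n p) \<partial>count_space UNIV) / 2"
    unfolding SUP_g energy_def ..
  also have "\<dots> = (SUP n. ennreal (2 * energy_on (A n) f)) / 2"
    unfolding integral_g[symmetric] by (subst nn_integral_monotone_convergence_SUP[OF inc]) simp_all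
  also have "\<dots> = (SUP n. ennreal (2 * energy_on (A n) f) / 2)" by (rule SUP_divide_ennreal)
  also have "\<dots> = (SUP n. ennreal (energy_on (A n) f))"
    using divide_ennreal[of "2 * energy_on (A _) f" 2] energy_on_nonneg by simp
  finally show ?thesis .
qed

definition "separates E F f \<longleftrightarrow> (\<forall>x\<in>E. f x = 1) \<and> (\<forall>x\<in>F. f x = (0::real))"

text \<open>The effective conductance between \<open>E\<close> and \<open>F\<close> in the network \<open>A\<close>.\<close>

definition "capacity A E F = (INF f\<in>{f. separates E F f}. energy_on A f)"

lemma separates_exists: "E \<inter> F = {} \<Longrightarrow> \<exists>f. separates E F f"
  by (intro exI[of _ "indicator E"]) (auto simp: separates_def indicator_def)

lemma capacity_le: "separates E F f \<Longrightarrow> capacity A E F \<le> energy_on A f"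
  unfolding capacity_def by (rule cINF_lower) (auto intro!: bdd_belowI[of _ 0] energy_on_nonneg)

lemma capacity_nonneg: "E \<inter> F = {} \<Longrightarrow> 0 \<le> capacity A E F"
  unfolding capacity_def using separates_exists
  by (intro cINF_greatest) (auto intro: energy_on_nonneg)

lemma capacity_empty: "E = {} \<or> F = {} \<Longrightarrow> capacity A E F = 0"
proof -
  assume "E = {} \<or> F = {}"
  then have "separates E F (\<lambda>_. 0) \<or> separates E F (\<lambda>_. 1)" by (auto simp: separates_def)
  then have "capacity A E F \<le> 0" using capacity_le energy_on_const by metis
  then show ?thesis using capacity_nonneg[of E F A] \<open>E = {} \<or> F = {}\<close> by auto
qed

definition clamp01 :: "real \<Rightarrow> real" where
  "clamp01 t = max 0 (min 1 t)"

lemma clamp01_lipschitz: "\<bar>clamp01 s - clamp01 t\<bar> \<le> \<bar>s - t\<bar>"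
  by (auto simp: clamp01_def max_def min_def)

lemma capacity_le_of_approximate:
  assumes d: "0 \<le> d" "d < 1 / 2" and E: "\<And>x. x \<in> E \<Longrightarrow> 1 - d \<le> g x" and F: "\<And>x. x \<in> F \<Longrightarrow> g x \<le> d"
  shows "capacity A E F \<le> (1 / (1 - 2 * d))\<^sup>2 * energy_on A g"
proof -
  let ?s = "\<lambda>x. 1 / (1 - 2 * d) * (g x - d)"
  have "separates E F (\<lambda>x. clamp01 (?s x))"
    unfolding separates_def
  proof (intro conjI ballI)
    fix x assume "x \<in> E"
    then have "1 \<le> ?s x" using E d by (simp add: field_simps)
    then show "clamp01 (?s x) = 1" by (simp add: clamp01_def)
  next
    fix x assume "x \<in> F"
    then have "?s x \<le> 0" using F d by (intro mult_nonneg_nonpos) auto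
    then show "clamp01 (?s x) = 0" by (simp add: clamp01_def)
  qed
  then have "capacity A E F \<le> energy_on A (\<lambda>x. clamp01 (?s x))" by (rule capacity_le)
  also have "\<dots> \<le> (1 / (1 - 2 * d))\<^sup>2 * energy_on A g"
  proof (rule energy_on_lipschitz)
    fix x y
    have "\<bar>clamp01 (?s x) - clamp01 (?s y)\<bar> \<le> \<bar>?s x - ?s y\<bar>" by (rule clamp01_lipschitz)
    also have "?s x - ?s y = 1 / (1 - 2 * d) * (g x - g y)" by (simp add: algebra_simps diff_divide_distrib)
    finally show "\<bar>clamp01 (?s x) - clamp01 (?s y)\<bar> \<le> 1 / (1 - 2 * d) * \<bar>g x - g y\<bar>"
      using d by (simp add: abs_mult)
  qed
  finally show ?thesis .
qed

lemma capacity_near_minimizer: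
  assumes "E \<inter> F = {}" "e > 0"
  shows "\<exists>f. separates E F f \<and> energy_on A f < capacity A E F + e \<and> (\<forall>x. 0 \<le> f x \<and> f x \<le> 1)"
proof -
  have "\<exists>f\<in>{f. separates E F f}. energy_on A f < capacity A E F + e"
  proof (subst cINF_less_iff[symmetric])
    show "{f. separates E F f} \<noteq> {}" using separates_exists[OF assms(1)] by simp
    show "bdd_below (energy_on A ` {f. separates E F f})"
      by (auto intro!: bdd_belowI[of _ 0] energy_on_nonneg)
    show "(INF f\<in>{f. separates E F f}. energy_on A f) < capacity A E F + e"
      using assms(2) unfolding capacity_def by simp
  qed
  then obtain f where f: "separates E F f" "energy_on A f < capacity A E F + e" by auto
  have "energy_on A (\<lambda>x. clamp01 (f x)) \<le> 1\<^sup>2 * energy_on A f"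
    using clamp01_lipschitz by (intro energy_on_lipschitz) auto
  moreover have "separates E F (\<lambda>x. clamp01 (f x))" using f(1) by (auto simp: separates_def clamp01_def)
  ultimately show ?thesis
    using f(2) by (intro exI[of _ "\<lambda>x. clamp01 (f x)"]) (auto simp: clamp01_def)
qed

end

section \<open>The natural random walk on the augmented tree\<close>

locale natural_random_walk = self_similar_set N S \<rho> K
  for N :: nat and S :: "nat \<Rightarrow> 'a::euclidean_space \<Rightarrow> 'a" and \<rho> :: "nat \<Rightarrow> real" and K :: "'a set" +
  fixes \<gamma> lam :: real
  assumes gamma_pos: "0 < \<gamma>" and lam_pos: "0 < lam" and lam_less: "lam < rmin N \<rho> powr hausdorff_dim K"
begin

abbreviation "c \<equiv> cond N S \<rho> K \<gamma> lam"

abbreviation "depth \<equiv> lev N \<rho>"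

definition "r\<^sub>\<alpha> = r powr \<alpha>"

definition "X = (\<Union>n. \<J> n)"

definition "parent x = (THE y. y \<in> \<J> (depth x - 1) \<and> prefix y x)"

definition "children x = descendants (Suc (depth x)) x"

definition "horizontal x = {y \<in> \<J> (depth x). y \<noteq> x \<and> gap S K x y \<le> \<gamma> * r ^ depth x}"

lemma r_alpha_bounds: "0 < r\<^sub>\<alpha>" "r\<^sub>\<alpha> < 1"
  using r_bounds hausdorff_dim_pos by (simp_all add: r\<^sub>\<alpha>_def powr01_less_one)

lemma lam_bounds: "lam < r\<^sub>\<alpha>" "lam < 1"
  using lam_less r_alpha_bounds(2) by (simp_all add: r\<^sub>\<alpha>_def)

lemma one_less_inverse_lam: "1 < 1 / lam"
  using lam_pos lam_bounds by simp

lemma r_alpha_power: "r powr (\<alpha> * real n) = r\<^sub>\<alpha> ^ n" "(r ^ n) powr \<alpha> = r\<^sub>\<alpha> ^ n"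
  using r_bounds
  by (simp_all add: r\<^sub>\<alpha>_def powr_realpow[symmetric] powr_powr mult.commute del: powr_realpow)

lemma lam_powr_uminus: "lam powr (- real n) = (1 / lam) ^ n"
  using lam_pos by (simp add: powr_minus powr_realpow divide_inverse power_inverse)

lemma X_J: "x \<in> X \<Longrightarrow> x \<in> \<J> (depth x)"
  using lev_eq by (auto simp: X_def)

lemma J_X: "x \<in> \<J> n \<Longrightarrow> x \<in> X"
  by (auto simp: X_def)

lemma Nil_X: "[] \<in> X"
  using J_X[OF Nil_J_0] .

lemma depth_Nil [simp]: "depth [] = 0"
  by (rule lev_eq[OF Nil_J_0])

lemma depth_eq_0_iff: "x \<in> X \<Longrightarrow> depth x = 0 \<longleftrightarrow> x = []"
  using X_J[of x] by (auto simp: J.simps)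

lemma weight_le: "x \<in> \<J> n \<Longrightarrow> weight x \<le> r\<^sub>\<alpha> ^ n"
  unfolding weight_def r_alpha_power(2)[symmetric]
  using rw_J_le rw_pos[OF J_words] hausdorff_dim_pos by (intro powr_mono2) (auto intro: less_imp_le)

lemma weight_ge: "x \<in> \<J> n \<Longrightarrow> r\<^sub>\<alpha> ^ Suc n \<le> weight x"
  unfolding weight_def r_alpha_power(2)[symmetric]
  using rw_J_gt r_bounds hausdorff_dim_pos by (intro powr_mono2) (auto intro: less_imp_le)

lemma parent:
  assumes x: "x \<in> \<J> (Suc n)"
  shows parent_J: "parent x \<in> \<J> n" and prefix_parent: "prefix (parent x) x"
proof -
  have "rw \<rho> x \<le> r ^ n" using rw_J_le[OF x] r_power_le[of n "Suc n"] by simp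
  then have "\<exists>!y. y \<in> \<J> n \<and> prefix y x"
    using J_prefix_exists[OF J_words[OF x]] J_prefix_unique by blast
  then have "parent x \<in> \<J> n \<and> prefix (parent x) x"
    unfolding parent_def lev_eq[OF x] using theI'[of "\<lambda>y. y \<in> \<J> n \<and> prefix y x"] by simp
  then show "parent x \<in> \<J> n" "prefix (parent x) x" by simp_all
qed

lemma parent_eq: "x \<in> \<J> (Suc n) \<Longrightarrow> y \<in> \<J> n \<Longrightarrow> prefix y x \<Longrightarrow> parent x = y"
  using parent J_prefix_unique by blast

lemma children_iff: "x \<in> \<J> n \<Longrightarrow> z \<in> children x \<longleftrightarrow> z \<in> \<J> (Suc n) \<and> parent z = x"
  using parent parent_eq by (auto simp: children_def descendants_def lev_eq)

lemma horizontal_iff: "x \<in> \<J> n \<Longrightarrow> y \<in> horizontal x \<longleftrightarrow> y \<in> \<J> n \<and> y \<noteq> x \<and> gap S K x y \<le> \<gamma> * r ^ n"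
  by (simp add: horizontal_def lev_eq)

lemma gap_sym: "gap S K x y = gap S K y x"
  unfolding gap_def by (rule arg_cong[of _ _ Inf]) (auto, (metis dist_commute)+)

lemma horizontal_sym: "x \<in> \<J> n \<Longrightarrow> y \<in> horizontal x \<Longrightarrow> x \<in> horizontal y"
  using horizontal_iff[of x n] horizontal_iff[of y n] gap_sym by auto

lemma finite_children: "finite (children x)"
  by (simp add: children_def finite_descendants)

lemma finite_horizontal: "finite (horizontal x)"
  using finite_J by (simp add: horizontal_def)

lemma sum_weight_children: "x \<in> \<J> n \<Longrightarrow> (\<Sum>z\<in>children x. weight z) = weight x"
  using sum_weight_descendants[OF above_J[of x n "Suc n"]] by (simp add: children_def lev_eq)

lemma children_nonempty: "x \<in> \<J> n \<Longrightarrow> children x \<noteq> {}"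
  using sum_weight_children[of x n] weight_pos[of x n] by auto

lemma sum_J_Suc: "(\<Sum>z\<in>\<J> (Suc n). F z) = (\<Sum>x\<in>\<J> n. \<Sum>z\<in>children x. F z)"
proof -
  have "(\<Sum>x\<in>\<J> n. \<Sum>z\<in>children x. F z) = (\<Sum>x\<in>\<J> n. \<Sum>z\<in>{z\<in>\<J> (Suc n). parent z = x}. F z)"
    by (intro sum.cong) (auto simp: children_iff)
  also have "\<dots> = (\<Sum>z\<in>\<J> (Suc n). F z)"
    by (rule sum.group[OF finite_J finite_J]) (use parent_J in blast)
  finally show ?thesis ..
qed

lemma gap_le:
  assumes "\<xi> \<in> cell x" "\<eta> \<in> cell y"
  shows "gap S K x y \<le> dist \<xi> \<eta>"
  unfolding gap_def
proof (rule cInf_lower)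
  obtain u v where "\<xi> = Sw S x u" "u \<in> K" "\<eta> = Sw S y v" "v \<in> K" using assms by (elim imageE)
  then show "dist \<xi> \<eta> \<in> {dist (Sw S x \<xi>) (Sw S y \<eta>) | \<xi> \<eta>. \<xi> \<in> K \<and> \<eta> \<in> K}" by blast
qed (auto intro!: bdd_belowI[of _ 0])

lemma c_child:
  assumes "x \<in> \<J> n" "z \<in> children x"
  shows "c x z = weight z * (1 / lam) ^ Suc n" "c z x = weight z * (1 / lam) ^ Suc n"
proof -
  have z: "z \<in> \<J> (Suc n)" "parent z = x" using children_iff[OF assms(1)] assms(2) by auto
  have down: "\<exists>m. z \<in> \<J> (Suc m) \<and> x \<in> \<J> m \<and> prefix x z"
    using z assms(1) prefix_parent by blast
  have not_up: "\<not> (\<exists>m. x \<in> \<J> (Suc m) \<and> z \<in> \<J> m \<and> prefix z x)"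
    using J_level_unique[OF assms(1)] J_level_unique[OF z(1)] by fastforce
  show "c x z = weight z * (1 / lam) ^ Suc n"
    unfolding cond_def Let_def if_not_P[OF not_up] if_P[OF down] lev_eq[OF z(1)] lam_powr_uminus weight_def ..
  show "c z x = weight z * (1 / lam) ^ Suc n"
    unfolding cond_def Let_def if_P[OF down] lev_eq[OF z(1)] lam_powr_uminus weight_def ..
qed

lemma c_parent:
  assumes "x \<in> \<J> (Suc n)"
  shows "c x (parent x) = weight x * (1 / lam) ^ Suc n"
  using c_child(2)[of "parent x" n x] parent_J[OF assms] children_iff[of "parent x" n x] assms by simp

lemma c_horizontal:
  assumes "x \<in> \<J> n" "y \<in> horizontal x"
  shows "c x y = r\<^sub>\<alpha> ^ n * (1 / lam) ^ n"
proof -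
  have y: "y \<in> \<J> n" "y \<noteq> x" "gap S K x y \<le> \<gamma> * r ^ n"
    using horizontal_iff[OF assms(1)] assms(2) by auto
  have not_vertical: "\<not> (\<exists>m. x \<in> \<J> (Suc m) \<and> y \<in> \<J> m \<and> prefix y x)"
      "\<not> (\<exists>m. y \<in> \<J> (Suc m) \<and> x \<in> \<J> m \<and> prefix x y)"
    using J_level_unique[OF assms(1)] J_level_unique[OF y(1)] by (metis n_not_Suc_n)+
  have edge: "\<exists>m. x \<in> \<J> m \<and> y \<in> \<J> m \<and> x \<noteq> y \<and> gap S K x y \<le> \<gamma> * r ^ m"
    using assms(1) y by blast
  show ?thesis
    unfolding cond_def Let_def if_not_P[OF not_vertical(1)] if_not_P[OF not_vertical(2)] if_P[OF edge]
      lev_eq[OF assms(1)] lam_powr_uminus r_alpha_power(1) ..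
qed

lemma edge_cases [consumes 1, case_names parent child horizontal]:
  assumes "c x y \<noteq> 0"
  obtains n where "x \<in> \<J> (Suc n)" "y = parent x"
    | n where "x \<in> \<J> n" "y \<in> children x"
    | n where "x \<in> \<J> n" "y \<in> horizontal x"
proof -
  have "(\<exists>n. x \<in> \<J> (Suc n) \<and> y \<in> \<J> n \<and> prefix y x) \<or> (\<exists>n. y \<in> \<J> (Suc n) \<and> x \<in> \<J> n \<and> prefix x y)
     \<or> (\<exists>n. x \<in> \<J> n \<and> y \<in> \<J> n \<and> x \<noteq> y \<and> gap S K x y \<le> \<gamma> * r ^ n)"
    using assms unfolding cond_def Let_def by argo
  then consider n where "x \<in> \<J> (Suc n)" "y \<in> \<J> n" "prefix y x"
    | n where "y \<in> \<J> (Suc n)" "x \<in> \<J> n" "prefix x y"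
    | n where "x \<in> \<J> n" "y \<in> \<J> n" "x \<noteq> y" "gap S K x y \<le> \<gamma> * r ^ n"
    by (elim disjE exE conjE)
  then show thesis
  proof cases
    case 1
    then show thesis using that(1) parent_eq by blast
  next
    case 2
    then show thesis using that(2) parent_eq[of y _ x] children_iff[of x _ y] by blast
  next
    case 3
    then show thesis using that(3) horizontal_iff[of x _ y] by blast
  qed
qed

lemma c_edge_pos:
  "x \<in> \<J> (Suc n) \<Longrightarrow> c x (parent x) > 0"
  "x \<in> \<J> n \<Longrightarrow> z \<in> children x \<Longrightarrow> c x z > 0"
  "x \<in> \<J> n \<Longrightarrow> y \<in> horizontal x \<Longrightarrow> c x y > 0"
  using c_parent c_child c_horizontal weight_pos lam_pos r_alpha_bounds children_iff
  by (auto simp del: power_Suc)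

lemma c_eq_0_outside: "x \<notin> X \<Longrightarrow> c x y = 0"
  by (rule ccontr, erule edge_cases) (auto simp: J_X)

lemma c_swap_of_nonzero:
  assumes "c x y \<noteq> 0"
  shows "c x y = c y x"
  using assms
proof (cases rule: edge_cases)
  case (parent n)
  then have "y \<in> \<J> n" "x \<in> children y" using parent_J[of x n] children_iff[of y n x] by auto
  then show ?thesis using c_child by simp
next
  case (child n)
  then show ?thesis using c_child by simp
next
  case (horizontal n)
  then show ?thesis
    using c_horizontal[of x n y] c_horizontal[of y n x] horizontal_sym[of x n y] horizontal_iff[of x n y]
    by simp
qed

sublocale weighted_graph c
proof
  fix x y
  show "0 \<le> c x y"
  proof (cases "c x y = 0")
    case False
    then show ?thesis by (cases rule: edge_cases) (use c_edge_pos in \<open>auto intro: less_imp_le\<close>)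
  qed simp
  show "c x y = c y x" using c_swap_of_nonzero[of x y] c_swap_of_nonzero[of y x] by metis
  have "{y. c x y \<noteq> 0} \<subseteq> insert (parent x) (children x \<union> horizontal x)"
    by (auto elim: edge_cases)
  then show "finite {y. c x y \<noteq> 0}"
    using finite_children finite_horizontal by (meson finite_UnI finite_insert finite_subset)
qed

lemma neighbours_eq:
  assumes x: "x \<in> \<J> n"
  shows "neighbours x = (if n = 0 then {} else {parent x}) \<union> children x \<union> horizontal x"
proof (intro equalityI subsetI)
  fix y assume "y \<in> neighbours x"
  then have "c x y \<noteq> 0" by (simp add: neighbours_def)
  then show "y \<in> (if n = 0 then {} else {parent x}) \<union> children x \<union> horizontal x"
    by (cases rule: edge_cases) (use J_level_unique[OF x] in auto)
next
  fix y assume "y \<in> (if n = 0 then {} else {parent x}) \<union> children x \<union> horizontal x"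
  then have "0 < c x y"
    using c_edge_pos x by (cases n) auto
  then show "y \<in> neighbours x" by (simp add: neighbours_def)
qed

lemma neighbours_X: "y \<in> neighbours x \<Longrightarrow> y \<in> X"
  using c_eq_0_outside[of y x] c_sym[of x y] by (auto simp: neighbours_def)

lemma neighbours_outside: "x \<notin> X \<Longrightarrow> neighbours x = {}"
  using c_eq_0_outside by (simp add: neighbours_def)

lemma neighbour_cases [consumes 2, case_names parent child horizontal]:
  assumes "x \<in> \<J> n" "y \<in> neighbours x"
  obtains m where "n = Suc m" "y = parent x" "y \<in> \<J> m"
    | "y \<in> children x" "y \<in> \<J> (Suc n)" "parent y = x"
    | "y \<in> horizontal x" "y \<in> \<J> n"
  using assms neighbours_eq[OF assms(1)] parent_J children_iff[OF assms(1)] horizontal_iff[OF assms(1)]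
  by (cases n) auto

lemma sum_neighbours:
  fixes F :: "nat list \<Rightarrow> real"
  assumes x: "x \<in> \<J> n"
  shows "(\<Sum>z\<in>neighbours x. F z)
    = (if n = 0 then 0 else F (parent x)) + (\<Sum>z\<in>children x. F z) + (\<Sum>y\<in>horizontal x. F y)"
proof -
  define P where "P = (if n = 0 then {} else {parent x})"
  have depth: "z \<in> P \<Longrightarrow> Suc (depth z) = n" "z \<in> children x \<Longrightarrow> depth z = Suc n"
      "z \<in> horizontal x \<Longrightarrow> depth z = n" for z
    using x parent_J children_iff[OF x] horizontal_iff[OF x] lev_eq by (cases n; force simp: P_def)+
  have "z \<in> P \<Longrightarrow> z \<notin> children x \<union> horizontal x" "z \<in> children x \<Longrightarrow> z \<notin> horizontal x" for z
    using depth[of z] by auto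
  then have "P \<inter> children x = {}" "(P \<union> children x) \<inter> horizontal x = {}" by blast+
  moreover have "finite P" by (simp add: P_def)
  ultimately have "(\<Sum>z\<in>neighbours x. F z) = (\<Sum>z\<in>P. F z) + (\<Sum>z\<in>children x. F z) + (\<Sum>z\<in>horizontal x. F z)"
    unfolding neighbours_eq[OF x] P_def[symmetric] using finite_children finite_horizontal
    by (simp add: sum.union_disjoint)
  then show ?thesis by (simp add: P_def)
qed

definition "base_point y = Sw S y (SOME p. p \<in> K)"

lemma base_point_cell: "base_point y \<in> cell y"
  using K_nonempty by (auto simp: base_point_def some_in_eq)

lemma dist_base_point: "y \<in> \<J> n \<Longrightarrow> \<xi> \<in> cell y \<Longrightarrow> dist (base_point y) \<xi> \<le> diameter K * r ^ n"
  using dist_cell_J[OF _ base_point_cell] .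

lemma dist_base_point_parent:
  assumes "x \<in> \<J> (Suc n)"
  shows "dist (base_point (parent x)) (base_point x) \<le> diameter K * r ^ n"
proof (rule dist_base_point[OF parent_J[OF assms]])
  show "base_point x \<in> cell (parent x)"
    using cell_prefix_subset[OF J_words[OF assms] prefix_parent[OF assms]] base_point_cell by blast
qed

lemma horizontal_close:
  assumes "x \<in> \<J> n" "y \<in> horizontal x"
  shows "\<exists>\<xi>\<in>cell x. \<exists>\<eta>\<in>cell y. dist \<xi> \<eta> < 2 * \<gamma> * r ^ n"
proof -
  let ?A = "{dist (Sw S x \<xi>) (Sw S y \<eta>) | \<xi> \<eta>. \<xi> \<in> K \<and> \<eta> \<in> K}"
  have "Inf ?A \<le> \<gamma> * r ^ n" using horizontal_iff[OF assms(1)] assms(2) by (simp add: gap_def)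
  also have "\<dots> < 2 * \<gamma> * r ^ n" using gamma_pos r_bounds by simp
  finally have "\<exists>t\<in>?A. t < 2 * \<gamma> * r ^ n" using K_nonempty by (intro cInf_lessD) auto
  then show ?thesis by auto
qed

definition "edge_reach = 2 * \<gamma> + 2 * diameter K"

lemma edge_reach: "edge_reach > 0" "diameter K \<le> edge_reach"
  using gamma_pos diameter_K_nonneg by (auto simp: edge_reach_def)

lemma dist_base_point_horizontal:
  assumes "x \<in> \<J> n" "y \<in> horizontal x"
  shows "dist (base_point y) (base_point x) \<le> edge_reach * r ^ n"
proof -
  obtain \<xi> \<eta> where close: "\<xi> \<in> cell x" "\<eta> \<in> cell y" "dist \<xi> \<eta> < 2 * \<gamma> * r ^ n"
    using horizontal_close[OF assms] by blast
  have "y \<in> \<J> n" using assms horizontal_iff by blast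
  then have "dist (base_point y) \<eta> \<le> diameter K * r ^ n" using close(2) by (rule dist_base_point)
  moreover have "dist (base_point x) \<xi> \<le> diameter K * r ^ n"
    using assms(1) close(1) by (rule dist_base_point)
  moreover have "dist (base_point y) (base_point x)
      \<le> dist (base_point y) \<eta> + dist \<xi> \<eta> + dist (base_point x) \<xi>" by metric
  ultimately show ?thesis using close(3) by (simp add: edge_reach_def algebra_simps)
qed

lemma neighbours_close:
  assumes y: "y \<in> \<J> (Suc n)" and z: "z \<in> neighbours y"
  shows "\<exists>k\<ge>n. z \<in> \<J> k \<and> dist (base_point z) (base_point y) \<le> edge_reach * r ^ n"
  using y z
proof (cases rule: neighbour_cases)
  case (parent m)
  have "diameter K * r ^ n \<le> edge_reach * r ^ n"
    using edge_reach r_bounds by (intro mult_right_mono) auto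
  then show ?thesis using dist_base_point_parent[OF y] parent by auto
next
  case child
  have "diameter K * r ^ Suc n \<le> edge_reach * r ^ n"
    using edge_reach diameter_K_nonneg r_bounds r_power_le[of n "Suc n"] by (intro mult_mono) auto
  then show ?thesis
    using dist_base_point_parent[OF child(2)] child by (intro exI[of _ "Suc (Suc n)"]) (simp add: dist_commute)
next
  case horizontal
  have "edge_reach * r ^ Suc n \<le> edge_reach * r ^ n"
    using edge_reach r_power_le[of n "Suc n"] by (intro mult_left_mono) auto
  then show ?thesis
    using order_trans[OF dist_base_point_horizontal[OF y horizontal(1)]] horizontal(2)
    by (intro exI[of _ "Suc n"]) auto
qed

lemma card_horizontal_bounded: "\<exists>M>0. \<forall>n x. x \<in> \<J> n \<longrightarrow> real (card (horizontal x)) \<le> M"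
proof -
  obtain M :: real where M: "M > 0" "\<And>n p. real (card (cells_near edge_reach n p)) \<le> M"
    using card_cells_near_bounded[of edge_reach] edge_reach by auto
  have "real (card (horizontal x)) \<le> M" if x: "x \<in> \<J> n" for n x
  proof -
    have "horizontal x \<subseteq> cells_near edge_reach n (base_point x)"
      using horizontal_iff[OF x] base_point_cell dist_base_point_horizontal[OF x]
      unfolding cells_near_def by blast
    then have "card (horizontal x) \<le> card (cells_near edge_reach n (base_point x))"
      using finite_J by (intro card_mono) (auto simp: cells_near_def)
    then show ?thesis using M(2)[of n "base_point x"] by linarith
  qed
  then show ?thesis using M(1) by blast
qed

definition "horizontal_degree = (SOME M. M > 0 \<and> (\<forall>n x. x \<in> \<J> n \<longrightarrow> real (card (horizontal x)) \<le> M))"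

lemma horizontal_degree_pos: "horizontal_degree > 0"
  and card_horizontal_le: "x \<in> \<J> n \<Longrightarrow> real (card (horizontal x)) \<le> horizontal_degree"
  using someI_ex[OF card_horizontal_bounded] unfolding horizontal_degree_def by blast+

lemma root_induct [consumes 1, case_names root parent]:
  assumes "x \<in> X" "P []" "\<And>n x. x \<in> \<J> (Suc n) \<Longrightarrow> P (parent x) \<Longrightarrow> P x"
  shows "P x"
proof -
  have "x \<in> \<J> n \<Longrightarrow> P x" for n x
  proof (induction n arbitrary: x)
    case 0
    then show ?case using assms(2) by (simp add: J.simps)
  next
    case (Suc n)
    then show ?case using assms(3) parent_J by blast
  qed
  then show ?thesis using assms(1) X_J by blast
qed

lemma finite_X_of_eventually:
  assumes "\<forall>\<^sub>F n in sequentially. \<forall>y\<in>\<J> n. \<not> P y"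
  shows "finite {y\<in>X. P y}"
proof -
  obtain m where m: "\<forall>n\<ge>m. \<forall>y\<in>\<J> n. \<not> P y" using assms by (auto simp: eventually_sequentially)
  have "{y\<in>X. P y} \<subseteq> (\<Union>n<m. \<J> n)"
  proof
    fix y assume y: "y \<in> {y\<in>X. P y}"
    then have "y \<in> \<J> (depth y)" by (simp add: X_J)
    moreover have "\<not> m \<le> depth y" using m y calculation by blast
    ultimately show "y \<in> (\<Union>n<m. \<J> n)" by (auto simp: not_le)
  qed
  then show ?thesis using finite_J finite_subset by blast
qed

text \<open>With \<open>(up, down) = (1, 1 / lam)\<close> this is the kernel of the walk, up to a factor on each level; with
  \<open>(1 / lam, 1)\<close> it is the kernel of its Doob transform by \<open>lam ^ depth\<close>, the walk reversed towards the root.\<close>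

definition step_weight :: "real \<Rightarrow> real \<Rightarrow> nat list \<Rightarrow> nat list \<Rightarrow> real" where
  "step_weight up down x y =
     (if depth y < depth x then up * weight x
      else if depth x < depth y then down * weight y
      else r\<^sub>\<alpha> ^ depth x)"

abbreviation "scaled_laplacian up down \<equiv> diff_operator (step_weight up down)"

lemma step_weight_nonneg: "0 \<le> up \<Longrightarrow> 0 \<le> down \<Longrightarrow> 0 \<le> step_weight up down x y"
  using r_alpha_bounds by (simp add: step_weight_def)

lemma c_eq_step_weight:
  assumes "x \<in> \<J> n" "y \<in> neighbours x"
  shows "c x y = (1 / lam) ^ n * step_weight 1 (1 / lam) x y"
    and "c x y * lam ^ depth y = step_weight (1 / lam) 1 x y"
proof -
  have "c x y = (1 / lam) ^ n * step_weight 1 (1 / lam) x y \<and> c x y * lam ^ depth y = step_weight (1 / lam) 1 x y"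
    using assms
  proof (cases rule: neighbour_cases)
    case (parent m)
    then have x: "x \<in> \<J> (Suc m)" using assms(1) by simp
    show ?thesis
      using c_parent[OF x] parent lev_eq[OF x] lev_eq[OF parent(3)] lam_pos
      by (simp add: step_weight_def power_divide)
  next
    case child
    then show ?thesis
      using c_child[OF assms(1)] lev_eq[OF assms(1)] lev_eq[OF child(2)] lam_pos
      by (simp add: step_weight_def power_divide)
  next
    case horizontal
    then show ?thesis
      using c_horizontal[OF assms(1)] lev_eq[OF assms(1)] lev_eq[OF horizontal(2)] lam_pos
      by (simp add: step_weight_def power_divide)
  qed
  then show "c x y = (1 / lam) ^ n * step_weight 1 (1 / lam) x y"
    "c x y * lam ^ depth y = step_weight (1 / lam) 1 x y" by blast+
qed

lemma step_weight_edge: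
  assumes x: "x \<in> \<J> n"
  shows "n \<noteq> 0 \<Longrightarrow> step_weight up down x (parent x) = up * weight x"
    and "z \<in> children x \<Longrightarrow> step_weight up down x z = down * weight z"
    and "y \<in> horizontal x \<Longrightarrow> step_weight up down x y = r\<^sub>\<alpha> ^ n"
proof -
  have "depth (parent x) < depth x" if "n \<noteq> 0"
    using that lev_eq[OF x] x parent_J[of x "n - 1"] lev_eq[of "parent x" "n - 1"] by simp
  moreover have "depth x < depth z" if "z \<in> children x"
    using that lev_eq[OF x] children_iff[OF x, of z] lev_eq[of z "Suc n"] by simp
  moreover have "depth y = depth x" if "y \<in> horizontal x"
    using that lev_eq[OF x] horizontal_iff[OF x, of y] lev_eq[of y n] by simp
  ultimately show "n \<noteq> 0 \<Longrightarrow> step_weight up down x (parent x) = up * weight x"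
    and "z \<in> children x \<Longrightarrow> step_weight up down x z = down * weight z"
    and "y \<in> horizontal x \<Longrightarrow> step_weight up down x y = r\<^sub>\<alpha> ^ n"
    using lev_eq[OF x] by (simp_all add: step_weight_def)
qed

lemma scaled_laplacian_eq:
  assumes x: "x \<in> \<J> n"
  shows "scaled_laplacian up down f x = (if n = 0 then 0 else up * weight x * (f (parent x) - f x))
    + down * (\<Sum>z\<in>children x. weight z * (f z - f x)) + r\<^sub>\<alpha> ^ n * (\<Sum>y\<in>horizontal x. f y - f x)"
  unfolding diff_operator_def sum_neighbours[OF x] using step_weight_edge[OF x]
  by (simp add: sum_distrib_left mult.assoc)

lemma sum_step_weight_le:
  assumes x: "x \<in> \<J> n" and "0 \<le> up" "0 \<le> down"
  shows "(\<Sum>y\<in>neighbours x. step_weight up down x y) \<le> r\<^sub>\<alpha> ^ n * (up + down + horizontal_degree)"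
proof -
  have "(\<Sum>y\<in>neighbours x. step_weight up down x y)
      = (if n = 0 then 0 else up * weight x) + down * weight x + r\<^sub>\<alpha> ^ n * card (horizontal x)"
    unfolding sum_neighbours[OF x] using step_weight_edge[OF x] sum_weight_children[OF x]
    by (simp flip: sum_distrib_left)
  also have "\<dots> \<le> up * r\<^sub>\<alpha> ^ n + down * r\<^sub>\<alpha> ^ n + r\<^sub>\<alpha> ^ n * horizontal_degree"
    using assms weight_le[OF x] card_horizontal_le[OF x] r_alpha_bounds
    by (intro add_mono mult_left_mono) (auto intro: mult_left_mono)
  finally show ?thesis by (simp add: algebra_simps)
qed

lemma laplacian_eq_scaled: "x \<in> \<J> n \<Longrightarrow> laplacian f x = (1 / lam) ^ n * scaled_laplacian 1 (1 / lam) f x"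
  unfolding diff_operator_def sum_distrib_left
  by (intro sum.cong refl) (simp add: c_eq_step_weight(1))

definition drift :: "real \<Rightarrow> real \<Rightarrow> real \<Rightarrow> nat \<Rightarrow> real" where
  "drift up down t n = (if n = 0 then down * (t - 1) else (t - 1) * (down - up / t))"

lemma scaled_laplacian_depth_power:
  assumes x: "x \<in> \<J> n" and "t > 0"
  shows "scaled_laplacian up down (\<lambda>y. t ^ depth y) x = weight x * t ^ n * drift up down t n"
proof -
  have "(\<Sum>z\<in>children x. weight z * (t ^ depth z - t ^ n)) = (\<Sum>z\<in>children x. weight z * (t ^ n * (t - 1)))"
    using children_iff[OF x] by (intro sum.cong refl) (auto simp: lev_eq algebra_simps)
  then have children: "(\<Sum>z\<in>children x. weight z * (t ^ depth z - t ^ n)) = weight x * (t ^ n * (t - 1))"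
    using sum_weight_children[OF x] by (simp flip: sum_distrib_right)
  have horizontal: "(\<Sum>y\<in>horizontal x. t ^ depth y - t ^ n) = 0"
    using horizontal_iff[OF x] lev_eq by (intro sum.neutral) auto
  have parent: "t ^ depth (parent x) - t ^ n = t ^ n * (1 / t - 1)" if "n \<noteq> 0"
  proof -
    obtain m where m: "n = Suc m" using \<open>n \<noteq> 0\<close> not0_implies_Suc by blast
    then have "depth (parent x) = m" using parent_J x lev_eq by blast
    then show ?thesis using m \<open>t > 0\<close> by (simp add: field_simps)
  qed
  show ?thesis
    unfolding scaled_laplacian_eq[OF x] lev_eq[OF x] children horizontal
    using parent \<open>t > 0\<close> by (simp add: drift_def field_simps)
qed

lemma laplacian_lam_depth:
  assumes "x \<in> X"
  shows "laplacian (\<lambda>y. lam ^ depth y) x = (if x = [] then 1 - 1 / lam else 0)"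
  unfolding laplacian_eq_scaled[OF X_J[OF assms]] scaled_laplacian_depth_power[OF X_J[OF assms] lam_pos]
  using depth_eq_0_iff[OF assms] lam_pos by (auto simp: drift_def field_simps)

lemma laplacian_lam_depth_mult:
  assumes x: "x \<in> X" "x \<noteq> []"
  shows "laplacian (\<lambda>y. lam ^ depth y * f y) x = scaled_laplacian (1 / lam) 1 f x"
proof -
  have "diff_operator (\<lambda>x y. c x y * lam ^ depth y) f x = scaled_laplacian (1 / lam) 1 f x"
    unfolding diff_operator_def using c_eq_step_weight(2)[OF X_J[OF x(1)]] by (intro sum.cong) auto
  then show ?thesis using x laplacian_lam_depth by (simp add: doob_transform)
qed

lemma conductance_Nil: "conductance [] = 1 / lam"
proof -
  have "horizontal [] = {}" using horizontal_iff[OF Nil_J_0] by (auto simp: J.simps)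
  then have "conductance [] = (\<Sum>z\<in>children []. c [] z)"
    unfolding conductance_def sum_neighbours[OF Nil_J_0] by simp
  also have "\<dots> = (\<Sum>z\<in>children []. weight z / lam)"
    using c_child(1)[OF Nil_J_0] by (intro sum.cong) auto
  also have "\<dots> = 1 / lam" using sum_weight_children[OF Nil_J_0] by (simp flip: sum_divide_distrib)
  finally show ?thesis .
qed

lemma conductance_pos:
  assumes "x \<in> X"
  shows "conductance x > 0"
proof -
  obtain z where z: "z \<in> children x" using children_nonempty X_J[OF assms] by blast
  show ?thesis using c_le_conductance[of x z] c_edge_pos(2)[OF X_J[OF assms] z] by linarith
qed

end

section \<open>The Green function and Martin ratios\<close>

context natural_random_walk
begin

definition "root_potential x = lam ^ depth x / (1 - lam)"

lemma root_potential_nonneg: "0 \<le> root_potential x"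
  using lam_pos lam_bounds by (simp add: root_potential_def)

lemma laplacian_root_potential:
  assumes "x \<in> X"
  shows "laplacian root_potential x = (if x = [] then - conductance [] else 0)"
proof -
  have "root_potential = (\<lambda>y. 1 / (1 - lam) * lam ^ depth y)" by (auto simp: root_potential_def)
  then have "laplacian root_potential x = 1 / (1 - lam) * (if x = [] then 1 - 1 / lam else 0)"
    by (simp only: diff_operator_scale laplacian_lam_depth[OF assms])
  moreover have "1 / (1 - lam) * (1 - 1 / lam) = - (1 / lam)"
    using lam_pos lam_bounds by (simp add: divide_simps)
  ultimately show ?thesis using conductance_Nil by simp
qed

lemma root_potential_supersolution:
  "(\<Sum>z\<in>neighbours x. transition x z * root_potential z) \<le> root_potential x - step_prob 0 x []"
proof (cases "x \<in> X")
  case True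
  have "conductance x * ((\<Sum>z\<in>neighbours x. transition x z * root_potential z) - root_potential x)
      = conductance x * (if x = [] then - 1 else 0)"
    using laplacian_root_potential[OF True] laplacian_eq_transition[of root_potential x] by simp
  then have "(\<Sum>z\<in>neighbours x. transition x z * root_potential z) - root_potential x = (if x = [] then - 1 else 0)"
    using conductance_pos[OF True] by (simp only: mult_cancel_left) simp
  then show ?thesis by (auto split: if_splits)
next
  case False
  then have "x \<noteq> []" using Nil_X by auto
  then show ?thesis using False by (simp add: neighbours_outside root_potential_nonneg)
qed

lemma step_prob_root_pos: "x \<in> \<J> n \<Longrightarrow> 0 < step_prob n x []"
proof (induction n arbitrary: x)
  case (Suc n)
  have "parent x \<in> neighbours x" using neighbours_eq[OF Suc.prems] by simp
  then show ?case using Suc.IH[OF parent_J[OF Suc.prems]] by (rule step_prob_Suc_pos)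
qed (simp add: J.simps)

lemma green_fn_root_le: "green_fn x [] \<le> root_potential x"
  using supersolution_bounds_green(2)[OF root_potential_nonneg root_potential_supersolution] .

sublocale transient_graph c
proof
  fix x y
  show "summable (\<lambda>n. step_prob n x y)"
  proof (cases "y \<in> X")
    case True
    show ?thesis
      by (rule summable_step_prob_of_reachable(1)[OF supersolution_bounds_green(1)
            step_prob_root_pos[OF X_J[OF True]]])
         (rule root_potential_nonneg root_potential_supersolution)+
  next
    case False
    then have "step_prob n x y = 0" if "n \<notin> {0}" for n
      using that by (cases n) (simp_all add: step_prob_Suc_right neighbours_outside del: step_prob.simps)
    then show ?thesis by (intro summable_finite[of "{0}"]) auto
  qed
qed

lemma drift_walk_neg: "lam < t \<Longrightarrow> t < 1 \<Longrightarrow> drift 1 (1 / lam) t n < 0"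
  using lam_pos by (auto simp: drift_def mult_less_0_iff frac_less2 divide_less_0_iff)

lemma drift_reversed_neg:
  assumes "1 < t" "t < 1 / lam" "n > 0"
  shows "drift (1 / lam) 1 t n < 0"
proof -
  have "lam * t < 1" using assms(2) lam_pos by (simp add: field_simps)
  then have "1 < 1 / lam / t" using assms(1) lam_pos by (simp add: field_simps)
  then show ?thesis using assms(1,3) by (simp add: drift_def mult_pos_neg)
qed

text \<open>The difference \<open>v\<close> is harmonic and of order \<open>lam ^ depth\<close> at infinity.\<close>

theorem green_fn_root:
  assumes "x \<in> X"
  shows "green_fn x [] = root_potential x"
proof -
  define v where "v y = green_fn y [] + (- 1) * root_potential y" for y
  define t where "t = (1 + lam) / 2"
  have t: "lam < t" "t < 1" "0 < t" using lam_pos lam_bounds by (simp_all add: t_def)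
  have "0 \<le> v x"
  proof (rule minimum_principle[where U = X and w = c and s = "\<lambda>y. t ^ depth y"])
    fix y assume y: "y \<in> X"
    show "laplacian v y \<le> 0"
      unfolding v_def diff_operator_linear laplacian_green_fn laplacian_root_potential[OF y] by simp
    have "weight y * t ^ depth y * drift 1 (1 / lam) t (depth y) < 0"
      using weight_pos[OF X_J[OF y]] t drift_walk_neg by (intro mult_pos_neg) auto
    then have "(1 / lam) ^ depth y * (weight y * t ^ depth y * drift 1 (1 / lam) t (depth y)) < 0"
      using lam_pos by (intro mult_pos_neg[OF zero_less_power]) simp_all
    then show "laplacian (\<lambda>y. t ^ depth y) y < 0"
      unfolding laplacian_eq_scaled[OF X_J[OF y]] scaled_laplacian_depth_power[OF X_J[OF y] t(3)] .
  next
    fix e :: real assume e: "e > 0"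
    have "\<forall>\<^sub>F n in sequentially. 1 / (1 - lam) * (lam / t) ^ n < e"
      using lam_pos t e by (intro eventually_mult_power_less) auto
    then have "\<forall>\<^sub>F n in sequentially. \<forall>y\<in>\<J> n. \<not> v y + e * t ^ depth y < 0"
    proof eventually_elim
      case (elim n)
      show ?case
      proof
        fix y assume y: "y \<in> \<J> n"
        have "root_potential y < e * t ^ depth y"
          using elim t lev_eq[OF y] by (simp add: root_potential_def power_divide field_simps)
        then show "\<not> v y + e * t ^ depth y < 0" using green_fn_nonneg[of y "[]"] by (simp add: v_def)
      qed
    qed
    then show "finite {y\<in>X. v y + e * t ^ depth y < 0}" by (rule finite_X_of_eventually)
  qed (use assms c_nonneg neighbours_X in auto)
  then show ?thesis using green_fn_root_le[of x] by (simp add: v_def)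
qed

lemma nbrs_eq: "nbrs N S \<rho> K \<gamma> lam = neighbours"
  by (simp add: fun_eq_iff nbrs_def neighbours_def)

lemma green_eq: "green N S \<rho> K \<gamma> lam = green_fn"
proof -
  have "trans_prob N S \<rho> K \<gamma> lam = transition"
    by (simp add: fun_eq_iff trans_prob_def transition_def conductance_def nbrs_eq)
  then have "Pn N S \<rho> K \<gamma> lam n x y = step_prob n x y" for n x y
    by (induction n arbitrary: x) (simp_all add: nbrs_eq)
  then show ?thesis by (simp add: fun_eq_iff green_def green_fn_def)
qed

definition "martin_ratio x y = green_fn x y / green_fn [] y"

lemma green_fn_eq_martin_ratio:
  assumes "x \<in> X" "y \<in> X"
  shows "green_fn y x = lam ^ depth y * (lam * conductance x / (1 - lam) * martin_ratio x y)"
proof -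
  have "green_fn x y = conductance y * green_fn y x / conductance x"
    using green_fn_reversible[of x y] conductance_pos[OF assms(1)] by (simp add: field_simps)
  moreover have "conductance [] * green_fn [] y = conductance y * root_potential y"
    using green_fn_reversible[of "[]" y] green_fn_root[OF assms(2)] by simp
  then have "green_fn [] y = lam * conductance y * lam ^ depth y / (1 - lam)"
    using lam_pos by (simp add: conductance_Nil root_potential_def field_simps)
  ultimately have ratio: "martin_ratio x y
      = (conductance y * green_fn y x / conductance x) / (lam * conductance y * lam ^ depth y / (1 - lam))"
    unfolding martin_ratio_def by (simp only:)
  show ?thesis
    unfolding ratio using conductance_pos[OF assms(1)] conductance_pos[OF assms(2)] lam_pos lam_bounds
    by (simp add: field_simps)
qed

lemma martin_ratio_nonneg: "0 \<le> martin_ratio x y"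
  by (simp add: martin_ratio_def green_fn_nonneg)

lemma martin_ratio_bounded:
  assumes x: "x \<in> X"
  obtains B where "B > 0" "\<And>y. y \<in> X \<Longrightarrow> martin_ratio x y \<le> B"
proof -
  define p where "p = step_prob (depth x) x []"
  have p: "p > 0" unfolding p_def using step_prob_root_pos[OF X_J[OF x]] .
  have "martin_ratio x y \<le> 1 / (lam * conductance x * p)" if y: "y \<in> X" for y
  proof -
    have "green_fn y x * p \<le> root_potential y"
      using summable_step_prob_of_reachable(2)[OF summable_step_prob, of "depth x" x "[]" y] p
        green_fn_root[OF y] by (simp add: p_def)
    then have "root_potential y * (lam * conductance x * p * martin_ratio x y) \<le> root_potential y * 1"
      unfolding green_fn_eq_martin_ratio[OF x y] root_potential_def by (simp add: mult_ac)
    moreover have "0 < root_potential y" using lam_pos lam_bounds by (simp add: root_potential_def)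
    ultimately have "lam * conductance x * p * martin_ratio x y \<le> 1" by (simp only: mult_le_cancel_left_pos)
    then show ?thesis using p lam_pos conductance_pos[OF x] by (simp add: field_simps)
  qed
  moreover have "1 / (lam * conductance x * p) > 0" using p lam_pos conductance_pos[OF x] by simp
  ultimately show thesis using that by blast
qed

lemma martin_ratio_harmonic:
  assumes x: "x \<in> X" and y: "y \<in> X" "y \<noteq> []" "y \<noteq> x"
  shows "scaled_laplacian (1 / lam) 1 (martin_ratio x) y = 0"
proof -
  define k where "k = lam * conductance x / (1 - lam)"
  have "0 = laplacian (\<lambda>y. green_fn y x) y" using y by (simp add: laplacian_green_fn)
  also have "\<dots> = laplacian (\<lambda>y. lam ^ depth y * (k * martin_ratio x y)) y"
    using x y neighbours_X by (intro diff_operator_cong) (auto simp: green_fn_eq_martin_ratio k_def)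
  also have "\<dots> = k * scaled_laplacian (1 / lam) 1 (martin_ratio x) y"
    unfolding laplacian_lam_depth_mult[OF y(1,2)] diff_operator_scale ..
  finally show ?thesis using lam_pos lam_bounds conductance_pos[OF x] by (simp add: k_def)
qed

end

section \<open>Oscillation of functions harmonic for the reversed walk\<close>

context natural_random_walk
begin

abbreviation "reversed_laplacian \<equiv> scaled_laplacian (1 / lam) 1"

definition "dist_growth up down = up * diameter K / r + down * diameter K + horizontal_degree * edge_reach"
  for up down :: real

lemma dist_growth_nonneg: "0 \<le> up \<Longrightarrow> 0 \<le> down \<Longrightarrow> 0 \<le> dist_growth up down"
  using diameter_K_nonneg r_bounds horizontal_degree_pos edge_reach by (simp add: dist_growth_def)

lemma dist_base_point_diff_le:
  "dist (base_point z) q - dist (base_point y) q \<le> dist (base_point z) (base_point y)"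
  using dist_triangle[of "base_point z" q "base_point y"] by simp

lemma weight_dist_parent_diff_le:
  assumes y: "y \<in> \<J> n" "n \<noteq> 0"
  shows "weight y * (dist (base_point (parent y)) q - dist (base_point y) q)
    \<le> r\<^sub>\<alpha> ^ n * (diameter K * r ^ n) / r"
proof -
  obtain m where m: "n = Suc m" using y(2) not0_implies_Suc by blast
  have "weight y * (dist (base_point (parent y)) q - dist (base_point y) q)
      \<le> weight y * (diameter K * r ^ n / r)"
    using order_trans[OF dist_base_point_diff_le dist_base_point_parent[of y m]] y m r_bounds
    by (intro mult_left_mono) auto
  also have "\<dots> \<le> r\<^sub>\<alpha> ^ n * (diameter K * r ^ n / r)"
    using weight_le[OF y(1)] diameter_K_nonneg r_bounds by (intro mult_right_mono) auto
  finally show ?thesis by simp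
qed

lemma sum_weight_dist_children_diff_le:
  assumes y: "y \<in> \<J> n"
  shows "(\<Sum>z\<in>children y. weight z * (dist (base_point z) q - dist (base_point y) q))
    \<le> r\<^sub>\<alpha> ^ n * (diameter K * r ^ n)"
proof -
  have "dist (base_point z) q - dist (base_point y) q \<le> diameter K * r ^ n" if "z \<in> children y" for z
    using order_trans[OF dist_base_point_diff_le, of z y] dist_base_point_parent[of z n] that
      children_iff[OF y] by (auto simp: dist_commute)
  then have "(\<Sum>z\<in>children y. weight z * (dist (base_point z) q - dist (base_point y) q))
      \<le> (\<Sum>z\<in>children y. weight z * (diameter K * r ^ n))"
    by (intro sum_mono mult_left_mono) auto
  also have "\<dots> = weight y * (diameter K * r ^ n)"
    using sum_weight_children[OF y] by (simp flip: sum_distrib_right)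
  also have "\<dots> \<le> r\<^sub>\<alpha> ^ n * (diameter K * r ^ n)"
    using weight_le[OF y] diameter_K_nonneg r_bounds by (intro mult_right_mono) auto
  finally show ?thesis .
qed

lemma sum_dist_horizontal_diff_le:
  assumes y: "y \<in> \<J> n"
  shows "(\<Sum>z\<in>horizontal y. dist (base_point z) q - dist (base_point y) q)
    \<le> horizontal_degree * (edge_reach * r ^ n)"
proof -
  have "(\<Sum>z\<in>horizontal y. dist (base_point z) q - dist (base_point y) q)
      \<le> (\<Sum>z\<in>horizontal y. edge_reach * r ^ n)"
    using order_trans[OF dist_base_point_diff_le dist_base_point_horizontal[OF y]] by (rule sum_mono)
  also have "\<dots> \<le> horizontal_degree * (edge_reach * r ^ n)"
    using card_horizontal_le[OF y] edge_reach r_bounds by (simp add: mult_right_mono)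
  finally show ?thesis .
qed

lemma scaled_laplacian_dist_le:
  assumes y: "y \<in> \<J> n" and up: "0 \<le> up" and down: "0 \<le> down"
  shows "scaled_laplacian up down (\<lambda>y. dist (base_point y) q) y \<le> dist_growth up down * (r\<^sub>\<alpha> ^ n * r ^ n)"
proof -
  let ?D = "diameter K * r ^ n"
  have "up * weight y * (dist (base_point (parent y)) q - dist (base_point y) q)
      \<le> up * (r\<^sub>\<alpha> ^ n * ?D / r)" if "n \<noteq> 0"
    using mult_left_mono[OF weight_dist_parent_diff_le[OF y that] up] by (simp add: mult.assoc)
  then have "scaled_laplacian up down (\<lambda>y. dist (base_point y) q) y
      \<le> up * (r\<^sub>\<alpha> ^ n * ?D / r) + down * (r\<^sub>\<alpha> ^ n * ?D) + r\<^sub>\<alpha> ^ n * (horizontal_degree * (edge_reach * r ^ n))"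
    unfolding scaled_laplacian_eq[OF y]
    using up down r_alpha_bounds r_bounds diameter_K_nonneg
      sum_weight_dist_children_diff_le[OF y, of q] sum_dist_horizontal_diff_le[OF y, of q]
    by (intro add_mono mult_left_mono) auto
  then show ?thesis by (simp add: dist_growth_def algebra_simps)
qed

lemma scaled_laplacian_barrier:
  assumes y: "y \<in> \<J> n" and up: "0 \<le> up" and down: "0 \<le> down" and s: "r \<le> s"
    and B: "B * drift up down s n \<le> - (dist_growth up down / r\<^sub>\<alpha>)"
  shows "scaled_laplacian up down (\<lambda>y. dist (base_point y) q + B * s ^ depth y) y \<le> 0"
proof -
  let ?D = "dist_growth up down"
  have D: "0 \<le> ?D" using up down by (rule dist_growth_nonneg)
  have s_pos: "0 < s" using s r_bounds by simp
  have "B * scaled_laplacian up down (\<lambda>y. s ^ depth y) y = weight y * s ^ n * (B * drift up down s n)"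
    unfolding scaled_laplacian_depth_power[OF y s_pos] by simp
  also have "\<dots> \<le> weight y * s ^ n * - (?D / r\<^sub>\<alpha>)"
    using B s_pos by (intro mult_left_mono) auto
  also have "\<dots> \<le> - (r\<^sub>\<alpha> ^ Suc n * s ^ n * (?D / r\<^sub>\<alpha>))"
    using mult_right_mono[OF weight_ge[OF y], of "s ^ n * (?D / r\<^sub>\<alpha>)"] D s_pos r_alpha_bounds
    by (simp add: mult.assoc del: power_Suc)
  also have "\<dots> = - (?D * (r\<^sub>\<alpha> ^ n * s ^ n))" using r_alpha_bounds by simp
  also have "\<dots> \<le> - (?D * (r\<^sub>\<alpha> ^ n * r ^ n))"
    using D s r_bounds r_alpha_bounds by (simp add: mult_left_mono power_mono)
  finally show ?thesis
    unfolding diff_operator_linear using scaled_laplacian_dist_le[OF y up down, of q] by simp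
qed

definition "harnack_const = r\<^sub>\<alpha>\<^sup>2 / (1 / lam + 1 + horizontal_degree)"

lemma harnack_const: "0 < harnack_const" "harnack_const \<le> 1"
proof -
  have "1 < 1 / lam + 1 + horizontal_degree" using lam_pos horizontal_degree_pos by (simp add: add_pos_pos)
  moreover have "r\<^sub>\<alpha>\<^sup>2 \<le> 1" using r_alpha_bounds by (simp add: power_le_one)
  ultimately show "0 < harnack_const" "harnack_const \<le> 1"
    using r_alpha_bounds by (auto simp: harnack_const_def field_simps)
qed

lemma step_weight_reversed_ge:
  assumes y: "y \<in> \<J> n" and z: "z \<in> neighbours y"
  shows "r\<^sub>\<alpha> ^ n * r\<^sub>\<alpha>\<^sup>2 \<le> step_weight (1 / lam) 1 y z"
  using y z
proof (cases rule: neighbour_cases)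
  case (parent m)
  have "r\<^sub>\<alpha> ^ n * r\<^sub>\<alpha>\<^sup>2 \<le> r\<^sub>\<alpha> ^ Suc n"
    using r_alpha_bounds by (simp add: power2_eq_square mult_left_le_one_le mult.left_commute)
  also have "\<dots> \<le> weight y" by (rule weight_ge[OF y])
  also have "\<dots> \<le> weight y / lam" using lam_pos lam_bounds by (simp add: pos_le_divide_eq mult_left_le)
  finally show ?thesis using parent step_weight_edge(1)[OF y] by simp
next
  case child
  then show ?thesis
    using weight_ge[OF child(2)] step_weight_edge(2)[OF y] by (simp add: power2_eq_square mult_ac)
next
  case horizontal
  then show ?thesis
    using r_alpha_bounds step_weight_edge(3)[OF y] by (simp add: mult_left_le power_le_one)
qed

lemma harnack:
  assumes y: "y \<in> \<J> n" and harmonic: "reversed_laplacian v y = 0"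
    and nonneg: "\<And>z. z \<in> insert y (neighbours y) \<Longrightarrow> 0 \<le> v z" and z: "z \<in> neighbours y"
  shows "harnack_const * v z \<le> v y"
proof -
  let ?w = "step_weight (1 / lam) 1 y"
  let ?D = "1 / lam + 1 + horizontal_degree"
  have D: "0 < ?D" using lam_pos horizontal_degree_pos by (simp add: add_pos_pos)
  have "r\<^sub>\<alpha> ^ n * (r\<^sub>\<alpha>\<^sup>2 * v z) \<le> ?w z * v z"
    using mult_right_mono[OF step_weight_reversed_ge[OF y z]] nonneg z by (simp add: mult.assoc)
  also have "\<dots> \<le> (\<Sum>z\<in>neighbours y. ?w z) * v y"
    using harmonic nonneg z lam_pos by (intro harnack_edge) (auto intro: step_weight_nonneg)
  also have "\<dots> \<le> r\<^sub>\<alpha> ^ n * ?D * v y"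
    using sum_step_weight_le[OF y, of "1 / lam" 1] lam_pos nonneg by (intro mult_right_mono) auto
  finally have "r\<^sub>\<alpha>\<^sup>2 * v z \<le> ?D * v y" using r_alpha_bounds by (simp add: mult.assoc)
  then show ?thesis using D by (simp add: harnack_const_def field_simps)
qed

definition "barrier_coeff = dist_growth (1 / lam) 1 / (r\<^sub>\<alpha> * ((1 - r) * (1 / (lam * r) - 1)))"

lemma barrier_coeff_nonneg: "0 \<le> barrier_coeff"
  and reversed_laplacian_barrier: "y \<in> \<J> n \<Longrightarrow> 0 < n \<Longrightarrow>
    reversed_laplacian (\<lambda>y. dist (base_point y) q + - barrier_coeff * r ^ depth y) y \<le> 0"
proof -
  define k where "k = (1 - r) * (1 / (lam * r) - 1)"
  have "lam * r < 1 * 1" using lam_pos lam_bounds r_bounds by (intro mult_strict_mono) auto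
  then have k: "0 < k" using lam_pos r_bounds by (simp add: k_def)
  have coeff: "barrier_coeff = dist_growth (1 / lam) 1 / (r\<^sub>\<alpha> * k)" by (simp add: barrier_coeff_def k_def)
  then show "0 \<le> barrier_coeff" using k r_alpha_bounds lam_pos by (simp add: dist_growth_nonneg)
  assume y: "y \<in> \<J> n" "0 < n"
  have "drift (1 / lam) 1 r n = k"
    using y(2) lam_pos r_bounds by (simp add: drift_def k_def field_simps)
  then have "- barrier_coeff * drift (1 / lam) 1 r n = - (dist_growth (1 / lam) 1 / r\<^sub>\<alpha>)"
    using k by (simp add: coeff)
  then show "reversed_laplacian (\<lambda>y. dist (base_point y) q + - barrier_coeff * r ^ depth y) y \<le> 0"
    using lam_pos by (intro scaled_laplacian_barrier[OF y(1)]) auto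
qed

definition "nbhd_radius = edge_reach + diameter K + 1"

definition "nbhd m q = {y. \<exists>n\<ge>m. y \<in> \<J> n \<and> dist (base_point y) q \<le> nbhd_radius * r ^ m}"

lemma nbhd_radius_pos: "0 < nbhd_radius"
  using edge_reach diameter_K_nonneg by (simp add: nbhd_radius_def add_pos_nonneg)

lemma nbhd_X: "y \<in> nbhd m q \<Longrightarrow> y \<in> X"
  using J_X by (auto simp: nbhd_def)

lemma dist_base_point_le_of_cell:
  assumes "y \<in> \<J> n" "m \<le> n" "\<eta> \<in> cell y" "dist \<eta> q \<le> r ^ m"
  shows "dist (base_point y) q \<le> (diameter K + 1) * r ^ m"
proof -
  have "diameter K * r ^ n \<le> diameter K * r ^ m"
    using diameter_K_nonneg r_power_le[OF assms(2)] by (intro mult_left_mono)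
  then show ?thesis
    using dist_base_point[OF assms(1,3)] dist_triangle[of "base_point y" q \<eta>] assms(4)
    by (simp add: algebra_simps)
qed

lemma cell_in_nbhd:
  assumes "y \<in> \<J> n" "m \<le> n" "\<eta> \<in> cell y" "dist \<eta> q \<le> r ^ m"
  shows "y \<in> nbhd m q"
proof -
  have "(diameter K + 1) * r ^ m \<le> nbhd_radius * r ^ m"
    using edge_reach r_bounds by (intro mult_right_mono) (auto simp: nbhd_radius_def)
  then show ?thesis using dist_base_point_le_of_cell[OF assms] assms(1,2) by (auto simp: nbhd_def)
qed

lemma cell_neighbours_in_nbhd:
  assumes y: "y \<in> \<J> n" "m < n" "\<eta> \<in> cell y" "dist \<eta> q \<le> r ^ m" and z: "z \<in> insert y (neighbours y)"
  shows "z \<in> nbhd m q"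
proof (cases "z = y")
  case False
  obtain k where k: "n = Suc k" using y(2) gr0_conv_Suc by (cases n) auto
  then obtain j where j: "j \<ge> k" "z \<in> \<J> j" "dist (base_point z) (base_point y) \<le> edge_reach * r ^ k"
    using neighbours_close y(1) z False by blast
  have "edge_reach * r ^ k \<le> edge_reach * r ^ m"
    using edge_reach r_power_le[of m k] y(2) k by (intro mult_left_mono) auto
  moreover have "dist (base_point y) q \<le> (diameter K + 1) * r ^ m"
    using y by (intro dist_base_point_le_of_cell) auto
  ultimately have "dist (base_point z) q \<le> nbhd_radius * r ^ m"
    using dist_triangle[of "base_point z" q "base_point y"] j(3)
    by (simp add: nbhd_radius_def algebra_simps)
  moreover have "m \<le> j" using j(1) y(2) k by simp
  ultimately show ?thesis using j(2) by (auto simp: nbhd_def)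
qed (use cell_in_nbhd y in auto)

lemma ray_in_nbhd: "\<xi> \<in> K \<Longrightarrow> m \<le> k \<Longrightarrow> ray \<xi> k \<in> nbhd m \<xi>"
  using cell_in_nbhd[OF ray_J _ ray_cell] r_bounds by simp

text \<open>The radius of the core is so large that the barrier loses at most half of a lower bound, and \<open>skip\<close>
  is so large that all cells meeting the core are horizontal neighbours of each other.\<close>

definition "core_factor = 2 * (nbhd_radius + barrier_coeff) + 1"

definition "skip = (SOME l. l > 0 \<and> core_factor * r ^ l \<le> min (\<gamma> * r) 1)"

definition "core_radius m = core_factor * r ^ (m + skip)"

lemma core_factor_pos: "0 < core_factor"
  using nbhd_radius_pos barrier_coeff_nonneg by (simp add: core_factor_def)

lemma skip: "skip > 0" "core_factor * r ^ skip \<le> min (\<gamma> * r) 1"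
proof -
  have "\<forall>\<^sub>F l in sequentially. core_factor * r ^ l < min (\<gamma> * r) 1"
    using r_bounds gamma_pos by (intro eventually_mult_power_less) auto
  then obtain m where m: "\<And>l. l \<ge> m \<Longrightarrow> core_factor * r ^ l < min (\<gamma> * r) 1"
    by (auto simp: eventually_sequentially)
  have "\<exists>l. l > 0 \<and> core_factor * r ^ l \<le> min (\<gamma> * r) 1"
    using m[of "Suc m"] by (intro exI[of _ "Suc m"]) (simp add: less_imp_le)
  then show "skip > 0" "core_factor * r ^ skip \<le> min (\<gamma> * r) 1"
    unfolding skip_def by (rule someI2_ex, blast)+
qed

lemma core_radius_pos: "0 < core_radius m"
  using core_factor_pos r_bounds by (simp add: core_radius_def)

lemma core_radius_le: "core_radius m \<le> r ^ m" "core_radius m \<le> \<gamma> * r ^ Suc m"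
proof -
  have "core_radius m = r ^ m * (core_factor * r ^ skip)" by (simp add: core_radius_def power_add)
  also have "\<dots> \<le> r ^ m * min (\<gamma> * r) 1" using skip(2) r_bounds by (intro mult_left_mono) auto
  finally have "core_radius m \<le> r ^ m * min (\<gamma> * r) 1" .
  moreover have "r ^ m * min (\<gamma> * r) 1 \<le> r ^ m * 1" "r ^ m * min (\<gamma> * r) 1 \<le> r ^ m * (\<gamma> * r)"
    using r_bounds by (intro mult_left_mono; simp)+
  ultimately show "core_radius m \<le> r ^ m" "core_radius m \<le> \<gamma> * r ^ Suc m"
    by (simp_all add: mult_ac)
qed

lemma harnack_chain:
  assumes nonneg: "\<And>y. y \<in> nbhd m q \<Longrightarrow> 0 \<le> v y"
    and harmonic: "\<And>n y. y \<in> \<J> n \<Longrightarrow> m < n \<Longrightarrow> reversed_laplacian v y = 0"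
    and x: "x \<in> \<J> (Suc m)" "q \<in> cell x"
    and y: "y \<in> \<J> (Suc m + i)" "\<eta> \<in> cell y" "dist \<eta> q \<le> core_radius m"
  shows "harnack_const ^ Suc i * v x \<le> v y"
  using y
proof (induction i arbitrary: y)
  case 0
  then have y: "y \<in> \<J> (Suc m)" by simp
  have near: "dist \<eta> q \<le> r ^ m" using 0(3) core_radius_le(1)[of m] by simp
  show ?case
  proof (cases "y = x")
    case True
    have "0 \<le> v x" using nonneg cell_in_nbhd[OF x(1) _ x(2), of m q] r_bounds by simp
    then show ?thesis using True harnack_const by (simp add: mult_left_le_one_le)
  next
    case False
    have "gap S K y x \<le> \<gamma> * r ^ Suc m"
      using gap_le[OF 0(2) x(2)] 0(3) core_radius_le(2)[of m] by linarith
    then have "x \<in> neighbours y" using horizontal_iff[OF y] x(1) False neighbours_eq[OF y] by auto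
    then have "harnack_const * v x \<le> v y"
      using cell_neighbours_in_nbhd[OF y _ 0(2) near] nonneg harmonic[OF y] by (intro harnack[OF y]) auto
    then show ?thesis by simp
  qed
next
  case (Suc i)
  then have y: "y \<in> \<J> (Suc (Suc m + i))" by simp
  have near: "dist \<eta> q \<le> r ^ m" using Suc.prems(3) core_radius_le(1)[of m] by simp
  have "\<eta> \<in> cell (parent y)"
    using cell_prefix_subset[OF J_words[OF y] prefix_parent[OF y]] Suc.prems(2) by blast
  then have "harnack_const ^ Suc i * v x \<le> v (parent y)"
    using Suc.IH parent_J[OF y] Suc.prems(3) by blast
  then have "harnack_const ^ Suc (Suc i) * v x \<le> harnack_const * v (parent y)"
    using harnack_const by (simp add: mult.assoc)
  also have "\<dots> \<le> v y"
    using cell_neighbours_in_nbhd[OF y _ Suc.prems(2) near] nonneg harmonic[OF y] neighbours_eq[OF y]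
    by (intro harnack[OF y]) auto
  finally show ?case .
qed

lemma reversed_minimum_principle:
  assumes U: "\<And>y. y \<in> U \<Longrightarrow> \<exists>n>0. y \<in> \<J> n"
    and super: "\<And>y. y \<in> U \<Longrightarrow> reversed_laplacian v y \<le> 0"
    and bounded: "\<And>y. y \<in> U \<Longrightarrow> - b \<le> v y"
    and boundary: "\<And>y z. y \<in> U \<Longrightarrow> z \<in> neighbours y \<Longrightarrow> z \<notin> U \<Longrightarrow> 0 \<le> v z"
    and "y \<in> U"
  shows "0 \<le> v y"
proof -
  define t where "t = (1 + 1 / lam) / 2"
  have t: "1 < t" "t < 1 / lam" using one_less_inverse_lam by (auto simp: t_def)
  show ?thesis
  proof (rule minimum_principle[where U = U and w = "step_weight (1 / lam) 1" and s = "\<lambda>y. t ^ depth y"])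
    fix y assume "y \<in> U"
    then obtain n where n: "0 < n" "y \<in> \<J> n" using U by blast
    show "reversed_laplacian (\<lambda>y. t ^ depth y) y < 0"
      using weight_pos[OF n(2)] t drift_reversed_neg[OF t n(1)]
      unfolding scaled_laplacian_depth_power[OF n(2) less_trans[OF zero_less_one t(1)]]
      by (intro mult_pos_neg) auto
  next
    fix e :: real assume e: "e > 0"
    have "\<forall>\<^sub>F n in sequentially. b * (1 / t) ^ n < e"
      using e t by (intro eventually_mult_power_less) auto
    then have "\<forall>\<^sub>F n in sequentially. \<forall>y\<in>\<J> n. \<not> (y \<in> U \<and> v y + e * t ^ depth y < 0)"
    proof eventually_elim
      case (elim n)
      have "b < e * t ^ n" using elim t by (simp add: power_divide divide_less_eq mult.commute)
      then show ?case using bounded lev_eq by fastforce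
    qed
    then have "finite {y\<in>X. y \<in> U \<and> v y + e * t ^ depth y < 0}" by (rule finite_X_of_eventually)
    then show "finite {y\<in>U. v y + e * t ^ depth y < 0}"
      by (rule finite_subset[rotated]) (use U J_X in blast)
  qed (use super boundary \<open>y \<in> U\<close> t lam_pos in \<open>auto intro: step_weight_nonneg\<close>)
qed

definition "barrier k q y = barrier_coeff * r ^ k + (dist (base_point y) q + - barrier_coeff * r ^ depth y)"

lemma dist_le_barrier:
  assumes "y \<in> \<J> n" "k \<le> n"
  shows "dist (base_point y) q \<le> barrier k q y"
proof -
  have "barrier_coeff * r ^ n \<le> barrier_coeff * r ^ k"
    using barrier_coeff_nonneg r_power_le[OF assms(2)] by (intro mult_left_mono)
  then show ?thesis using lev_eq[OF assms(1)] by (simp add: barrier_def)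
qed

lemma barrier_le: "barrier k q y \<le> dist (base_point y) q + barrier_coeff * r ^ k"
  using barrier_coeff_nonneg r_bounds by (simp add: barrier_def)

lemma reversed_laplacian_add_barrier_le:
  assumes "y \<in> \<J> n" "0 < n" "0 \<le> a"
  shows "reversed_laplacian (\<lambda>y. (k + v y) + a * barrier m q y) y \<le> reversed_laplacian v y"
proof -
  have "reversed_laplacian (\<lambda>y. (k + v y) + a * barrier m q y) y = reversed_laplacian v y +
      a * reversed_laplacian (\<lambda>y. dist (base_point y) q + - barrier_coeff * r ^ depth y) y"
    unfolding barrier_def diff_operator_linear diff_operator_add_const ..
  then show ?thesis
    using mult_nonneg_nonpos[OF assms(3) reversed_laplacian_barrier[OF assms(1,2), of q]] by simp
qed

text \<open>The minimum principle for \<open>v - b + (b / \<delta>) * barrier\<close> on the vertices below level \<open>k\<close> at distance less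
  than \<open>\<delta>\<close> from \<open>q\<close>.\<close>

lemma lower_bound_below_level:
  assumes harmonic: "\<And>n y. y \<in> \<J> n \<Longrightarrow> k < n \<Longrightarrow> reversed_laplacian v y = 0"
    and nonneg: "\<And>n y z. y \<in> \<J> n \<Longrightarrow> k < n \<Longrightarrow> dist (base_point y) q < \<delta> \<Longrightarrow> z \<in> insert y (neighbours y) \<Longrightarrow> 0 \<le> v z"
    and level: "\<And>y. y \<in> \<J> k \<Longrightarrow> dist (base_point y) q < \<delta> \<Longrightarrow> b \<le> v y"
    and b: "0 \<le> b" and \<delta>: "0 < \<delta>" and y: "y \<in> \<J> n" "k < n" "dist (base_point y) q < \<delta>"
  shows "b * (1 - (dist (base_point y) q + barrier_coeff * r ^ k) / \<delta>) \<le> v y"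
proof -
  define f where "f y = (- b + v y) + b / \<delta> * barrier k q y" for y
  define U where "U = {y. \<exists>n>k. y \<in> \<J> n \<and> dist (base_point y) q < \<delta>}"
  have f_ge: "v z - b + b / \<delta> * dist (base_point z) q \<le> f z" if "z \<in> \<J> j" "k \<le> j" for z j
    using mult_left_mono[OF dist_le_barrier[OF that, of q], of "b / \<delta>"] b \<delta> by (simp add: f_def)
  have "0 \<le> f y"
  proof (rule reversed_minimum_principle[where U = U and v = f and b = b])
    show "y \<in> U" using y by (auto simp: U_def)
    fix y assume "y \<in> U"
    then obtain n where n: "k < n" "y \<in> \<J> n" "dist (base_point y) q < \<delta>" by (auto simp: U_def)
    then show "\<exists>n>0. y \<in> \<J> n" by (intro exI[of _ n]) simp
    show "reversed_laplacian f y \<le> 0"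
      using reversed_laplacian_add_barrier_le[OF n(2), of "b / \<delta>" "- b" v k q] harmonic[OF n(2,1)] n(1) b \<delta>
      by (simp add: f_def[abs_def])
    have "0 \<le> v y" using nonneg[OF n(2,1,3)] by simp
    moreover have "0 \<le> b / \<delta> * dist (base_point y) q" using b \<delta> by simp
    ultimately show "- b \<le> f y" using f_ge[OF n(2)] n(1) by simp
    fix z assume z: "z \<in> neighbours y" "z \<notin> U"
    obtain n' where n': "n = Suc n'" using n(1) by (cases n) auto
    then obtain j where "n' \<le> j" "z \<in> \<J> j" using neighbours_close z n(2) by blast
    then have j: "k \<le> j" "z \<in> \<J> j" using n(1) n' by simp_all
    have vz: "0 \<le> v z" using nonneg n z by blast
    show "0 \<le> f z"
    proof (cases "\<delta> \<le> dist (base_point z) q")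
      case True
      then have "b \<le> b / \<delta> * dist (base_point z) q"
        using b \<delta> mult_left_mono[OF True, of "b / \<delta>"] by simp
      then show ?thesis using f_ge[OF j(2,1)] vz by linarith
    next
      case False
      then have "\<not> k < j" using z(2) j(2) by (auto simp: U_def)
      then have "b \<le> v z" using level False j by simp
      moreover have "0 \<le> b / \<delta> * dist (base_point z) q" using b \<delta> by simp
      ultimately show ?thesis using f_ge[OF j(2,1)] by linarith
    qed
  qed
  moreover have "b / \<delta> * barrier k q y \<le> b / \<delta> * (dist (base_point y) q + barrier_coeff * r ^ k)"
    using b \<delta> by (intro mult_left_mono barrier_le) auto
  ultimately show ?thesis by (simp add: f_def algebra_simps add_divide_distrib)
qed

lemma nbhd_lower_bound:
  assumes nonneg: "\<And>y. y \<in> nbhd m q \<Longrightarrow> 0 \<le> v y"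
    and harmonic: "\<And>n y. y \<in> \<J> n \<Longrightarrow> m < n \<Longrightarrow> reversed_laplacian v y = 0"
    and x: "x \<in> \<J> (Suc m)" "q \<in> cell x" and y: "y \<in> nbhd (m + Suc skip) q"
  shows "harnack_const ^ skip / 2 * v x \<le> v y"
proof -
  define b where "b = harnack_const ^ skip * v x"
  obtain l where l: "skip = Suc l" using skip(1) gr0_conv_Suc by blast
  have b: "0 \<le> b"
    using nonneg cell_in_nbhd[OF x(1) _ x(2), of m q] r_bounds harnack_const by (simp add: b_def)
  obtain n where n: "n \<ge> m + Suc skip" "y \<in> \<J> n" "dist (base_point y) q \<le> nbhd_radius * r ^ (m + Suc skip)"
    using y by (auto simp: nbhd_def)
  have "nbhd_radius * r ^ (m + Suc skip) \<le> nbhd_radius * r ^ (m + skip)"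
    using nbhd_radius_pos r_power_le[of "m + skip" "m + Suc skip"] by (intro mult_left_mono) auto
  then have y_dist: "dist (base_point y) q \<le> nbhd_radius * r ^ (m + skip)" using n(3) by linarith
  have "nbhd_radius * r ^ (m + skip) < core_radius m"
    using nbhd_radius_pos barrier_coeff_nonneg r_bounds by (simp add: core_radius_def core_factor_def)
  then have y_core: "dist (base_point y) q < core_radius m" using y_dist by linarith
  have "dist (base_point y) q + barrier_coeff * r ^ (m + skip) \<le> core_radius m / 2"
    using y_dist zero_less_power[OF r_bounds(1), of "m + skip"]
    by (simp add: core_radius_def core_factor_def algebra_simps del: zero_less_power)
  then have "b * (1 / 2) \<le> b * (1 - (dist (base_point y) q + barrier_coeff * r ^ (m + skip)) / core_radius m)"
    using b core_radius_pos[of m] by (intro mult_left_mono) (auto simp: field_simps)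
  also have "\<dots> \<le> v y"
  proof (rule lower_bound_below_level[OF _ _ _ b core_radius_pos n(2) _ y_core])
    show "b \<le> v z" if "z \<in> \<J> (m + skip)" "dist (base_point z) q < core_radius m" for z
      using harnack_chain[OF nonneg harmonic x, where y = z and i = l and \<eta> = "base_point z"]
        that base_point_cell l by (simp add: b_def)
    show "0 \<le> v z" if "w \<in> \<J> n" "m + skip < n" "dist (base_point w) q < core_radius m"
        "z \<in> insert w (neighbours w)" for n w z
      using cell_neighbours_in_nbhd[OF that(1) _ base_point_cell _ that(4)] that core_radius_le(1)[of m]
      by (intro nonneg) auto
  qed (use harmonic n in auto)
  finally show ?thesis by (simp add: b_def)
qed

definition "contraction = 1 - harnack_const ^ skip / 2"

lemma contraction_bounds: "0 < contraction" "contraction < 1"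
proof -
  have "harnack_const ^ skip \<le> 1" using harnack_const by (intro power_le_one) auto
  then show "0 < contraction" "contraction < 1" using harnack_const by (auto simp: contraction_def)
qed

text \<open>The lower bounds for \<open>h - A\<close> and for \<open>A + D - h\<close> add up, where \<open>A\<close> is the infimum of \<open>h\<close> there.\<close>

lemma oscillation_step:
  assumes osc: "\<And>y z. y \<in> nbhd m q \<Longrightarrow> z \<in> nbhd m q \<Longrightarrow> h y - h z \<le> D"
    and harmonic: "\<And>n y. y \<in> \<J> n \<Longrightarrow> m < n \<Longrightarrow> reversed_laplacian h y = 0" and q: "q \<in> K"
    and yz: "y \<in> nbhd (m + Suc skip) q" "z \<in> nbhd (m + Suc skip) q"
  shows "h y - h z \<le> contraction * D"
proof -
  obtain x where x: "x \<in> \<J> (Suc m)" "q \<in> cell x" using ex_level_cell[OF q] by blast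
  have x_nbhd: "x \<in> nbhd m q" using cell_in_nbhd[OF x(1) _ x(2), of m q] r_bounds by simp
  define A where "A = Inf (h ` nbhd m q)"
  have bdd: "bdd_below (h ` nbhd m q)"
    using osc[OF x_nbhd] by (intro bdd_belowI[of _ "h x - D"]) (auto simp: algebra_simps)
  have lower: "A \<le> h w" if "w \<in> nbhd m q" for w
    unfolding A_def using bdd that by (intro cInf_lower) auto
  have upper: "h w \<le> A + D" if "w \<in> nbhd m q" for w
  proof -
    have "h w - D \<le> A"
      unfolding A_def using osc[OF that] x_nbhd by (intro cInf_greatest) (auto simp: algebra_simps)
    then show ?thesis by simp
  qed
  let ?g = "harnack_const ^ skip / 2"
  have "?g * (- A + h x) \<le> - A + h z"
  proof (rule nbhd_lower_bound[OF _ _ x yz(2)])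
    show "0 \<le> - A + h w" if "w \<in> nbhd m q" for w using lower[OF that] by simp
    show "reversed_laplacian (\<lambda>w. - A + h w) w = 0" if "w \<in> \<J> n" "m < n" for n w
      unfolding diff_operator_add_const by (rule harmonic[OF that])
  qed
  moreover have "?g * ((A + D) + - h x) \<le> (A + D) + - h y"
  proof (rule nbhd_lower_bound[OF _ _ x yz(1)])
    show "0 \<le> (A + D) + - h w" if "w \<in> nbhd m q" for w using upper[OF that] by simp
    show "reversed_laplacian (\<lambda>w. (A + D) + - h w) w = 0" if "w \<in> \<J> n" "m < n" for n w
      unfolding diff_operator_add_const diff_operator_uminus using harmonic[OF that] by simp
  qed
  ultimately show ?thesis unfolding contraction_def by argo
qed

lemma oscillation_iterate:
  assumes osc: "\<And>y z. y \<in> X \<Longrightarrow> z \<in> X \<Longrightarrow> h y - h z \<le> D"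
    and harmonic: "\<And>n y. y \<in> \<J> n \<Longrightarrow> m < n \<Longrightarrow> reversed_laplacian h y = 0" and q: "q \<in> K"
    and "y \<in> nbhd (m + j * Suc skip) q" "z \<in> nbhd (m + j * Suc skip) q"
  shows "h y - h z \<le> contraction ^ j * D"
  using assms(4,5)
proof (induction j arbitrary: y z)
  case 0
  then show ?case using osc nbhd_X by simp
next
  case (Suc j)
  have eq: "m + Suc j * Suc skip = (m + j * Suc skip) + Suc skip" by simp
  have "h y - h z \<le> contraction * (contraction ^ j * D)"
  proof (rule oscillation_step[OF Suc.IH _ q])
    show "reversed_laplacian h w = 0" if "w \<in> \<J> n" "m + j * Suc skip < n" for n w
      using harmonic[OF that(1)] add_lessD1[OF that(2)] .
  qed (use Suc.prems in \<open>simp_all only: eq\<close>)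
  then show ?case by simp
qed

lemma martin_ratio_oscillation:
  assumes x: "x \<in> X" and e: "e > 0"
  shows "\<exists>n. \<forall>q\<in>K. \<forall>y\<in>nbhd n q. \<forall>z\<in>nbhd n q. \<bar>martin_ratio x y - martin_ratio x z\<bar> < e"
proof -
  obtain B where B: "B > 0" "\<And>y. y \<in> X \<Longrightarrow> martin_ratio x y \<le> B"
    using martin_ratio_bounded[OF x] by blast
  obtain j where j: "contraction ^ j < e / B"
    using real_arch_pow_inv[of "e / B" contraction] e B(1) contraction_bounds by auto
  let ?m = "depth x + j * Suc skip"
  have "martin_ratio x y - martin_ratio x z < e"
    if "q \<in> K" "y \<in> nbhd ?m q" "z \<in> nbhd ?m q" for q y z
  proof -
    have "martin_ratio x y - martin_ratio x z \<le> contraction ^ j * B"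
    proof (rule oscillation_iterate[OF _ _ that])
      show "martin_ratio x y - martin_ratio x z \<le> B" if "y \<in> X" "z \<in> X" for y z
        using B(2)[OF that(1)] martin_ratio_nonneg[of x z] by simp
      show "reversed_laplacian (martin_ratio x) y = 0" if "y \<in> \<J> n" "depth x < n" for n y
        using that lev_eq[OF that(1)] by (intro martin_ratio_harmonic x J_X) auto
    qed
    also have "\<dots> < e" using j B(1) by (simp add: field_simps)
    finally show ?thesis .
  qed
  then show ?thesis by (intro exI[of _ ?m]) (auto simp: abs_less_iff)
qed

abbreviation "martin_kernel \<equiv> martin N S \<rho> K \<gamma> lam"

lemma martin_kernel_eq_lim: "martin_kernel x \<xi> = lim (\<lambda>n. martin_ratio x (ray \<xi> n))"
  by (simp add: martin_def Let_def ray_def martin_ratio_def green_eq)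

lemma martin_ratio_tendsto:
  assumes x: "x \<in> X" and \<xi>: "\<xi> \<in> K"
  shows "(\<lambda>n. martin_ratio x (ray \<xi> n)) \<longlonglongrightarrow> martin_kernel x \<xi>"
proof -
  have "Cauchy (\<lambda>n. martin_ratio x (ray \<xi> n))"
  proof (rule metric_CauchyI)
    fix e :: real assume "e > 0"
    then obtain m where m: "\<forall>q\<in>K. \<forall>y\<in>nbhd m q. \<forall>z\<in>nbhd m q. \<bar>martin_ratio x y - martin_ratio x z\<bar> < e"
      using martin_ratio_oscillation[OF x] by blast
    then have "dist (martin_ratio x (ray \<xi> k)) (martin_ratio x (ray \<xi> l)) < e" if "k \<ge> m" "l \<ge> m" for k l
      using \<xi> ray_in_nbhd[OF \<xi>] that by (simp add: dist_real_def)
    then show "\<exists>m. \<forall>k\<ge>m. \<forall>l\<ge>m. dist (martin_ratio x (ray \<xi> k)) (martin_ratio x (ray \<xi> l)) < e" by blast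
  qed
  then show ?thesis
    unfolding martin_kernel_eq_lim using Cauchy_convergent convergent_LIMSEQ_iff by blast
qed

lemma martin_ratio_approx:
  assumes x: "x \<in> X" and e: "e > 0"
  shows "\<exists>n. \<forall>\<xi>\<in>K. \<forall>y\<in>nbhd n \<xi>. \<bar>martin_ratio x y - martin_kernel x \<xi>\<bar> \<le> e"
proof -
  obtain n where n: "\<forall>q\<in>K. \<forall>y\<in>nbhd n q. \<forall>z\<in>nbhd n q. \<bar>martin_ratio x y - martin_ratio x z\<bar> < e"
    using martin_ratio_oscillation[OF x e] by blast
  have "\<bar>martin_ratio x y - martin_kernel x \<xi>\<bar> \<le> e" if \<xi>: "\<xi> \<in> K" and y: "y \<in> nbhd n \<xi>" for \<xi> y
  proof (rule LIMSEQ_le_const2)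
    show "(\<lambda>k. \<bar>martin_ratio x y - martin_ratio x (ray \<xi> k)\<bar>) \<longlonglongrightarrow> \<bar>martin_ratio x y - martin_kernel x \<xi>\<bar>"
      by (intro tendsto_intros martin_ratio_tendsto x \<xi>)
    show "\<exists>m. \<forall>k\<ge>m. \<bar>martin_ratio x y - martin_ratio x (ray \<xi> k)\<bar> \<le> e"
      using n \<xi> y ray_in_nbhd[OF \<xi>] by (intro exI[of _ n]) (auto intro: less_imp_le)
  qed
  then show ?thesis by blast
qed

theorem continuous_on_martin_kernel:
  assumes x: "x \<in> X"
  shows "continuous_on K (martin_kernel x)"
  unfolding continuous_on_iff
proof (intro ballI allI impI)
  fix \<xi> and e :: real assume \<xi>: "\<xi> \<in> K" and e: "e > 0"
  obtain n where n: "\<forall>\<xi>\<in>K. \<forall>y\<in>nbhd n \<xi>. \<bar>martin_ratio x y - martin_kernel x \<xi>\<bar> \<le> e / 3"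
    using martin_ratio_approx[OF x, of "e / 3"] e by auto
  have "dist (martin_kernel x \<eta>) (martin_kernel x \<xi>) < e" if \<eta>: "\<eta> \<in> K" "dist \<eta> \<xi> < r ^ n" for \<eta>
  proof -
    obtain y where y: "y \<in> \<J> n" "\<eta> \<in> cell y" using ex_level_cell[OF \<eta>(1)] by blast
    have "y \<in> nbhd n \<eta>" "y \<in> nbhd n \<xi>"
      using cell_in_nbhd[OF y(1) order_refl y(2)] \<eta>(2) r_bounds by auto
    then have "\<bar>martin_ratio x y - martin_kernel x \<eta>\<bar> \<le> e / 3" "\<bar>martin_ratio x y - martin_kernel x \<xi>\<bar> \<le> e / 3"
      using n \<eta>(1) \<xi> by blast+
    then show ?thesis using e unfolding dist_real_def by linarith
  qed
  then show "\<exists>d>0. \<forall>\<eta>\<in>K. dist \<eta> \<xi> < d \<longrightarrow> dist (martin_kernel x \<eta>) (martin_kernel x \<xi>) < e"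
    using r_bounds by (intro exI[of _ "r ^ n"]) auto
qed

text \<open>Outside \<open>K\<close> the ray in the definition of the kernel is an arbitrary sequence, the same at every point.\<close>

lemma borel_measurable_martin_kernel:
  assumes "x \<in> X"
  shows "martin_kernel x \<in> borel_measurable borel"
proof (rule borel_measurable_extend_continuous_on_K[OF continuous_on_martin_kernel[OF assms]])
  fix \<xi> assume "\<xi> \<notin> K"
  have "\<xi> \<in> K" if "geo_ray N S \<rho> K \<xi> ys" for ys
    using that[unfolded geo_ray_def, rule_format, of 0] by (auto simp: J.simps)
  then have "geo_ray N S \<rho> K \<xi> = (\<lambda>_. False)" using \<open>\<xi> \<notin> K\<close> by blast
  then show "martin_kernel x \<xi> = lim (\<lambda>n. martin_ratio x ((SOME ys. False) n))"
    by (simp add: martin_kernel_eq_lim ray_def)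
qed

lemma martin_kernel_nonneg: "x \<in> X \<Longrightarrow> \<xi> \<in> K \<Longrightarrow> 0 \<le> martin_kernel x \<xi>"
  by (rule LIMSEQ_le_const[OF martin_ratio_tendsto]) (auto intro: martin_ratio_nonneg)

end

section \<open>Boundary values and the Poisson representation\<close>

context self_similar_set
begin

definition "cell_sequences = {(s, \<xi>). \<forall>n. s n \<in> \<J> n \<and> \<xi> \<in> cell (s n)}"

definition boundary_value :: "(nat list \<Rightarrow> real) \<Rightarrow> ('a \<Rightarrow> real) \<Rightarrow> bool" where
  "boundary_value f u \<longleftrightarrow> uniform_limit cell_sequences (\<lambda>n p. f (fst p n)) (\<lambda>p. u (snd p)) sequentially"

lemma cell_sequences_K: "p \<in> cell_sequences \<Longrightarrow> snd p \<in> K"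
  using cell_subset_K[OF J_words] by (fastforce simp: cell_sequences_def)

lemma boundary_value_iff:
  "boundary_value f u \<longleftrightarrow> (\<forall>e>0. \<forall>\<^sub>F n in sequentially. \<forall>y\<in>\<J> n. \<forall>\<xi>\<in>cell y. \<bar>f y - u \<xi>\<bar> < e)"
proof -
  have "(\<forall>p\<in>cell_sequences. dist (f (fst p n)) (u (snd p)) < e) \<longleftrightarrow> (\<forall>y\<in>\<J> n. \<forall>\<xi>\<in>cell y. \<bar>f y - u \<xi>\<bar> < e)" for n e
  proof (intro iffI ballI)
    fix y \<xi> assume close: "\<forall>p\<in>cell_sequences. dist (f (fst p n)) (u (snd p)) < e"
      and y: "y \<in> \<J> n" "\<xi> \<in> cell y"
    then have "\<xi> \<in> K" using cell_subset_K[OF J_words] by blast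
    then have "((ray \<xi>)(n := y), \<xi>) \<in> cell_sequences"
      using y ray_J ray_cell by (simp add: cell_sequences_def)
    then show "\<bar>f y - u \<xi>\<bar> < e" using close by (fastforce simp: dist_real_def)
  next
    fix p assume close: "\<forall>y\<in>\<J> n. \<forall>\<xi>\<in>cell y. \<bar>f y - u \<xi>\<bar> < e" and "p \<in> cell_sequences"
    then have "fst p n \<in> \<J> n" "snd p \<in> cell (fst p n)" by (simp_all add: cell_sequences_def split_def)
    then show "dist (f (fst p n)) (u (snd p)) < e" using close by (simp only: dist_real_def)
  qed
  then show ?thesis by (simp add: boundary_value_def uniform_limit_iff)
qed

lemma boundary_value_const [simp]: "boundary_value (\<lambda>_. k) (\<lambda>_. k)"
  by (simp add: boundary_value_iff)

lemma boundary_value_add: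
  "boundary_value f u \<Longrightarrow> boundary_value g v \<Longrightarrow> boundary_value (\<lambda>x. f x + g x) (\<lambda>\<xi>. u \<xi> + v \<xi>)"
  unfolding boundary_value_def by (rule uniform_limit_add)

lemma boundary_value_scale: "boundary_value f u \<Longrightarrow> boundary_value (\<lambda>x. k * f x) (\<lambda>\<xi>. k * u \<xi>)"
  unfolding boundary_value_def
  by (rule bounded_linear.uniform_limit[OF bounded_linear_mult_right])

lemma boundary_value_uminus: "boundary_value f u \<Longrightarrow> boundary_value (\<lambda>x. - f x) (\<lambda>\<xi>. - u \<xi>)"
  using boundary_value_scale[of f u "-1"] by simp

lemma boundary_value_mult:
  assumes "boundary_value f u" "boundary_value g v" "bounded (u ` K)" "bounded (v ` K)"
  shows "boundary_value (\<lambda>x. f x * g x) (\<lambda>\<xi>. u \<xi> * v \<xi>)"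
proof -
  have "bounded ((\<lambda>p. w (snd p)) ` cell_sequences)" if "bounded (w ` K)" for w :: "'a \<Rightarrow> real"
    using that by (rule bounded_subset) (use cell_sequences_K in blast)
  then show ?thesis
    using assms unfolding boundary_value_def by (intro uniform_lim_mult)
qed

lemma boundary_value_transform:
  assumes "boundary_value f u" "\<forall>\<^sub>F n in sequentially. \<forall>y\<in>\<J> n. g y = f y"
  shows "boundary_value g u"
  unfolding boundary_value_iff
proof (intro allI impI)
  fix e :: real assume "e > 0"
  with assms(1) have "\<forall>\<^sub>F n in sequentially. \<forall>y\<in>\<J> n. \<forall>\<xi>\<in>cell y. \<bar>f y - u \<xi>\<bar> < e"
    unfolding boundary_value_iff by blast
  then show "\<forall>\<^sub>F n in sequentially. \<forall>y\<in>\<J> n. \<forall>\<xi>\<in>cell y. \<bar>g y - u \<xi>\<bar> < e"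
    using assms(2) by eventually_elim simp
qed

lemma boundary_value_tendsto:
  assumes "boundary_value f u" "geo_ray N S \<rho> K \<xi> ys"
  shows "(\<lambda>n. f (ys n)) \<longlonglongrightarrow> u \<xi>"
proof -
  have "(ys, \<xi>) \<in> cell_sequences" using assms(2) by (simp add: cell_sequences_def geo_ray_def)
  then show ?thesis using assms(1) unfolding boundary_value_def by (auto dest: tendsto_uniform_limitI)
qed

lemma boundary_value_unique:
  assumes "boundary_value f u" "boundary_value f v" "\<xi> \<in> K"
  shows "u \<xi> = v \<xi>"
  using boundary_value_tendsto geo_ray_ray assms LIMSEQ_unique by metis

lemma riemann_sum_tendsto:
  assumes "boundary_value \<phi> \<psi>" "integrable (nu K) \<psi>"
  shows "(\<lambda>n. \<Sum>y\<in>\<J> n. weight y * \<phi> y) \<longlonglongrightarrow> (\<integral>\<xi>. \<psi> \<xi> \<partial>nu K)"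
proof (rule tendstoI)
  fix e :: real assume "e > 0"
  then have "\<forall>\<^sub>F n in sequentially. \<forall>y\<in>\<J> n. \<forall>\<xi>\<in>cell y. \<bar>\<phi> y - \<psi> \<xi>\<bar> < e / 2"
    using assms(1) unfolding boundary_value_iff by (meson half_gt_zero)
  then show "\<forall>\<^sub>F n in sequentially. dist (\<Sum>y\<in>\<J> n. weight y * \<phi> y) (\<integral>\<xi>. \<psi> \<xi> \<partial>nu K) < e"
  proof eventually_elim
    case (elim n)
    then have "\<bar>(\<Sum>y\<in>\<J> n. weight y * \<phi> y) - (\<integral>\<xi>. \<psi> \<xi> \<partial>nu K)\<bar> \<le> e / 2"
      by (intro riemann_sum_bound[OF assms(2)]) (auto intro: less_imp_le)
    then show ?case using \<open>e > 0\<close> by (simp add: dist_real_def)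
  qed
qed

end

context natural_random_walk
begin

abbreviation "X_upto \<equiv> Xn N \<rho>"

lemma X_upto_iff: "x \<in> X_upto n \<longleftrightarrow> (\<exists>k\<le>n. x \<in> \<J> k)"
  by (auto simp: Xn_def)

lemma finite_X_upto: "finite (X_upto n)"
  using finite_J by (simp add: Xn_def)

lemma J_X_upto: "x \<in> \<J> k \<Longrightarrow> k \<le> n \<Longrightarrow> x \<in> X_upto n"
  by (auto simp: X_upto_iff)

lemma X_upto_X: "x \<in> X_upto n \<Longrightarrow> x \<in> X"
  by (auto simp: X_upto_iff J_X)

lemma incseq_X_upto: "incseq X_upto"
  by (rule monoI) (force simp: Xn_def)

lemma neighbours_X_upto:
  assumes "x \<in> \<J> k" "k < n"
  shows "neighbours x \<subseteq> X_upto n"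
proof
  fix y assume "y \<in> neighbours x"
  with assms(1) show "y \<in> X_upto n"
    by (cases rule: neighbour_cases) (use assms(2) in \<open>auto intro: J_X_upto\<close>)
qed

lemma neighbours_J_minus_X_upto:
  assumes x: "x \<in> \<J> n"
  shows "neighbours x - X_upto n = children x"
proof (intro equalityI subsetI)
  fix y assume y: "y \<in> neighbours x - X_upto n"
  then have "y \<in> neighbours x" by simp
  with x show "y \<in> children x"
    by (cases rule: neighbour_cases) (use y in \<open>auto intro: J_X_upto\<close>)
next
  fix y assume "y \<in> children x"
  then show "y \<in> neighbours x - X_upto n"
    using neighbours_eq[OF x] children_iff[OF x] J_level_unique by (fastforce simp: X_upto_iff)
qed

definition flux :: "(nat list \<Rightarrow> real) \<Rightarrow> (nat list \<Rightarrow> real) \<Rightarrow> nat \<Rightarrow> real" where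
  "flux f g n = (\<Sum>z\<in>\<J> (Suc n). weight z * (1 / lam) ^ Suc n * (f (parent z) * g z - g (parent z) * f z))"

lemma sum_green_identity_X_upto:
  "(\<Sum>x\<in>X_upto n. f x * laplacian g x - g x * laplacian f x) = flux f g n"
proof -
  let ?F = "\<lambda>x y. c x y * (f x * g y - g x * f y)"
  have "(\<Sum>x\<in>X_upto n. f x * laplacian g x - g x * laplacian f x)
      = (\<Sum>x\<in>X_upto n. \<Sum>y\<in>neighbours x - X_upto n. ?F x y)"
    by (rule green_identity[OF finite_X_upto])
  also have "\<dots> = (\<Sum>x\<in>\<J> n. \<Sum>y\<in>neighbours x - X_upto n. ?F x y)"
  proof (rule sum.mono_neutral_right[OF finite_X_upto])
    show "\<J> n \<subseteq> X_upto n" using J_X_upto by blast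
    show "\<forall>x\<in>X_upto n - \<J> n. (\<Sum>y\<in>neighbours x - X_upto n. ?F x y) = 0"
    proof
      fix x assume "x \<in> X_upto n - \<J> n"
      then obtain k where "x \<in> \<J> k" "k < n" by (auto simp: X_upto_iff le_less)
      then show "(\<Sum>y\<in>neighbours x - X_upto n. ?F x y) = 0"
        using neighbours_X_upto by (intro sum.neutral) blast
    qed
  qed
  also have "\<dots> = (\<Sum>x\<in>\<J> n. \<Sum>z\<in>children x. weight z * (1 / lam) ^ Suc n * (f (parent z) * g z - g (parent z) * f z))"
  proof (rule sum.cong[OF refl])
    fix x assume x: "x \<in> \<J> n"
    show "(\<Sum>y\<in>neighbours x - X_upto n. ?F x y)
        = (\<Sum>z\<in>children x. weight z * (1 / lam) ^ Suc n * (f (parent z) * g z - g (parent z) * f z))"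
      unfolding neighbours_J_minus_X_upto[OF x] using c_child(1)[OF x] children_iff[OF x]
      by (intro sum.cong refl) simp
  qed
  finally show ?thesis unfolding flux_def sum_J_Suc .
qed

lemma flux_superharmonic_le:
  assumes x: "x \<in> X_upto n" and super: "\<And>y. y \<in> X \<Longrightarrow> laplacian f y \<le> 0"
  shows "flux (\<lambda>y. green_fn y x) f n \<le> conductance x * f x"
proof -
  have "flux (\<lambda>y. green_fn y x) f n
      = (\<Sum>y\<in>X_upto n. green_fn y x * laplacian f y - f y * laplacian (\<lambda>y. green_fn y x) y)"
    by (rule sum_green_identity_X_upto[symmetric])
  also have "\<dots> \<le> (\<Sum>y\<in>X_upto n. if y = x then conductance x * f x else 0)"
  proof (rule sum_mono)
    fix y assume "y \<in> X_upto n"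
    then have "green_fn y x * laplacian f y \<le> 0"
      using super X_upto_X green_fn_nonneg by (intro mult_nonneg_nonpos) auto
    then show "green_fn y x * laplacian f y - f y * laplacian (\<lambda>y. green_fn y x) y
        \<le> (if y = x then conductance x * f x else 0)"
      by (auto simp: laplacian_green_fn mult.commute[of "f x"])
  qed
  also have "\<dots> = conductance x * f x" using x finite_X_upto by simp
  finally show ?thesis .
qed

abbreviation "H \<equiv> Hext N S \<rho> K \<gamma> lam"

lemma boundary_value_martin_ratio:
  assumes "x \<in> X"
  shows "boundary_value (martin_ratio x) (martin_kernel x)"
  unfolding boundary_value_iff
proof (intro allI impI)
  fix e :: real assume "e > 0"
  then obtain m where m: "\<forall>\<xi>\<in>K. \<forall>y\<in>nbhd m \<xi>. \<bar>martin_ratio x y - martin_kernel x \<xi>\<bar> \<le> e / 2"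
    using martin_ratio_approx[OF assms, of "e / 2"] by auto
  have "\<bar>martin_ratio x y - martin_kernel x \<xi>\<bar> < e" if "n \<ge> m" "y \<in> \<J> n" "\<xi> \<in> cell y" for n y \<xi>
  proof -
    have "\<xi> \<in> K" "y \<in> nbhd m \<xi>"
      using cell_subset_K[OF J_words] cell_in_nbhd[OF that(2,1,3), of \<xi>] that r_bounds by auto
    then show ?thesis using m \<open>e > 0\<close> by fastforce
  qed
  then show "\<forall>\<^sub>F n in sequentially. \<forall>y\<in>\<J> n. \<forall>\<xi>\<in>cell y. \<bar>martin_ratio x y - martin_kernel x \<xi>\<bar> < e"
    unfolding eventually_sequentially by blast
qed

lemma boundary_value_parent:
  assumes "boundary_value f u"
  shows "boundary_value (\<lambda>y. f (parent y)) u"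
  unfolding boundary_value_iff
proof (intro allI impI)
  fix e :: real assume "e > 0"
  with assms have "\<forall>\<^sub>F n in sequentially. \<forall>y\<in>\<J> n. \<forall>\<xi>\<in>cell y. \<bar>f y - u \<xi>\<bar> < e"
    unfolding boundary_value_iff by blast
  then have "\<forall>\<^sub>F n in sequentially. \<forall>y\<in>\<J> (Suc n). \<forall>\<xi>\<in>cell y. \<bar>f (parent y) - u \<xi>\<bar> < e"
  proof eventually_elim
    case (elim n)
    show ?case
    proof (intro ballI)
      fix y \<xi> assume y: "y \<in> \<J> (Suc n)" "\<xi> \<in> cell y"
      then have "\<xi> \<in> cell (parent y)"
        using cell_prefix_subset[OF J_words[OF y(1)] prefix_parent[OF y(1)]] by blast
      then show "\<bar>f (parent y) - u \<xi>\<bar> < e" using elim parent_J[OF y(1)] by blast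
    qed
  qed
  then show "\<forall>\<^sub>F n in sequentially. \<forall>y\<in>\<J> n. \<forall>\<xi>\<in>cell y. \<bar>f (parent y) - u \<xi>\<bar> < e"
    by (subst (asm) eventually_sequentially_Suc)
qed

lemma integrable_martin_kernel_mult:
  assumes "x \<in> X" "u \<in> borel_measurable borel" "continuous_on K u"
  shows "integrable (nu K) (\<lambda>\<xi>. martin_kernel x \<xi> * u \<xi>)"
  using assms borel_measurable_martin_kernel[OF assms(1)] continuous_on_martin_kernel[OF assms(1)]
  by (intro integrable_nu_continuous borel_measurable_times continuous_intros)

definition "flux_density x f z =
  (1 / lam) * (martin_ratio x (parent z) * f z) + - (f (parent z) * martin_ratio x z)"

lemma flux_green_eq:
  assumes x: "x \<in> X"
  shows "flux (\<lambda>y. green_fn y x) f n =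
    lam * conductance x / (1 - lam) * (\<Sum>z\<in>\<J> (Suc n). weight z * flux_density x f z)"
proof -
  define k where "k = lam * conductance x / (1 - lam)"
  have "weight z * (1 / lam) ^ Suc n * (green_fn (parent z) x * f z - f (parent z) * green_fn z x)
      = k * (weight z * flux_density x f z)" if z: "z \<in> \<J> (Suc n)" for z
  proof -
    have green_eq: "green_fn y x = lam ^ depth y * (k * martin_ratio x y)" if "y \<in> X" for y
      using green_fn_eq_martin_ratio[OF x that] by (simp add: k_def)
    have green: "green_fn z x = lam ^ Suc n * (k * martin_ratio x z)"
      "green_fn (parent z) x = lam ^ n * (k * martin_ratio x (parent z))"
      using green_eq[OF J_X] z parent_J[OF z] lev_eq by metis+
    show ?thesis unfolding green flux_density_def using lam_pos by (simp add: field_simps)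
  qed
  then show ?thesis unfolding flux_def sum_distrib_left k_def by (rule sum.cong[OF refl])
qed

lemma flux_green_tendsto:
  assumes x: "x \<in> X" and u: "u \<in> borel_measurable borel" "continuous_on K u" and f: "boundary_value f u"
  shows "(\<lambda>n. flux (\<lambda>y. green_fn y x) f n) \<longlonglongrightarrow> conductance x * H u x"
proof -
  let ?k = "lam * conductance x / (1 - lam)"
  let ?\<phi> = "\<lambda>\<xi>. (1 / lam) * (martin_kernel x \<xi> * u \<xi>) + - (u \<xi> * martin_kernel x \<xi>)"
  have "bounded (martin_kernel x ` K)" "bounded (u ` K)"
    using bounded_image_K continuous_on_martin_kernel[OF x] u(2) by auto
  then have "boundary_value (flux_density x f) ?\<phi>"
    unfolding flux_density_def[abs_def]
    by (intro boundary_value_add boundary_value_scale boundary_value_uminus boundary_value_mult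
        boundary_value_parent boundary_value_martin_ratio x f)
  moreover have "?\<phi> = (\<lambda>\<xi>. (1 / lam - 1) * (martin_kernel x \<xi> * u \<xi>))"
    by (simp add: fun_eq_iff left_diff_distrib)
  ultimately have "boundary_value (flux_density x f) (\<lambda>\<xi>. (1 / lam - 1) * (martin_kernel x \<xi> * u \<xi>))"
    by simp
  then have "(\<lambda>n. \<Sum>z\<in>\<J> n. weight z * flux_density x f z) \<longlonglongrightarrow> (1 / lam - 1) * H u x"
    using riemann_sum_tendsto integrable_martin_kernel_mult[OF x u] by (fastforce simp: Hext_def)
  then have "(\<lambda>n. flux (\<lambda>y. green_fn y x) f n) \<longlonglongrightarrow> ?k * ((1 / lam - 1) * H u x)"
    unfolding flux_green_eq[OF x] by (intro tendsto_intros LIMSEQ_Suc)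
  moreover have "?k * ((1 / lam - 1) * H u x) = conductance x * H u x"
    using lam_pos lam_bounds by (simp add: field_simps)
  ultimately show ?thesis by (simp only:)
qed

theorem H_le_superharmonic:
  assumes x: "x \<in> X" and u: "u \<in> borel_measurable borel" "continuous_on K u" and f: "boundary_value f u"
    and super: "\<And>y. y \<in> X \<Longrightarrow> laplacian f y \<le> 0"
  shows "H u x \<le> f x"
proof -
  have "conductance x * H u x \<le> conductance x * f x"
    using flux_superharmonic_le[OF J_X_upto[OF X_J[OF x]] super]
    by (intro LIMSEQ_le_const2[OF flux_green_tendsto[OF x u f]]) blast
  then show ?thesis using conductance_pos[OF x] by simp
qed

theorem H_eq_harmonic:
  assumes x: "x \<in> X" and u: "u \<in> borel_measurable borel" "continuous_on K u" and f: "boundary_value f u"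
    and harmonic: "\<And>y. y \<in> X \<Longrightarrow> laplacian f y = 0"
  shows "H u x = f x"
proof (rule antisym)
  show "H u x \<le> f x" using harmonic by (intro H_le_superharmonic x u f) simp
  have "H (\<lambda>\<xi>. - u \<xi>) x \<le> - f x"
    using u harmonic
    by (intro H_le_superharmonic x boundary_value_uminus f)
      (auto simp: diff_operator_uminus intro!: continuous_intros)
  then show "f x \<le> H u x" by (simp add: Hext_def)
qed

lemma H_one: "x \<in> X \<Longrightarrow> H (\<lambda>_. 1) x = 1"
  by (rule H_eq_harmonic[where f = "\<lambda>_. 1"]) auto

definition "barrier_ratio = (1 + max r lam) / 2"

definition "walk_barrier_coeff = dist_growth 1 (1 / lam) / (r\<^sub>\<alpha> * - drift 1 (1 / lam) barrier_ratio 1)"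

lemma barrier_ratio_bounds: "r < barrier_ratio" "lam < barrier_ratio" "0 < barrier_ratio" "barrier_ratio < 1"
  using r_bounds lam_bounds lam_pos by (auto simp: barrier_ratio_def max_def)

lemma walk_barrier_coeff_nonneg: "0 \<le> walk_barrier_coeff"
  unfolding walk_barrier_coeff_def
  using drift_walk_neg[of barrier_ratio 1] barrier_ratio_bounds r_alpha_bounds lam_pos
  by (intro divide_nonneg_pos dist_growth_nonneg mult_pos_pos) auto

lemma laplacian_walk_barrier_le:
  assumes "y \<in> X"
  shows "laplacian (\<lambda>y. dist (base_point y) q + walk_barrier_coeff * barrier_ratio ^ depth y) y \<le> 0"
proof -
  let ?drift = "drift 1 (1 / lam) barrier_ratio"
  have drift: "?drift n \<le> ?drift 1" for n
    using barrier_ratio_bounds lam_pos by (auto simp: drift_def field_simps)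
  have "walk_barrier_coeff * ?drift n \<le> walk_barrier_coeff * ?drift 1" for n
    using walk_barrier_coeff_nonneg drift by (intro mult_left_mono) auto
  also have "walk_barrier_coeff * ?drift 1 = - (dist_growth 1 (1 / lam) / r\<^sub>\<alpha>)"
    using drift_walk_neg[of barrier_ratio 1] barrier_ratio_bounds by (simp add: walk_barrier_coeff_def)
  finally have "scaled_laplacian 1 (1 / lam)
      (\<lambda>y. dist (base_point y) q + walk_barrier_coeff * barrier_ratio ^ depth y) y \<le> 0"
    using barrier_ratio_bounds lam_pos by (intro scaled_laplacian_barrier[OF X_J[OF assms]]) auto
  then show ?thesis
    unfolding laplacian_eq_scaled[OF X_J[OF assms]] using lam_pos by (intro mult_nonneg_nonpos) auto
qed

definition "dist_error n = diameter K * r ^ n + walk_barrier_coeff * barrier_ratio ^ n"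

lemma dist_error_tendsto_0: "dist_error \<longlonglongrightarrow> 0"
proof -
  have "(\<lambda>n. diameter K * r ^ n + walk_barrier_coeff * barrier_ratio ^ n)
      \<longlonglongrightarrow> diameter K * 0 + walk_barrier_coeff * 0"
    using r_bounds barrier_ratio_bounds by (intro tendsto_intros LIMSEQ_power_zero) auto
  then show ?thesis by (simp add: dist_error_def[abs_def])
qed

lemma H_dist_le:
  assumes y: "y \<in> \<J> n" "\<xi> \<in> cell y"
  shows "H (\<lambda>\<eta>. dist \<eta> \<xi>) y \<le> dist_error n"
proof -
  let ?f = "\<lambda>y. dist (base_point y) \<xi> + walk_barrier_coeff * barrier_ratio ^ depth y"
  have "H (\<lambda>\<eta>. dist \<eta> \<xi>) y \<le> ?f y"
  proof (rule H_le_superharmonic[OF J_X[OF y(1)]])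
    show "boundary_value ?f (\<lambda>\<eta>. dist \<eta> \<xi>)"
      unfolding boundary_value_iff
    proof (intro allI impI)
      fix e :: real assume "e > 0"
      then have "\<forall>\<^sub>F n in sequentially. dist_error n < e"
        using dist_error_tendsto_0 by (intro order_tendstoD)
      then show "\<forall>\<^sub>F n in sequentially. \<forall>y\<in>\<J> n. \<forall>\<eta>\<in>cell y. \<bar>?f y - dist \<eta> \<xi>\<bar> < e"
      proof eventually_elim
        case (elim n)
        show ?case
        proof (intro ballI)
          fix y \<eta> assume z: "y \<in> \<J> n" "\<eta> \<in> cell y"
          have "\<bar>dist (base_point y) \<xi> - dist \<eta> \<xi>\<bar> \<le> diameter K * r ^ n"
            using dist_base_point[OF z] by metric
          moreover have "0 \<le> walk_barrier_coeff * barrier_ratio ^ n"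
            using walk_barrier_coeff_nonneg barrier_ratio_bounds by simp
          ultimately show "\<bar>?f y - dist \<eta> \<xi>\<bar> < e"
            using elim unfolding dist_error_def lev_eq[OF z(1)] by linarith
        qed
      qed
    qed
  qed (auto intro!: continuous_intros laplacian_walk_barrier_le)
  also have "\<dots> \<le> dist_error n" using dist_base_point[OF y] lev_eq[OF y(1)] by (simp add: dist_error_def)
  finally show ?thesis .
qed

lemma H_diff_le:
  assumes y: "y \<in> X" and u: "u \<in> borel_measurable borel" "continuous_on K u"
    and modulus: "\<And>\<eta>. \<eta> \<in> K \<Longrightarrow> \<bar>u \<eta> - k\<bar> \<le> e + C * dist \<eta> \<xi>"
  shows "\<bar>H u y - k\<bar> \<le> e + C * H (\<lambda>\<eta>. dist \<eta> \<xi>) y"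
proof -
  let ?m = "martin_kernel y"
  have dist: "(\<lambda>\<eta>. dist \<eta> \<xi>) \<in> borel_measurable borel" "continuous_on K (\<lambda>\<eta>. dist \<eta> \<xi>)"
    by (auto intro!: continuous_intros)
  note integrable = integrable_martin_kernel_mult[OF y]
  have int_1: "integrable (nu K) ?m" "(\<integral>\<eta>. ?m \<eta> \<partial>nu K) = 1"
    using integrable[of "\<lambda>_. 1"] H_one[OF y] by (simp_all add: Hext_def)
  have "H u y - k = (\<integral>\<eta>. ?m \<eta> * u \<eta> - ?m \<eta> * k \<partial>nu K)"
    using integrable[OF u] int_1 by (simp add: Hext_def)
  also have "\<bar>\<dots>\<bar> \<le> (\<integral>\<eta>. \<bar>?m \<eta> * u \<eta> - ?m \<eta> * k\<bar> \<partial>nu K)"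
    using integral_norm_bound[of "nu K" "\<lambda>\<eta>. ?m \<eta> * u \<eta> - ?m \<eta> * k"] by simp
  also have "\<dots> \<le> (\<integral>\<eta>. ?m \<eta> * e + C * (?m \<eta> * dist \<eta> \<xi>) \<partial>nu K)"
  proof (rule integral_mono_AE)
    show "AE \<eta> in nu K. \<bar>?m \<eta> * u \<eta> - ?m \<eta> * k\<bar> \<le> ?m \<eta> * e + C * (?m \<eta> * dist \<eta> \<xi>)"
      using AE_nu_K
    proof eventually_elim
      case (elim \<eta>)
      have "?m \<eta> * \<bar>u \<eta> - k\<bar> \<le> ?m \<eta> * (e + C * dist \<eta> \<xi>)"
        using modulus[OF elim] martin_kernel_nonneg[OF y elim] by (rule mult_left_mono)
      moreover have "\<bar>?m \<eta> * u \<eta> - ?m \<eta> * k\<bar> = ?m \<eta> * \<bar>u \<eta> - k\<bar>"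
        using martin_kernel_nonneg[OF y elim] by (simp add: abs_mult flip: right_diff_distrib)
      ultimately show ?case by (simp add: distrib_left mult.left_commute)
    qed
  qed (use integrable[OF u] integrable[OF dist] int_1 in auto)
  also have "\<dots> = e + C * H (\<lambda>\<eta>. dist \<eta> \<xi>) y"
    using integrable[OF dist] int_1 by (simp add: Hext_def)
  finally show ?thesis .
qed

lemma continuous_on_K_modulus:
  fixes u :: "'a \<Rightarrow> real"
  assumes u: "continuous_on K u" and e: "e > 0"
  obtains C where "C > 0" "\<And>\<xi> \<eta>. \<xi> \<in> K \<Longrightarrow> \<eta> \<in> K \<Longrightarrow> \<bar>u \<eta> - u \<xi>\<bar> \<le> e + C * dist \<eta> \<xi>"
proof -
  obtain B where B: "B > 0" "\<And>\<xi>. \<xi> \<in> K \<Longrightarrow> \<bar>u \<xi>\<bar> \<le> B" using continuous_on_K_bounded[OF u] by blast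
  obtain d where d: "d > 0" "\<And>\<xi> \<eta>. \<xi> \<in> K \<Longrightarrow> \<eta> \<in> K \<Longrightarrow> dist \<eta> \<xi> < d \<Longrightarrow> \<bar>u \<eta> - u \<xi>\<bar> < e"
    using compact_uniformly_continuous[OF u K_compact] e
    unfolding uniformly_continuous_on_def dist_real_def by metis
  have "\<bar>u \<eta> - u \<xi>\<bar> \<le> e + 2 * B / d * dist \<eta> \<xi>" if \<xi>\<eta>: "\<xi> \<in> K" "\<eta> \<in> K" for \<xi> \<eta>
  proof (cases "dist \<eta> \<xi> < d")
    case True
    moreover have "0 \<le> 2 * B / d * dist \<eta> \<xi>" using B(1) d(1) by simp
    ultimately show ?thesis using d(2)[OF \<xi>\<eta>] by linarith
  next
    case False
    have "\<bar>u \<eta> - u \<xi>\<bar> \<le> 2 * B" using B(2)[OF \<xi>\<eta>(1)] B(2)[OF \<xi>\<eta>(2)] by linarith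
    also have "\<dots> \<le> 2 * B / d * dist \<eta> \<xi>" using False B(1) d(1) by (simp add: field_simps)
    finally show ?thesis using e by linarith
  qed
  then show thesis using that B(1) d(1) by (metis divide_pos_pos mult_pos_pos zero_less_numeral)
qed

theorem boundary_value_H:
  assumes u: "u \<in> borel_measurable borel" "continuous_on K u"
  shows "boundary_value (H u) u"
  unfolding boundary_value_iff
proof (intro allI impI)
  fix e :: real assume "e > 0"
  then obtain C where C: "C > 0" "\<And>\<xi> \<eta>. \<xi> \<in> K \<Longrightarrow> \<eta> \<in> K \<Longrightarrow> \<bar>u \<eta> - u \<xi>\<bar> \<le> e / 2 + C * dist \<eta> \<xi>"
    using continuous_on_K_modulus[OF u(2), of "e / 2"] by auto
  have "\<forall>\<^sub>F n in sequentially. dist_error n < e / (2 * C)"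
    using dist_error_tendsto_0 \<open>e > 0\<close> C(1) by (intro order_tendstoD) auto
  then show "\<forall>\<^sub>F n in sequentially. \<forall>y\<in>\<J> n. \<forall>\<xi>\<in>cell y. \<bar>H u y - u \<xi>\<bar> < e"
  proof eventually_elim
    case (elim n)
    show ?case
    proof (intro ballI)
      fix y \<xi> assume y: "y \<in> \<J> n" "\<xi> \<in> cell y"
      then have "\<xi> \<in> K" using cell_subset_K[OF J_words] by blast
      then have "\<bar>H u y - u \<xi>\<bar> \<le> e / 2 + C * H (\<lambda>\<eta>. dist \<eta> \<xi>) y"
        using C(2) by (intro H_diff_le u J_X[OF y(1)])
      also have "\<dots> \<le> e / 2 + C * dist_error n"
        using H_dist_le[OF y] C(1) by simp
      also have "\<dots> < e" using elim C(1) by (simp add: field_simps)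
      finally show "\<bar>H u y - u \<xi>\<bar> < e" .
    qed
  qed
qed

end

section \<open>Energy and boundary traces\<close>

context natural_random_walk
begin

abbreviation "energy_upto n \<equiv> energy_on (X_upto n)"

lemma energyXn_eq: "energyXn N S \<rho> K \<gamma> lam n f = energy_upto n f"
  by (simp add: energyXn_def energy_on_def)

abbreviation "boundary_energy \<equiv> EK N S \<rho> K \<gamma> lam"

abbreviation "boundary_domain \<equiv> DK N S \<rho> K \<gamma> lam"

lemma boundary_energy_eq: "boundary_energy u = energy (H u)"
  by (simp add: EK_def energyX_def energy_def)

lemma energy_eq_SUP_upto: "energy f = (SUP n. ennreal (energy_upto n f))"
proof (rule energy_eq_SUP[OF incseq_X_upto finite_X_upto])
  fix x y assume "c x y \<noteq> 0"
  then have "x \<in> X" using c_eq_0_outside by blast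
  then show "\<exists>n. x \<in> X_upto n" using X_J J_X_upto by blast
qed

lemma energy_upto_mono: "m \<le> n \<Longrightarrow> energy_upto m f \<le> energy_upto n f"
  using incseq_X_upto by (intro energy_on_mono finite_X_upto) (auto simp: incseq_def)

lemma energy_le_iff: "0 \<le> M \<Longrightarrow> energy f \<le> ennreal M \<longleftrightarrow> (\<forall>n. energy_upto n f \<le> M)"
  unfolding energy_eq_SUP_upto SUP_le_iff by auto

lemma energy_le_ennreal_iff: "energy f \<le> ennreal M \<and> 0 \<le> M \<longleftrightarrow> (\<forall>n. energy_upto n f \<le> M)"
  using energy_le_iff energy_on_nonneg order_trans by blast

lemma finite_energy_cases:
  assumes "energy f < top"
  obtains M where "energy f = ennreal M" "\<And>n. energy_upto n f \<le> M"
proof -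
  obtain M where M: "0 \<le> M" "energy f = ennreal M" using assms by (cases "energy f") auto
  then show thesis using that energy_le_iff[of M f] by simp
qed

lemma energy_cong: "(\<And>x. x \<in> X \<Longrightarrow> f x = g x) \<Longrightarrow> energy f = energy g"
  unfolding energy_eq_SUP_upto using energy_on_cong X_upto_X by (metis (no_types, lifting))

definition "decay_rate = sqrt (lam / r\<^sub>\<alpha>)"

definition "variation_bound M = sqrt (M / r\<^sub>\<alpha>) / (1 - decay_rate)"

lemma decay_rate_bounds: "0 < decay_rate" "decay_rate < 1"
  using lam_pos lam_bounds r_alpha_bounds by (auto simp: decay_rate_def)

lemma variation_bound: "0 \<le> M \<Longrightarrow> 0 \<le> sqrt (M / r\<^sub>\<alpha>)" "0 \<le> M \<Longrightarrow> sqrt (M / r\<^sub>\<alpha>) \<le> variation_bound M"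
proof -
  assume "0 \<le> M"
  then show nonneg: "0 \<le> sqrt (M / r\<^sub>\<alpha>)" using r_alpha_bounds by simp
  have "sqrt (M / r\<^sub>\<alpha>) * (1 - decay_rate) \<le> sqrt (M / r\<^sub>\<alpha>)"
    using nonneg decay_rate_bounds by (intro mult_left_le) auto
  then show "sqrt (M / r\<^sub>\<alpha>) \<le> variation_bound M"
    using decay_rate_bounds by (simp add: variation_bound_def pos_le_divide_eq)
qed

lemma edge_conductance_ge:
  assumes x: "x \<in> \<J> k" and y: "y \<in> neighbours x" "y \<notin> children x"
  shows "r\<^sub>\<alpha> * (r\<^sub>\<alpha> / lam) ^ k \<le> c x y"
  using x y(1)
proof (cases rule: neighbour_cases)
  case (parent m)
  then have xm: "x \<in> \<J> (Suc m)" using x by simp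
  have "r\<^sub>\<alpha> * (r\<^sub>\<alpha> / lam) ^ k = r\<^sub>\<alpha> ^ Suc k * (1 / lam) ^ k" by (simp add: power_divide)
  also have "\<dots> \<le> weight x * (1 / lam) ^ k" using weight_ge[OF x] lam_pos by (intro mult_right_mono) auto
  finally show ?thesis using c_parent[OF xm] parent by simp
next
  case child
  then show ?thesis using y(2) by simp
next
  case horizontal
  have "r\<^sub>\<alpha> * (r\<^sub>\<alpha> / lam) ^ k \<le> 1 * (r\<^sub>\<alpha> / lam) ^ k"
    using r_alpha_bounds lam_pos by (intro mult_right_mono) auto
  then show ?thesis using c_horizontal[OF x] horizontal by (simp add: power_divide)
qed

lemma edge_increment_le:
  assumes M: "energy_upto n f \<le> M" and x: "x \<in> \<J> k" "k \<le> n" and y: "y \<in> neighbours x" "y \<notin> children x"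
  shows "\<bar>f x - f y\<bar> \<le> sqrt (M / r\<^sub>\<alpha>) * decay_rate ^ k"
proof -
  have "y \<in> X_upto n"
    using x(1) y(1) by (cases rule: neighbour_cases) (use x(2) y(2) in \<open>auto intro: J_X_upto\<close>)
  have "r\<^sub>\<alpha> * (r\<^sub>\<alpha> / lam) ^ k * (f x - f y)\<^sup>2 \<le> c x y * (f x - f y)\<^sup>2"
    using edge_conductance_ge[OF x(1) y] by (rule mult_right_mono) simp
  also have "\<dots> \<le> M"
    using edge_le_energy_on[OF finite_X_upto J_X_upto[OF x] \<open>y \<in> X_upto n\<close>] M by (rule order_trans)
  finally have "(f x - f y)\<^sup>2 \<le> M / r\<^sub>\<alpha> * (lam / r\<^sub>\<alpha>) ^ k"
    using r_alpha_bounds lam_pos by (simp add: power_divide field_simps)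
  then have "\<bar>f x - f y\<bar> \<le> sqrt (M / r\<^sub>\<alpha> * (lam / r\<^sub>\<alpha>) ^ k)" using real_sqrt_le_mono by fastforce
  then show ?thesis unfolding real_sqrt_mult real_sqrt_power decay_rate_def .
qed

lemma parent_increment_le:
  assumes "energy_upto n f \<le> M" "x \<in> \<J> (Suc k)" "Suc k \<le> n"
  shows "\<bar>f (parent x) - f x\<bar> \<le> sqrt (M / r\<^sub>\<alpha>) * decay_rate ^ Suc k"
proof -
  have "parent x \<notin> children x"
    using parent_J[OF assms(2)] children_iff[OF assms(2)] J_level_unique by fastforce
  then have "\<bar>f x - f (parent x)\<bar> \<le> sqrt (M / r\<^sub>\<alpha>) * decay_rate ^ Suc k"
    using assms neighbours_eq[OF assms(2)] by (intro edge_increment_le) auto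
  then show ?thesis by (simp add: abs_minus_commute)
qed

lemma prefix_increment_le:
  assumes M: "energy_upto m f \<le> M" and z: "z \<in> \<J> n" "n \<le> m" and y: "y \<in> \<J> k" "prefix y z" "k \<le> n"
  shows "\<bar>f y - f z\<bar> \<le> variation_bound M * decay_rate ^ k"
proof -
  have "0 \<le> M" using energy_on_nonneg M order_trans by blast
  note bound = variation_bound[OF this]
  have "\<bar>f y - f z\<bar> \<le> variation_bound M * (decay_rate ^ k - decay_rate ^ n)"
    using y(3) z y(2)
  proof (induction n arbitrary: z rule: dec_induct)
    case base
    then have "y = z" using J_prefix_eq y(1) by blast
    then show ?case by simp
  next
    case (step n)
    have pz: "parent z \<in> \<J> n" "prefix (parent z) z" using parent[OF step(4)] .
    have "prefix y (parent z)" by (rule J_prefix_mono[OF y(1) pz(1) step(1,6) pz(2)])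
    then have "\<bar>f y - f (parent z)\<bar> \<le> variation_bound M * (decay_rate ^ k - decay_rate ^ n)"
      using step.IH[OF pz(1)] step(5) by simp
    moreover have "\<bar>f (parent z) - f z\<bar> \<le> sqrt (M / r\<^sub>\<alpha>) * decay_rate ^ n"
    proof -
      have "\<bar>f (parent z) - f z\<bar> \<le> sqrt (M / r\<^sub>\<alpha>) * decay_rate ^ Suc n"
        by (rule parent_increment_le[OF M step(4,5)])
      also have "\<dots> \<le> sqrt (M / r\<^sub>\<alpha>) * decay_rate ^ n"
        using bound(1) decay_rate_bounds by (intro mult_left_mono) (auto simp: mult_left_le_one_le)
      finally show ?thesis .
    qed
    moreover have "sqrt (M / r\<^sub>\<alpha>) * decay_rate ^ n
        = variation_bound M * (decay_rate ^ n - decay_rate ^ Suc n)"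
      using decay_rate_bounds by (simp add: variation_bound_def field_simps)
    ultimately show ?case by (simp add: algebra_simps)
  qed
  also have "\<dots> \<le> variation_bound M * decay_rate ^ k"
    using bound decay_rate_bounds by (intro mult_left_mono order_trans[OF bound]) auto
  finally show ?thesis .
qed

lemma nearby_increment_le:
  assumes M: "energy_upto n f \<le> M" and y: "y \<in> \<J> n" "\<xi> \<in> cell y" and z: "z \<in> \<J> n" "\<eta> \<in> cell z"
    and near: "dist \<xi> \<eta> \<le> \<gamma> * r ^ n"
  shows "\<bar>f y - f z\<bar> \<le> variation_bound M * decay_rate ^ n"
proof -
  have "0 \<le> M" using energy_on_nonneg M order_trans by blast
  note bound = variation_bound[OF this]
  have "\<bar>f y - f z\<bar> \<le> sqrt (M / r\<^sub>\<alpha>) * decay_rate ^ n"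
  proof (cases "y = z")
    case True
    then show ?thesis using bound(1) decay_rate_bounds by simp
  next
    case False
    have "gap S K y z \<le> \<gamma> * r ^ n" using gap_le[OF y(2) z(2)] near by linarith
    then have "z \<in> horizontal y" using horizontal_iff[OF y(1)] z(1) False by auto
    moreover from this have "z \<notin> children y" using children_iff[OF y(1)] J_level_unique[OF z(1), of "Suc n"] by auto
    ultimately show ?thesis
      using neighbours_eq[OF y(1)] by (intro edge_increment_le[OF M y(1)]) auto
  qed
  also have "\<dots> \<le> variation_bound M * decay_rate ^ n"
    using bound(2) decay_rate_bounds by (intro mult_right_mono) auto
  finally show ?thesis .
qed

definition "boundary_trace f \<xi> = (if \<xi> \<in> K then lim (\<lambda>n. f (ray \<xi> n)) else 0)" for f :: "nat list \<Rightarrow> real"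

lemma eventually_mult_decay_less: "e > 0 \<Longrightarrow> \<forall>\<^sub>F n in sequentially. C * decay_rate ^ n < e"
  using decay_rate_bounds by (intro eventually_mult_power_less) auto

lemma boundary_trace_approx:
  assumes f: "\<And>n. energy_upto n f \<le> M" and y: "y \<in> \<J> n" "\<xi> \<in> cell y"
  shows "\<bar>f y - boundary_trace f \<xi>\<bar> \<le> 2 * variation_bound M * decay_rate ^ n"
proof -
  have \<xi>: "\<xi> \<in> K" using cell_subset_K[OF J_words[OF y(1)]] y(2) by blast
  have step: "\<bar>f (ray \<xi> k) - f (ray \<xi> l)\<bar> \<le> variation_bound M * decay_rate ^ k" if "k \<le> l" for k l
    using geo_ray_prefix[OF geo_ray_ray[OF \<xi>] that] that
    by (intro prefix_increment_le[OF f ray_J[OF \<xi>] order_refl ray_J[OF \<xi>]])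
  have "Cauchy (\<lambda>k. f (ray \<xi> k))"
  proof (rule metric_CauchyI)
    fix e :: real assume "e > 0"
    then obtain m where m: "variation_bound M * decay_rate ^ m < e / 2"
      using eventually_mult_decay_less[of "e / 2"] by (auto simp: eventually_sequentially)
    have "dist (f (ray \<xi> k)) (f (ray \<xi> l)) < e" if "k \<ge> m" "l \<ge> m" for k l
      using step[OF that(1)] step[OF that(2)] m unfolding dist_real_def by linarith
    then show "\<exists>m. \<forall>k\<ge>m. \<forall>l\<ge>m. dist (f (ray \<xi> k)) (f (ray \<xi> l)) < e" by blast
  qed
  then have lim: "(\<lambda>k. f (ray \<xi> k)) \<longlonglongrightarrow> boundary_trace f \<xi>"
    using \<xi> Cauchy_convergent convergent_LIMSEQ_iff by (auto simp: boundary_trace_def)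
  have "\<bar>f (ray \<xi> n) - boundary_trace f \<xi>\<bar> \<le> variation_bound M * decay_rate ^ n"
    by (rule LIMSEQ_le_const2[OF tendsto_rabs[OF tendsto_diff[OF tendsto_const lim]]]) (use step in auto)
  moreover have "\<bar>f y - f (ray \<xi> n)\<bar> \<le> variation_bound M * decay_rate ^ n"
    using gamma_pos r_bounds by (intro nearby_increment_le[OF f y ray_J[OF \<xi>] ray_cell[OF \<xi>]]) simp
  ultimately show ?thesis by linarith
qed

lemma boundary_value_boundary_trace:
  assumes "energy f < top"
  shows "boundary_value f (boundary_trace f)"
  unfolding boundary_value_iff
proof (intro allI impI)
  obtain M where M: "\<And>n. energy_upto n f \<le> M" using finite_energy_cases[OF assms] by blast
  fix e :: real assume "e > 0"
  then have "\<forall>\<^sub>F n in sequentially. 2 * variation_bound M * decay_rate ^ n < e"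
    by (rule eventually_mult_decay_less)
  then show "\<forall>\<^sub>F n in sequentially. \<forall>y\<in>\<J> n. \<forall>\<xi>\<in>cell y. \<bar>f y - boundary_trace f \<xi>\<bar> < e"
    by eventually_elim (use boundary_trace_approx[OF M] le_less_trans in blast)
qed

lemma continuous_on_boundary_trace:
  assumes "energy f < top"
  shows "continuous_on K (boundary_trace f)"
  unfolding continuous_on_iff
proof (intro ballI allI impI)
  obtain M where M: "\<And>n. energy_upto n f \<le> M" using finite_energy_cases[OF assms] by blast
  let ?b = "\<lambda>n. variation_bound M * decay_rate ^ n"
  fix \<xi> and e :: real assume \<xi>: "\<xi> \<in> K" and "e > 0"
  then obtain n where n: "?b n < e / 5"
    using eventually_mult_decay_less[of "e / 5"] by (auto simp: eventually_sequentially)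
  have "dist (boundary_trace f \<eta>) (boundary_trace f \<xi>) < e" if \<eta>: "\<eta> \<in> K" "dist \<eta> \<xi> < \<gamma> * r ^ n" for \<eta>
  proof -
    have "\<bar>f (ray \<eta> n) - f (ray \<xi> n)\<bar> \<le> ?b n"
      using \<eta> by (intro nearby_increment_le[OF M ray_J ray_cell ray_J ray_cell] \<xi>) auto
    then show ?thesis
      using boundary_trace_approx[OF M ray_J ray_cell, OF \<eta>(1) \<eta>(1), of n]
        boundary_trace_approx[OF M ray_J ray_cell, OF \<xi> \<xi>, of n] n
      unfolding dist_real_def by (simp only: mult.assoc)
  qed
  then show "\<exists>d>0. \<forall>\<eta>\<in>K. dist \<eta> \<xi> < d \<longrightarrow> dist (boundary_trace f \<eta>) (boundary_trace f \<xi>) < e"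
    using gamma_pos r_bounds by (intro exI[of _ "\<gamma> * r ^ n"]) auto
qed

lemma borel_measurable_boundary_trace: "energy f < top \<Longrightarrow> boundary_trace f \<in> borel_measurable borel"
  by (rule borel_measurable_extend_continuous_on_K[OF continuous_on_boundary_trace, of f 0])
    (auto simp: boundary_trace_def)

lemma energy_0_imp_const:
  assumes "\<And>n. energy_upto n f \<le> 0" "x \<in> X"
  shows "f x = f []"
  using assms(2)
proof (induction x rule: root_induct)
  case (parent n x)
  then show ?case using parent_increment_le[OF assms(1) parent(1) order_refl] by simp
qed simp

end

section \<open>The limiting resistance of two plates\<close>

lemma pointwise_convergent_subsequence:
  fixes F :: "nat \<Rightarrow> 'v::countable \<Rightarrow> real"
  assumes "\<And>k x. a \<le> F k x \<and> F k x \<le> b"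
  obtains t f where "strict_mono (t :: nat \<Rightarrow> nat)" "\<And>x. (\<lambda>k. F (t k) x) \<longlonglongrightarrow> f x"
proof -
  have "compactin (product_topology (\<lambda>_. euclidean) UNIV) (PiE UNIV (\<lambda>_::'v. {a..b}))"
    by (simp add: compactin_PiE)
  then have "compact (PiE UNIV (\<lambda>_::'v. {a..b}))"
    by (simp add: euclidean_product_topology)
  moreover have "F k \<in> PiE UNIV (\<lambda>_. {a..b})" for k using assms by auto
  ultimately obtain t f where t: "strict_mono (t :: nat \<Rightarrow> nat)" "(F \<circ> t) \<longlonglongrightarrow> f"
    unfolding compact_def by metis
  have "(\<lambda>k. F (t k) x) \<longlonglongrightarrow> f x" for x
    using continuous_on_tendsto_compose[OF continuous_on_product_coordinates[of x] t(2)]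
    by (simp add: o_def)
  then show thesis using that t(1) by blast
qed

lemma eq_0_of_quadratic_nonneg:
  fixes b m :: real
  assumes "m > 0" "\<And>t. 0 \<le> - 2 * t * b + t\<^sup>2 * m"
  shows "b = 0"
proof -
  have "- 2 * (b / m) * b + (b / m)\<^sup>2 * m = - (b\<^sup>2 / m)"
    using assms(1) by (simp add: power2_eq_square field_simps)
  then have "b\<^sup>2 / m \<le> 0" using assms(2)[of "b / m"] by simp
  then show ?thesis using assms(1) by (simp add: divide_le_0_iff)
qed

lemma ex_rescaling_less:
  fixes M e :: real
  assumes "e > 0"
  shows "\<exists>d>0. d < 1 / 2 \<and> (1 / (1 - 2 * d))\<^sup>2 * M < M + e"
proof -
  have "((\<lambda>d. (1 / (1 - 2 * d))\<^sup>2 * M) \<longlongrightarrow> (1 / (1 - 2 * 0))\<^sup>2 * M) (at_right 0)"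
    by (intro tendsto_intros) auto
  then have "\<forall>\<^sub>F d in at_right 0. (1 / (1 - 2 * d))\<^sup>2 * M < M + e"
    using assms by (intro order_tendstoD) auto
  moreover have "\<forall>\<^sub>F d::real in at_right 0. 0 < d \<and> d < 1 / 2"
    by (auto simp: eventually_at_right_field intro!: exI[of _ "1 / 2"])
  ultimately have "\<forall>\<^sub>F d in at_right 0. 0 < d \<and> d < 1 / 2 \<and> (1 / (1 - 2 * d))\<^sup>2 * M < M + e"
    by eventually_elim auto
  then show ?thesis using eventually_happens by (fastforce simp: trivial_limit_at_right_real)
qed

lemma (in natural_random_walk) effres_eq:
  "effres N S \<rho> K \<gamma> lam n E F = (if E \<inter> F \<noteq> {} then 0 else 1 / capacity (X_upto n) E F)"
  by (simp add: effres_def capacity_def separates_def energyXn_eq)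

lemma (in natural_random_walk) plates_of_effres_limit_pos:
  assumes "lim (\<lambda>n. effres N S \<rho> K \<gamma> lam n (\<kappa> n ` \<Phi>) (\<kappa> n ` \<Psi>)) > 0"
  shows "\<Phi> \<noteq> {}" "\<Psi> \<noteq> {}" "\<Phi> \<inter> \<Psi> = {}"
proof -
  have "effres N S \<rho> K \<gamma> lam n (\<kappa> n ` \<Phi>) (\<kappa> n ` \<Psi>) = 0" if "\<Phi> = {} \<or> \<Psi> = {} \<or> \<Phi> \<inter> \<Psi> \<noteq> {}" for n
    using that by (auto simp: effres_eq capacity_empty)
  then have "\<Phi> \<noteq> {} \<and> \<Psi> \<noteq> {} \<and> \<Phi> \<inter> \<Psi> = {}" using assms by (cases "\<Phi> = {} \<or> \<Psi> = {} \<or> \<Phi> \<inter> \<Psi> \<noteq> {}") auto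
  then show "\<Phi> \<noteq> {}" "\<Psi> \<noteq> {}" "\<Phi> \<inter> \<Psi> = {}" by simp_all
qed

locale condenser = natural_random_walk N S \<rho> K \<gamma> lam
  for N :: nat and S :: "nat \<Rightarrow> 'a::euclidean_space \<Rightarrow> 'a" and \<rho> :: "nat \<Rightarrow> real" and K :: "'a set"
    and \<gamma> lam :: real +
  fixes \<Phi> \<Psi> :: "'a set" and \<kappa> :: "nat \<Rightarrow> 'a \<Rightarrow> nat list"
  assumes closed_plates: "closed \<Phi>" "closed \<Psi>" and plates_subset_K: "\<Phi> \<subseteq> K" "\<Psi> \<subseteq> K"
    and plates_nonempty: "\<Phi> \<noteq> {}" "\<Psi> \<noteq> {}" and plates_disjoint: "\<Phi> \<inter> \<Psi> = {}"
    and kappa_seq: "kappa_seq N S \<rho> K \<kappa>"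
begin

abbreviation "level_resistance n \<equiv> effres N S \<rho> K \<gamma> lam n (\<kappa> n ` \<Phi>) (\<kappa> n ` \<Psi>)"

definition "level_capacity n = capacity (X_upto n) (\<kappa> n ` \<Phi>) (\<kappa> n ` \<Psi>)"

definition "potential f \<longleftrightarrow> (\<exists>u. boundary_value f u \<and> separates \<Phi> \<Psi> u)"

lemma geo_ray_kappa: "\<xi> \<in> K \<Longrightarrow> geo_ray N S \<rho> K \<xi> (\<lambda>n. \<kappa> n \<xi>)"
  using kappa_seq by (simp add: kappa_seq_def)

lemma kappa_J: "\<xi> \<in> K \<Longrightarrow> \<kappa> n \<xi> \<in> \<J> n"
  and kappa_cell: "\<xi> \<in> K \<Longrightarrow> \<xi> \<in> cell (\<kappa> n \<xi>)"
  using geo_ray_kappa by (auto simp: geo_ray_def)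

lemma eventually_plates_separated: "\<forall>\<^sub>F n in sequentially. \<kappa> n ` \<Phi> \<inter> \<kappa> n ` \<Psi> = {}"
proof -
  have "compact \<Phi>"
    using compact_Int_closed[OF K_compact closed_plates(1)] plates_subset_K(1) by (simp add: Int_absorb1)
  then obtain d where d: "d > 0" "\<forall>\<xi>\<in>\<Phi>. \<forall>\<eta>\<in>\<Psi>. d \<le> dist \<xi> \<eta>"
    using separate_compact_closed[OF _ closed_plates(2) plates_disjoint] by blast
  have "\<forall>\<^sub>F n in sequentially. diameter K * r ^ n < d"
    using r_bounds d(1) by (intro eventually_mult_power_less) auto
  then show ?thesis
  proof eventually_elim
    case (elim n)
    have False if "\<xi> \<in> \<Phi>" "\<eta> \<in> \<Psi>" "\<kappa> n \<xi> = \<kappa> n \<eta>" for \<xi> \<eta>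
    proof -
      have "\<xi> \<in> K" "\<eta> \<in> K" using that plates_subset_K by auto
      then have "dist \<xi> \<eta> \<le> diameter K * r ^ n"
        using dist_cell_J[OF kappa_J kappa_cell, where y = \<eta>] kappa_cell[of \<eta> n] that(3) by simp
      then show False using elim d(2) that(1,2) by force
    qed
    then show ?case by auto
  qed
qed

lemma level_capacity_eventually_less:
  assumes g: "potential g" and M: "\<And>n. energy_upto n g \<le> M" and e: "e > 0"
  shows "\<forall>\<^sub>F n in sequentially. level_capacity n < M + e"
proof -
  obtain u where u: "boundary_value g u" "separates \<Phi> \<Psi> u" using g by (auto simp: potential_def)
  obtain d where d: "d > 0" "d < 1 / 2" "(1 / (1 - 2 * d))\<^sup>2 * M < M + e"
    using ex_rescaling_less[OF e] by blast
  have "\<forall>\<^sub>F n in sequentially. \<forall>y\<in>\<J> n. \<forall>\<xi>\<in>cell y. \<bar>g y - u \<xi>\<bar> < d"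
    using u(1) d(1) unfolding boundary_value_iff by blast
  then show ?thesis
  proof eventually_elim
    case (elim n)
    have close: "\<bar>g (\<kappa> n \<xi>) - u \<xi>\<bar> < d" if "\<xi> \<in> K" for \<xi> using elim kappa_J kappa_cell that by blast
    have "level_capacity n \<le> (1 / (1 - 2 * d))\<^sup>2 * energy_upto n g"
      unfolding level_capacity_def
    proof (rule capacity_le_of_approximate)
      show "1 - d \<le> g x" if "x \<in> \<kappa> n ` \<Phi>" for x
        using that close u(2) plates_subset_K(1) by (force simp: separates_def)
      show "g x \<le> d" if "x \<in> \<kappa> n ` \<Psi>" for x
        using that close u(2) plates_subset_K(2) by (force simp: separates_def)
    qed (use d in auto)
    also have "\<dots> \<le> (1 / (1 - 2 * d))\<^sup>2 * M" using M by (intro mult_left_mono) auto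
    finally show ?case using d(3) by linarith
  qed
qed

lemma boundary_trace_of_pointwise_limit:
  assumes lim: "\<And>x. (\<lambda>k. F k x) \<longlonglongrightarrow> f x" and f: "energy f < top"
    and s: "\<And>k. k \<le> s k" and M: "\<And>k. energy_upto (s k) (F k) \<le> M"
    and \<xi>: "\<xi> \<in> K" and v: "\<And>k. F k (\<kappa> (s k) \<xi>) = v"
  shows "boundary_trace f \<xi> = v"
proof (rule LIMSEQ_unique)
  show "(\<lambda>m. f (\<kappa> m \<xi>)) \<longlonglongrightarrow> boundary_trace f \<xi>"
    using boundary_value_tendsto[OF boundary_value_boundary_trace[OF f] geo_ray_kappa[OF \<xi>]] .
  have bound: "norm (f (\<kappa> m \<xi>) - v) \<le> variation_bound M * decay_rate ^ m" for m
    unfolding real_norm_def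
  proof (rule LIMSEQ_le_const2)
    show "(\<lambda>k. \<bar>F k (\<kappa> m \<xi>) - v\<bar>) \<longlonglongrightarrow> \<bar>f (\<kappa> m \<xi>) - v\<bar>" by (intro tendsto_intros lim)
    have "\<bar>F k (\<kappa> m \<xi>) - v\<bar> \<le> variation_bound M * decay_rate ^ m" if "m \<le> k" for k
      unfolding v[of k, symmetric]
    proof (rule prefix_increment_le[OF M kappa_J[OF \<xi>] order_refl kappa_J[OF \<xi>]])
      show le: "m \<le> s k" using that s[of k] by simp
      show "prefix (\<kappa> m \<xi>) (\<kappa> (s k) \<xi>)" using geo_ray_prefix[OF geo_ray_kappa[OF \<xi>] le] .
    qed
    then show "\<exists>l. \<forall>k\<ge>l. \<bar>F k (\<kappa> m \<xi>) - v\<bar> \<le> variation_bound M * decay_rate ^ m" by blast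
  qed
  have "(\<lambda>m. variation_bound M * decay_rate ^ m) \<longlonglongrightarrow> 0"
    using decay_rate_bounds by (intro tendsto_mult_right_zero LIMSEQ_power_zero) auto
  then have "(\<lambda>m. f (\<kappa> m \<xi>) - v) \<longlonglongrightarrow> 0"
    by (rule Lim_null_comparison[OF always_eventually[OF allI[OF bound]]])
  then show "(\<lambda>m. f (\<kappa> m \<xi>)) \<longlonglongrightarrow> v" by (rule LIM_zero_cancel)
qed

lemma potential_of_pointwise_limit:
  assumes lim: "\<And>x. (\<lambda>k. F k x) \<longlonglongrightarrow> f x" and F: "\<And>k. separates (\<kappa> (s k) ` \<Phi>) (\<kappa> (s k) ` \<Psi>) (F k)"
    and s: "\<And>k. k \<le> s k" and E: "\<And>k. energy_upto (s k) (F k) \<le> E k" and L: "E \<longlonglongrightarrow> L"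
  shows "potential f" "energy f \<le> ennreal L"
proof -
  have energy: "energy_upto n f \<le> L" for n
  proof (rule LIMSEQ_le[OF energy_on_tendsto[OF lim] L])
    have "energy_upto n (F k) \<le> E k" if "n \<le> k" for k
      using energy_upto_mono[of n "s k" "F k"] E[of k] s[of k] that by linarith
    then show "\<exists>m. \<forall>k\<ge>m. energy_upto n (F k) \<le> E k" by blast
  qed
  then show "energy f \<le> ennreal L" using energy_le_ennreal_iff by blast
  then have f: "energy f < top" by (simp add: le_less_trans)
  have "Bseq E" using L by (intro convergent_imp_Bseq convergentI)
  then obtain M where "\<And>k. \<bar>E k\<bar> \<le> M" by (auto simp: Bseq_def)
  then have M: "energy_upto (s k) (F k) \<le> M" for k using E[of k] by (meson abs_le_D1 order_trans)
  note trace_eq = boundary_trace_of_pointwise_limit[OF lim f s M]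
  have "separates \<Phi> \<Psi> (boundary_trace f)"
    unfolding separates_def
  proof (intro conjI ballI)
    show "boundary_trace f \<xi> = 1" if "\<xi> \<in> \<Phi>" for \<xi>
      using that plates_subset_K(1) F by (intro trace_eq) (auto simp: separates_def)
    show "boundary_trace f \<xi> = 0" if "\<xi> \<in> \<Psi>" for \<xi>
      using that plates_subset_K(2) F by (intro trace_eq) (auto simp: separates_def)
  qed
  then show "potential f" using boundary_value_boundary_trace[OF f] by (auto simp: potential_def)
qed

lemma level_capacity_limit_attained:
  assumes s: "strict_mono (s :: nat \<Rightarrow> nat)" and L: "(\<lambda>k. level_capacity (s k)) \<longlonglongrightarrow> L"
  shows "\<exists>f. potential f \<and> energy f \<le> ennreal L"
proof -
  obtain m where m: "\<And>n. n \<ge> m \<Longrightarrow> \<kappa> n ` \<Phi> \<inter> \<kappa> n ` \<Psi> = {}"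
    using eventually_plates_separated by (auto simp: eventually_sequentially)
  define s' where "s' k = s (k + m)" for k
  have s'_ge: "k + m \<le> s' k" for k using seq_suble[OF s, of "k + m"] by (simp add: s'_def)
  let ?E = "\<lambda>k. level_capacity (s' k) + 1 / (real k + 1)"
  have "\<exists>f. separates (\<kappa> (s' k) ` \<Phi>) (\<kappa> (s' k) ` \<Psi>) f \<and> energy_upto (s' k) f < ?E k \<and> (\<forall>x. 0 \<le> f x \<and> f x \<le> 1)" for k
    unfolding level_capacity_def using s'_ge[of k] by (intro capacity_near_minimizer m) auto
  then obtain F where F: "\<And>k. separates (\<kappa> (s' k) ` \<Phi>) (\<kappa> (s' k) ` \<Psi>) (F k)"
      "\<And>k. energy_upto (s' k) (F k) < ?E k" "\<And>k x. 0 \<le> F k x \<and> F k x \<le> 1" by metis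
  obtain t f where t: "strict_mono t" and f: "\<And>x. (\<lambda>k. F (t k) x) \<longlonglongrightarrow> f x"
    using pointwise_convergent_subsequence[of 0 F 1] F(3) by blast
  have "(\<lambda>k. level_capacity (s' k) + 1 / (real k + 1)) \<longlonglongrightarrow> L + 0"
    unfolding s'_def using LIMSEQ_ignore_initial_segment[OF L, of m] LIMSEQ_inverse_real_of_nat
    by (intro tendsto_add) (simp_all add: add.commute divide_inverse)
  then have E: "(\<lambda>k. ?E (t k)) \<longlonglongrightarrow> L" using LIMSEQ_subseq_LIMSEQ[OF _ t] by (fastforce simp: o_def)
  have "k \<le> s' (t k)" for k using seq_suble[OF t, of k] s'_ge[of "t k"] by simp
  then show ?thesis
    using potential_of_pointwise_limit[OF f F(1) _ less_imp_le[OF F(2)] E] by blast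
qed

lemma level_capacity_limit_le:
  assumes L: "level_capacity \<longlonglongrightarrow> L" and g: "potential g"
  shows "ennreal L \<le> energy g"
proof (cases "energy g = top")
  case False
  then obtain M where M: "energy g = ennreal M" "\<And>n. energy_upto n g \<le> M"
    using finite_energy_cases by (auto simp: less_top)
  have "L \<le> M"
  proof (rule field_le_epsilon)
    fix e :: real assume "e > 0"
    then have "\<forall>\<^sub>F n in sequentially. level_capacity n < M + e"
      by (rule level_capacity_eventually_less[OF g M(2)])
    then show "L \<le> M + e"
      by (intro tendsto_upperbound[OF L]) (auto elim: eventually_mono)
  qed
  then show ?thesis using M(1) by (simp add: ennreal_leI)
qed simp

lemma potential_energy_pos:
  assumes "potential f"
  shows "energy f > 0"
proof (rule ccontr)
  assume "\<not> energy f > 0"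
  then have "energy_upto n f \<le> 0" for n using energy_le_iff[of 0 f] by simp
  then have const: "f x = f []" if "x \<in> X" for x using energy_0_imp_const that by blast
  obtain u where u: "boundary_value f u" "separates \<Phi> \<Psi> u" using assms by (auto simp: potential_def)
  have "boundary_value f (\<lambda>_. f [])"
    by (rule boundary_value_transform[OF boundary_value_const])
       (use const J_X in \<open>auto intro!: always_eventually\<close>)
  then have "u \<xi> = f []" if "\<xi> \<in> K" for \<xi> using boundary_value_unique[OF u(1)] that by blast
  then show False using u(2) plates_nonempty plates_subset_K unfolding separates_def by fastforce
qed

lemma eventually_level_resistance_eq:
  "\<forall>\<^sub>F n in sequentially. level_resistance n = 1 / level_capacity n"
  using eventually_plates_separated by eventually_elim (simp add: effres_eq level_capacity_def)

lemma liminf_level_capacity_finite: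
  assumes R: "lim level_resistance > 0"
  obtains L where "0 \<le> L" "liminf (\<lambda>n. ereal (level_capacity n)) = ereal L"
proof -
  let ?l = "liminf (\<lambda>n. ereal (level_capacity n))"
  have "?l \<noteq> \<infinity>"
  proof
    assume "?l = \<infinity>"
    then have "filterlim level_capacity at_top sequentially"
      by (simp add: Liminf_PInfty flip: tendsto_PInfty_eq_at_top)
    then have "(\<lambda>n. 1 / level_capacity n) \<longlonglongrightarrow> 0"
      using tendsto_inverse_0_at_top by (simp add: divide_inverse)
    then have "level_resistance \<longlonglongrightarrow> 0"
      by (rule Lim_transform_eventually) (use eventually_level_resistance_eq in eventually_elim, simp)
    then show False using R limI by force
  qed
  moreover have "\<forall>\<^sub>F n in sequentially. 0 \<le> ereal (level_capacity n)"
    using eventually_plates_separated by eventually_elim (simp add: level_capacity_def capacity_nonneg)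
  then have "0 \<le> ?l" by (rule Liminf_bounded)
  ultimately show thesis using that by (cases ?l) auto
qed

lemma level_capacity_limit_exists:
  assumes R: "lim level_resistance > 0"
  obtains L f where "level_capacity \<longlonglongrightarrow> L" "0 < L" "potential f" "energy f = ennreal L" "lim level_resistance = 1 / L"
proof -
  let ?C = "\<lambda>n. ereal (level_capacity n)"
  obtain L where L: "0 \<le> L" "liminf ?C = ereal L" using R by (rule liminf_level_capacity_finite)
  obtain s where s: "strict_mono s" "(?C \<circ> s) \<longlonglongrightarrow> liminf ?C" using liminf_subseq_lim by blast
  have "(\<lambda>k. level_capacity (s k)) \<longlonglongrightarrow> L" using s(2) unfolding L(2) by (simp add: o_def)
  then obtain f where f: "potential f" "energy f \<le> ennreal L"
    using level_capacity_limit_attained[OF s(1)] by blast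
  have f_upto: "energy_upto n f \<le> L" for n using f(2) L(1) energy_le_iff by blast
  have lim: "level_capacity \<longlonglongrightarrow> L"
  proof (rule order_tendstoI)
    fix a assume "a < L"
    then have "ereal a < liminf ?C" by (simp add: L(2))
    then show "\<forall>\<^sub>F n in sequentially. a < level_capacity n" by (auto dest: less_LiminfD)
  next
    fix a assume "L < a"
    then show "\<forall>\<^sub>F n in sequentially. level_capacity n < a"
      using level_capacity_eventually_less[OF f(1) f_upto, of "a - L"] by simp
  qed
  have energy: "energy f = ennreal L"
    using f level_capacity_limit_le[OF lim f(1)] by (intro antisym)
  then have "0 < L" using potential_energy_pos[OF f(1)] by simp
  then have "(\<lambda>n. 1 / level_capacity n) \<longlonglongrightarrow> 1 / L" by (intro tendsto_intros lim) simp
  then have "level_resistance \<longlonglongrightarrow> 1 / L"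
    by (rule Lim_transform_eventually) (use eventually_level_resistance_eq in eventually_elim, simp)
  then show thesis using that[OF lim \<open>0 < L\<close> f(1) energy] limI by blast
qed

lemma minimizer_harmonic:
  assumes L: "level_capacity \<longlonglongrightarrow> L" and f: "potential f" "energy f \<le> ennreal L" "0 \<le> L" and x: "x \<in> X"
  shows "laplacian f x = 0"
proof (rule eq_0_of_quadratic_nonneg[OF conductance_pos[OF x]])
  fix t
  let ?g = "\<lambda>y. f y + (if y = x then t else 0)"
  let ?M = "L - 2 * t * laplacian f x + t\<^sup>2 * conductance x"
  have "energy_upto n ?g \<le> ?M" for n
  proof -
    let ?m = "max n (Suc (depth x))"
    have "energy_upto n ?g \<le> energy_upto ?m ?g" by (rule energy_upto_mono) simp
    also have "\<dots> \<le> energy_upto ?m f - 2 * t * laplacian f x + t\<^sup>2 * conductance x"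
      using X_J[OF x] neighbours_X_upto[OF X_J[OF x]] J_X_upto
      by (intro energy_on_perturb_le finite_X_upto) auto
    also have "\<dots> \<le> ?M" using f energy_le_iff[of L f] by simp
    finally show ?thesis .
  qed
  then have g: "energy ?g \<le> ennreal ?M" "0 \<le> ?M" using energy_le_ennreal_iff by blast+
  have "potential ?g"
  proof -
    obtain u where u: "boundary_value f u" "separates \<Phi> \<Psi> u" using f(1) by (auto simp: potential_def)
    have "\<forall>\<^sub>F n in sequentially. depth x < n" by (rule eventually_gt_at_top)
    then have "\<forall>\<^sub>F n in sequentially. \<forall>y\<in>\<J> n. ?g y = f y" by eventually_elim (use lev_eq in auto)
    with u(1) have "boundary_value ?g u" by (rule boundary_value_transform)
    then show ?thesis using u(2) by (auto simp: potential_def)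
  qed
  then have "ennreal L \<le> ennreal ?M" using level_capacity_limit_le[OF L] g(1) order_trans by blast
  then show "0 \<le> - 2 * t * laplacian f x + t\<^sup>2 * conductance x" using g(2) by (simp add: ennreal_le_iff)
qed

lemma minimizer_unique:
  assumes L: "level_capacity \<longlonglongrightarrow> L" "0 \<le> L"
    and f: "energy f \<le> ennreal L" "boundary_value f u" "separates \<Phi> \<Psi> u"
    and g: "energy g \<le> ennreal L" "boundary_value g v" "separates \<Phi> \<Psi> v" and \<xi>: "\<xi> \<in> K"
  shows "u \<xi> = v \<xi>"
proof -
  let ?h = "\<lambda>x. (f x + g x) / 2" and ?d = "\<lambda>x. (f x - g x) / 2"
  have fg: "energy_upto n f \<le> L" "energy_upto n g \<le> L" for n using f(1) g(1) L(2) energy_le_iff by blast+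
  have half_sum: "boundary_value (\<lambda>x. (f x + a * g x) / 2) (\<lambda>\<xi>. (u \<xi> + a * v \<xi>) / 2)" for a
    using boundary_value_scale[OF boundary_value_add[OF f(2) boundary_value_scale[OF g(2)]], of "1 / 2" a] by simp
  have "potential ?h"
    using half_sum[of 1] f(3) g(3) unfolding potential_def separates_def by fastforce
  then have h_ge: "ennreal L \<le> energy ?h" by (rule level_capacity_limit_le[OF L(1)])
  have "energy_upto n ?d \<le> 0" for n
  proof -
    have "energy_upto k ?h \<le> L - energy_upto n ?d" for k
      using energy_on_parallelogram[of "X_upto (max k n)" f g] fg[of "max k n"]
        energy_upto_mono[of k "max k n" ?h] energy_upto_mono[of n "max k n" ?d] by simp
    then have "energy ?h \<le> ennreal (L - energy_upto n ?d)" "0 \<le> L - energy_upto n ?d"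
      using energy_le_ennreal_iff by blast+
    then have "ennreal L \<le> ennreal (L - energy_upto n ?d)" using h_ge order_trans by blast
    then show ?thesis using \<open>0 \<le> L - energy_upto n ?d\<close> by (simp add: ennreal_le_iff)
  qed
  then have "?d x = ?d []" if "x \<in> X" for x using energy_0_imp_const[of ?d] that by blast
  then have "boundary_value ?d (\<lambda>_. ?d [])"
    by (intro boundary_value_transform[OF boundary_value_const]) (use J_X in \<open>auto intro!: always_eventually\<close>)
  moreover have "boundary_value ?d (\<lambda>\<xi>. (u \<xi> - v \<xi>) / 2)" using half_sum[of "-1"] by simp
  ultimately have const: "(u \<eta> - v \<eta>) / 2 = ?d []" if "\<eta> \<in> K" for \<eta> using boundary_value_unique that by blast
  obtain \<eta> where "\<eta> \<in> \<Phi>" using plates_nonempty(1) by blast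
  then have "?d [] = 0" using const[of \<eta>] f(3) g(3) plates_subset_K(1) by (auto simp: separates_def)
  then show ?thesis using const[OF \<xi>] by simp
qed

lemma potential_H:
  assumes u: "u \<in> boundary_domain" "admissible K \<Phi> \<Psi> u"
  shows "boundary_value (H u) u" "potential (H u)"
proof -
  show "boundary_value (H u) u"
    using u by (intro boundary_value_H) (auto simp: DK_def admissible_def)
  then show "potential (H u)" using u(2) by (auto simp: potential_def separates_def admissible_def)
qed

lemma boundary_trace_minimizer:
  assumes L: "level_capacity \<longlonglongrightarrow> L" "0 \<le> L" and f: "potential f" "energy f = ennreal L"
  shows "boundary_trace f \<in> boundary_domain" "admissible K \<Phi> \<Psi> (boundary_trace f)"
    and "boundary_energy (boundary_trace f) = ennreal L"
proof -
  have finite: "energy f < top" using f(2) by simp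
  note trace = borel_measurable_boundary_trace[OF finite] continuous_on_boundary_trace[OF finite]
    boundary_value_boundary_trace[OF finite]
  have "H (boundary_trace f) x = f x" if "x \<in> X" for x
    using minimizer_harmonic[OF L(1) f(1) _ L(2)] f(2) by (intro H_eq_harmonic that trace) auto
  then show energy: "boundary_energy (boundary_trace f) = ennreal L"
    unfolding boundary_energy_eq f(2)[symmetric] by (rule energy_cong)
  then show "boundary_trace f \<in> boundary_domain"
    using trace energy by (auto simp: DK_def intro!: integrable_nu_continuous continuous_intros)
  obtain u where u: "boundary_value f u" "separates \<Phi> \<Psi> u" using f(1) by (auto simp: potential_def)
  have "boundary_trace f \<xi> = u \<xi>" if "\<xi> \<in> K" for \<xi> using boundary_value_unique[OF trace(3) u(1) that] .
  then show "admissible K \<Phi> \<Psi> (boundary_trace f)"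
    using trace(2) u(2) plates_subset_K by (auto simp: admissible_def separates_def)
qed

theorem dirichlet_principle:
  assumes R: "lim level_resistance > 0"
  shows "\<exists>u\<in>boundary_domain. admissible K \<Phi> \<Psi> u \<and> ennreal (1 / lim level_resistance) = boundary_energy u \<and>
    boundary_energy u = (INF u'\<in>{u'\<in>boundary_domain. admissible K \<Phi> \<Psi> u'}. boundary_energy u') \<and>
    (\<forall>u'\<in>boundary_domain. admissible K \<Phi> \<Psi> u' \<and> boundary_energy u' = boundary_energy u \<longrightarrow> (\<forall>\<xi>\<in>K. u' \<xi> = u \<xi>))"
proof -
  obtain L f where L: "level_capacity \<longlonglongrightarrow> L" "0 < L" and f: "potential f" "energy f = ennreal L"
    and R_eq: "lim level_resistance = 1 / L"
    using R by (rule level_capacity_limit_exists)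
  note u = boundary_trace_minimizer[OF L(1) less_imp_le[OF L(2)] f]
  have minimal: "boundary_energy (boundary_trace f) \<le> boundary_energy u'"
    if "u' \<in> boundary_domain" "admissible K \<Phi> \<Psi> u'" for u'
    using level_capacity_limit_le[OF L(1) potential_H(2)[OF that]] by (simp only: u(3) boundary_energy_eq[of u'])
  show ?thesis
  proof (intro bexI[OF _ u(1)] conjI ballI impI)
    show "admissible K \<Phi> \<Psi> (boundary_trace f)" by (rule u(2))
    show "ennreal (1 / lim level_resistance) = boundary_energy (boundary_trace f)" by (simp add: R_eq u(3))
    show "boundary_energy (boundary_trace f) =
        (INF u'\<in>{u'\<in>boundary_domain. admissible K \<Phi> \<Psi> u'}. boundary_energy u')"
      using u(1,2) minimal by (intro antisym INF_greatest INF_lower) auto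
    fix u' \<xi> assume u': "u' \<in> boundary_domain" and "\<xi> \<in> K"
      and eq: "admissible K \<Phi> \<Psi> u' \<and> boundary_energy u' = boundary_energy (boundary_trace f)"
    then show "u' \<xi> = boundary_trace f \<xi>"
      using u(2) u(3)[unfolded boundary_energy_eq] L(2) f(2) boundary_value_boundary_trace[of f]
      by (intro minimizer_unique[OF L(1) _ _ potential_H(1)[OF u'], where g = f])
         (auto simp: boundary_energy_eq admissible_def separates_def)
  qed
qed

end

theorem theorem4p2:
  fixes N :: nat and S :: "nat \<Rightarrow> 'a::euclidean_space \<Rightarrow> 'a" and \<rho> :: "nat \<Rightarrow> real"
    and K :: "'a set" and \<gamma> lam :: real and \<Phi> \<Psi> :: "'a set"
  assumes "N \<ge> 2"
    and "\<forall>i\<in>{1..N}. 0 < \<rho> i \<and> \<rho> i < 1 \<and> similitude (S i) (\<rho> i)"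
    and "osc N S"
    and "compact K" and "K \<noteq> {}" and "K = (\<Union>i\<in>{1..N}. S i ` K)"
    and "0 < \<gamma>"
    and "0 < lam" and "lam < rmin N \<rho> powr hausdorff_dim K"
    and "closed \<Phi>" and "\<Phi> \<subseteq> K" and "closed \<Psi>" and "\<Psi> \<subseteq> K"
    and "Rlim N S \<rho> K \<gamma> lam \<Phi> \<Psi> > 0"
  shows "\<exists>u\<in>DK N S \<rho> K \<gamma> lam. admissible K \<Phi> \<Psi> u \<and>
           ennreal (1 / Rlim N S \<rho> K \<gamma> lam \<Phi> \<Psi>) = EK N S \<rho> K \<gamma> lam u \<and>
           EK N S \<rho> K \<gamma> lam u =
             (INF u'\<in>{u'\<in>DK N S \<rho> K \<gamma> lam. admissible K \<Phi> \<Psi> u'}. EK N S \<rho> K \<gamma> lam u') \<and>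
           (\<forall>u'\<in>DK N S \<rho> K \<gamma> lam. admissible K \<Phi> \<Psi> u' \<and>
              EK N S \<rho> K \<gamma> lam u' = EK N S \<rho> K \<gamma> lam u \<longrightarrow> (\<forall>\<xi>\<in>K. u' \<xi> = u \<xi>))"
proof -
  interpret natural_random_walk N S \<rho> K \<gamma> lam by unfold_locales (fact assms)+
  define \<kappa> where "\<kappa> = (SOME \<kappa>. kappa_seq N S \<rho> K \<kappa>)"
  have kappa: "kappa_seq N S \<rho> K \<kappa>" unfolding \<kappa>_def by (rule someI_ex[OF kappa_seq_exists])
  have R: "Rlim N S \<rho> K \<gamma> lam \<Phi> \<Psi> = lim (\<lambda>n. effres N S \<rho> K \<gamma> lam n (\<kappa> n ` \<Phi>) (\<kappa> n ` \<Psi>))"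
    unfolding Rlim_def Let_def \<kappa>_def ..
  interpret condenser N S \<rho> K \<gamma> lam \<Phi> \<Psi> \<kappa>
    using assms(10-14) kappa plates_of_effres_limit_pos[of \<kappa> \<Phi> \<Psi>] by unfold_locales (auto simp: R)
  show ?thesis unfolding R by (rule dirichlet_principle) (use assms(14) R in simp)
qed

end
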